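(* Let $n\geq 2$, let $M$ be an $n$-dimensional smooth manifold-with-boundary equipped with a collar neighbourhood and a basepoint on its boundary, let $X$ be a based path-connected space, and let $\mathcal{A}$ be an abelian category. Let $\mathcal{B}(M,X)$ be the partial braid category. Then for every functor $T\colon \mathcal{B}(M,X)\to\mathcal{A}$ we have $\deg^{\dagger}(T)=\deg^{\ddagger}(T)$, where $\deg^{\dagger}$ is the degree with respect to the single stabiliser $(s,\imath)$ of $\mathcal{B}(M,X)$ and $\deg^{\ddagger}$ is the degree with respect to the family of stabilisers coming from the structure of $\mathcal{B}(M,X)$ as a left-module over the monoidal category $\mathcal{B}(\mathbb{D}^n,X)$.
   Context: **Degree.** A category with stabilisers is a small category $\mathcal{C}$ with a family of endofunctors $s_i\colon\mathcal{C}\to\mathcal{C}$ and natural transformations $\imath_i\colon \mathrm{id}\to s_i$ ($i\in I$). For a functor $T\colon\mathcal{C}\to\mathcal{A}$, $\deg(T)\in\{-1,0,1,\ldots,\infty\}$ is defined recursively: $\deg(T)\leq -1$ iff $T=0$; for $d\geq 0$, $\deg(T)\leq d$ iff $\deg(\mathrm{coker}(T\imath_i\colon T\to T s_i))\leq d-1$ for all $i\in I$; and $\deg(T)=\infty$ if $\deg(T)\leq d$ for no finite $d$. **Manifolds.** A collar neighbourhood is a proper embedding $c\colon\partial M\times[0,\infty]\to M$ with $c(y,0)=y$; let $p\in\partial M$ be the basepoint and $x_0\in X$ the basepoint of $X$. Put $a_t=c(p,t)$ for $t\in[0,\infty]$, and let $e\colon M\hookrightarrow M$ be the embedding $e(c(y,t))=c(y,t+1)$,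 equal to the identity outside the collar. $C_k(M,X)$ is the space of unordered configurations $\{(m_1,x_1),\ldots,(m_k,x_k)\}$ of $k$ distinct points $m_i\in M$ with labels $x_i\in X$. **The category $\mathcal{B}(M,X)$.** Objects are the integers $0,1,2,\ldots$. A morphism $m\to m'$ is a choice of $k\leq\min(m,m')$ and a path in $C_k(M,X)$, up to endpoint-preserving homotopy, from a $k$-element subset of $\{(a_1,x_0),\ldots,(a_m,x_0)\}$ to a $k$-element subset of $\{(a_1,x_0),\ldots,(a_{m'},x_0)\}$. Composition is concatenation of paths after deleting the strands for which the concatenated path is defined only half-way. **First structure ($\dagger$).** One stabiliser $(s,\imath)$: $s(m)=m+1$ on objects, and $s$ sends a path $\gamma$ in $C_k(M,X)$ to $s_k\circ\gamma$ where $s_k\{(m_1,x_1),\ldots,(m_k,x_k)\}=\{(a_1,x_0),(e(m_1),x_1),\ldots,(e(m_k),x_k)\}$. The morphism $\imath_m\colon m\to m+1$ is the path $t\mapsto\{(a_{1+t},x_0),\ldots,(a_{m+t},x_0)\}$. **Second structure ($\ddagger$).** The closed unit disc $\mathbb{D}^n$ is equipped with a collar neighbourhood and boundary basepoint, with corresponding points $a_t^{\mathbb{D}}$. Boundary connected sum makes $\mathcal{B}(\mathbb{D}^n,X)$ a strict monoidal category with unit object $0$ (which is null), and $\mathcal{B}(M,X)$ a strict left-module over it, where the boundary connected sum of $\mathbb{D}^n$ with $M$ is formed at the component of $\partial M$ containing $p$. Explicitly, $m\oplus l=m+l$ on objects, and on morphisms $\beta\colon m\to m'$ of $\mathcal{B}(\mathbb{D}^n,X)$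 and $\gamma\colon l\to l'$ of $\mathcal{B}(M,X)$ one takes $N\geq\max(m,m')$, embeds $\mathbb{D}^n$ into $c(\partial M\times[0,N+\frac12])$ as a neighbourhood of the arc $\{a_t \mid \frac12\leq t\leq N\}$ with $a^{\mathbb{D}}_i\mapsto a_i$ for $1\leq i\leq N$ and a neighbourhood of the corresponding arc sent to a neighbourhood of the arc (with a fixed choice of local orientation near $p$), places $\beta$ in the image of this embedding and $\gamma$ in $M$ via $e^{N+1}$, and then pre- and post-composes with the order-preserving slides of points along the arc $\{a_t\}$ (with constant labels $x_0$) that identify $\{a_1,\ldots,a_m,a_{N+2},\ldots,a_{N+1+l}\}$ with $\{a_1,\ldots,a_{m+l}\}$, and similarly for $m',l'$. In particular $1\oplus -=s$. The second structure consists of the stabilisers, indexed by all objects $m$ of $\mathcal{B}(\mathbb{D}^n,X)$, given by the endofunctors $m\oplus -$ and the natural transformations $\mathrm{id}=0\oplus -\to m\oplus -$ induced by the unique morphism $0\to m$ in $\mathcal{B}(\mathbb{D}^n,X)$. *)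

theory Defs
  imports "HOL-Analysis.Analysis" "HOL-Homology.Homology"
begin

record ('o, 'a) cat =
  Obj :: "'o set"
  Arr :: "'a set"
  Dom :: "'a \<Rightarrow> 'o"
  Cod :: "'a \<Rightarrow> 'o"
  Idn :: "'o \<Rightarrow> 'a"
  Cmp :: "'a \<Rightarrow> 'a \<Rightarrow> 'a"

text \<open>\<^term>\<open>Cmp C g f\<close> is the composite "g after f".\<close>

definition homset :: "('o, 'a) cat \<Rightarrow> 'o \<Rightarrow> 'o \<Rightarrow> 'a set" where
  "homset C x y = {f \<in> Arr C. Dom C f = x \<and> Cod C f = y}"

definition is_category :: "('o, 'a) cat \<Rightarrow> bool" where
  "is_category C \<longleftrightarrow>
     (\<forall>f\<in>Arr C. Dom C f \<in> Obj C \<and> Cod C f \<in> Obj C) \<and>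
     (\<forall>x\<in>Obj C. Idn C x \<in> homset C x x) \<and>
     (\<forall>f\<in>Arr C. \<forall>g\<in>Arr C. Cod C f = Dom C g \<longrightarrow> Cmp C g f \<in> homset C (Dom C f) (Cod C g)) \<and>
     (\<forall>f\<in>Arr C. Cmp C f (Idn C (Dom C f)) = f \<and> Cmp C (Idn C (Cod C f)) f = f) \<and>
     (\<forall>f\<in>Arr C. \<forall>g\<in>Arr C. \<forall>h\<in>Arr C. Cod C f = Dom C g \<and> Cod C g = Dom C h \<longrightarrow>
        Cmp C h (Cmp C g f) = Cmp C (Cmp C h g) f)"

record ('o, 'a, 'p, 'b) functr =
  FObj :: "'o \<Rightarrow> 'p"
  FArr :: "'a \<Rightarrow> 'b"

definition is_functor :: "('o, 'a) cat \<Rightarrow> ('p, 'b) cat \<Rightarrow> ('o, 'a, 'p, 'b) functr \<Rightarrow> bool" where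
  "is_functor C D F \<longleftrightarrow>
     (\<forall>x\<in>Obj C. FObj F x \<in> Obj D) \<and>
     (\<forall>f\<in>Arr C. FArr F f \<in> homset D (FObj F (Dom C f)) (FObj F (Cod C f))) \<and>
     (\<forall>x\<in>Obj C. FArr F (Idn C x) = Idn D (FObj F x)) \<and>
     (\<forall>f\<in>Arr C. \<forall>g\<in>Arr C. Cod C f = Dom C g \<longrightarrow>
        FArr F (Cmp C g f) = Cmp D (FArr F g) (FArr F f))"

definition fcomp ::
  "('p, 'b, 'q, 'c) functr \<Rightarrow> ('o, 'a, 'p, 'b) functr \<Rightarrow> ('o, 'a, 'q, 'c) functr" where
  "fcomp G F = \<lparr>FObj = FObj G \<circ> FObj F, FArr = FArr G \<circ> FArr F\<rparr>"

definition zero_object :: "('o, 'a) cat \<Rightarrow> 'o \<Rightarrow> bool" where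
  "zero_object A z \<longleftrightarrow> z \<in> Obj A \<and>
     (\<forall>x\<in>Obj A. (\<exists>!f. f \<in> homset A z x) \<and> (\<exists>!f. f \<in> homset A x z))"

definition zero_arrow :: "('o, 'a) cat \<Rightarrow> 'a \<Rightarrow> bool" where
  "zero_arrow A f \<longleftrightarrow>
     (\<exists>z u v. zero_object A z \<and> u \<in> homset A (Dom A f) z \<and> v \<in> homset A z (Cod A f) \<and>
        f \<in> Arr A \<and> f = Cmp A v u)"

definition is_cokernel :: "('o, 'a) cat \<Rightarrow> 'a \<Rightarrow> 'a \<Rightarrow> bool" where
  "is_cokernel A f q \<longleftrightarrow> q \<in> Arr A \<and> Dom A q = Cod A f \<and> zero_arrow A (Cmp A q f) \<and>
     (\<forall>g\<in>Arr A. Dom A g = Cod A f \<and> zero_arrow A (Cmp A g f) \<longrightarrow>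
        (\<exists>!h. h \<in> homset A (Cod A q) (Cod A g) \<and> Cmp A h q = g))"

definition is_kernel :: "('o, 'a) cat \<Rightarrow> 'a \<Rightarrow> 'a \<Rightarrow> bool" where
  "is_kernel A f k \<longleftrightarrow> k \<in> Arr A \<and> Cod A k = Dom A f \<and> zero_arrow A (Cmp A f k) \<and>
     (\<forall>g\<in>Arr A. Cod A g = Dom A f \<and> zero_arrow A (Cmp A f g) \<longrightarrow>
        (\<exists>!h. h \<in> homset A (Dom A g) (Dom A k) \<and> Cmp A k h = g))"

definition is_monic :: "('o, 'a) cat \<Rightarrow> 'a \<Rightarrow> bool" where
  "is_monic A f \<longleftrightarrow> f \<in> Arr A \<and>
     (\<forall>x. \<forall>g\<in>homset A x (Dom A f). \<forall>h\<in>homset A x (Dom A f). Cmp A f g = Cmp A f h \<longrightarrow> g = h)"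

definition is_epic :: "('o, 'a) cat \<Rightarrow> 'a \<Rightarrow> bool" where
  "is_epic A f \<longleftrightarrow> f \<in> Arr A \<and>
     (\<forall>x. \<forall>g\<in>homset A (Cod A f) x. \<forall>h\<in>homset A (Cod A f) x. Cmp A g f = Cmp A h f \<longrightarrow> g = h)"

definition is_preadditive :: "('o, 'a) cat \<Rightarrow> ('a \<Rightarrow> 'a \<Rightarrow> 'a) \<Rightarrow> bool" where
  "is_preadditive A plusA \<longleftrightarrow> is_category A \<and>
     (\<forall>x\<in>Obj A. \<forall>y\<in>Obj A. \<exists>z.
        comm_group \<lparr>carrier = homset A x y, monoid.mult = plusA, one = z\<rparr>) \<and>
     (\<forall>x\<in>Obj A. \<forall>y\<in>Obj A. \<forall>z\<in>Obj A.
        \<forall>f\<in>homset A x y. \<forall>f'\<in>homset A x y. \<forall>g\<in>homset A y z. \<forall>g'\<in>homset A y z.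
          Cmp A g (plusA f f') = plusA (Cmp A g f) (Cmp A g f') \<and>
          Cmp A (plusA g g') f = plusA (Cmp A g f) (Cmp A g' f))"

definition is_biproduct ::
  "('o, 'a) cat \<Rightarrow> ('a \<Rightarrow> 'a \<Rightarrow> 'a) \<Rightarrow> 'o \<Rightarrow> 'o \<Rightarrow> 'o \<Rightarrow> 'a \<Rightarrow> 'a \<Rightarrow> 'a \<Rightarrow> 'a \<Rightarrow> bool" where
  "is_biproduct A plusA x y z i j p q \<longleftrightarrow>
     z \<in> Obj A \<and> i \<in> homset A x z \<and> j \<in> homset A y z \<and> p \<in> homset A z x \<and> q \<in> homset A z y \<and>
     Cmp A p i = Idn A x \<and> Cmp A q j = Idn A y \<and>
     plusA (Cmp A i p) (Cmp A j q) = Idn A z"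

text \<open>The addition of an abelian category is determined by the underlying category, so it is not
  kept as part of the data.\<close>

definition abelian_category :: "('o, 'a) cat \<Rightarrow> bool" where
  "abelian_category A \<longleftrightarrow>
     (\<exists>plusA. is_preadditive A plusA \<and>
        (\<forall>x\<in>Obj A. \<forall>y\<in>Obj A. \<exists>z i j p q. is_biproduct A plusA x y z i j p q)) \<and>
     (\<exists>z. zero_object A z) \<and>
     (\<forall>f\<in>Arr A. (\<exists>k. is_kernel A f k) \<and> (\<exists>q. is_cokernel A f q)) \<and>
     (\<forall>k. is_monic A k \<longrightarrow> (\<exists>f\<in>Arr A. is_kernel A f k)) \<and>
     (\<forall>q. is_epic A q \<longrightarrow> (\<exists>f\<in>Arr A. is_cokernel A f q))"

text \<open>\<^term>\<open>SFun S i\<close> is the endofunctor with index i, and \<^term>\<open>SNat S i x\<close> the component at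
  the object x of the natural transformation from the identity to it.\<close>

record ('i, 'o, 'a) stabilisers =
  SIdx :: "'i set"
  SFun :: "'i \<Rightarrow> ('o, 'a, 'o, 'a) functr"
  SNat :: "'i \<Rightarrow> 'o \<Rightarrow> 'a"

definition coker :: "('p, 'b) cat \<Rightarrow> 'b \<Rightarrow> 'b" where
  "coker A f = (SOME q. is_cokernel A f q)"

text \<open>The objectwise cokernel of a natural transformation with target G and components
  \<^term>\<open>\<tau> x\<close>; its effect on arrows is the induced map of cokernels.\<close>

definition coker_functor ::
  "('o, 'a) cat \<Rightarrow> ('p, 'b) cat \<Rightarrow> ('o, 'a, 'p, 'b) functr \<Rightarrow> ('o \<Rightarrow> 'b) \<Rightarrow> ('o, 'a, 'p, 'b) functr"
where
  "coker_functor C A G \<tau> =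
     \<lparr>FObj = (\<lambda>x. Cod A (coker A (\<tau> x))),
      FArr = (\<lambda>u. THE h.
        h \<in> homset A (Cod A (coker A (\<tau> (Dom C u)))) (Cod A (coker A (\<tau> (Cod C u)))) \<and>
        Cmp A h (coker A (\<tau> (Dom C u))) = Cmp A (coker A (\<tau> (Cod C u))) (FArr G u))\<rparr>"

text \<open>\<open>deg_less C A S d T\<close> means that T has degree at most \<open>d - 1\<close>; the shift lets the recursion
  start at the natural number 0.\<close>

fun deg_less ::
  "('o, 'a) cat \<Rightarrow> ('p, 'b) cat \<Rightarrow> ('i, 'o, 'a) stabilisers \<Rightarrow> nat \<Rightarrow> ('o, 'a, 'p, 'b) functr \<Rightarrow> bool"
where
  "deg_less C A S 0 T \<longleftrightarrow> (\<forall>x\<in>Obj C. zero_object A (FObj T x))"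
| "deg_less C A S (Suc d) T \<longleftrightarrow>
     (\<forall>i\<in>SIdx S. deg_less C A S d
        (coker_functor C A (fcomp T (SFun S i)) (\<lambda>x. FArr T (SNat S i x))))"

definition degree_wrt ::
  "('o, 'a) cat \<Rightarrow> ('p, 'b) cat \<Rightarrow> ('i, 'o, 'a) stabilisers \<Rightarrow> ('o, 'a, 'p, 'b) functr \<Rightarrow> ereal"
where
  "degree_wrt C A S T = Inf {ereal (real d - 1) | d. deg_less C A S d T}"

fun Ck_on :: "nat \<Rightarrow> 'e::real_normed_vector set \<Rightarrow> ('e \<Rightarrow> 'f::real_normed_vector) \<Rightarrow> bool" where
  "Ck_on 0 S f \<longleftrightarrow> continuous_on S f"
| "Ck_on (Suc k) S f \<longleftrightarrow>
     (\<forall>x\<in>S. f differentiable (at x)) \<and> (\<forall>v. Ck_on k S (\<lambda>x. frechet_derivative f (at x) v))"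

text \<open>On a set that need not be open, smooth means locally extendable to a smooth map on an
  open set.\<close>

definition smooth_map_on ::
  "'e::real_normed_vector set \<Rightarrow> ('e \<Rightarrow> 'f::real_normed_vector) \<Rightarrow> bool" where
  "smooth_map_on S f \<longleftrightarrow>
     (\<forall>x\<in>S. \<exists>W g. open W \<and> x \<in> W \<and> (\<forall>k. Ck_on k W g) \<and> (\<forall>y\<in>W \<inter> S. g y = f y))"

definition normal_vec :: "'e::euclidean_space" where
  "normal_vec = (SOME b. b \<in> Basis)"

definition half_space :: "'e::euclidean_space set" where
  "half_space = {x. 0 \<le> x \<bullet> normal_vec}"

text \<open>A chart is a pair of a domain and a coordinate map; the dimension is \<open>DIM('e)\<close>.\<close>

definition bd_chart :: "'m topology \<Rightarrow> 'm set \<times> ('m \<Rightarrow> 'e::euclidean_space) \<Rightarrow> bool" where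
  "bd_chart M = (\<lambda>(U, \<theta>). openin M U \<and> openin (top_of_set half_space) (\<theta> ` U) \<and>
     homeomorphic_map (subtopology M U) (top_of_set (\<theta> ` U)) \<theta>)"

definition smooth_manifold_with_boundary ::
  "'m topology \<Rightarrow> ('m set \<times> ('m \<Rightarrow> 'e::euclidean_space)) set \<Rightarrow> bool" where
  "smooth_manifold_with_boundary M atlas \<longleftrightarrow>
     Hausdorff_space M \<and> second_countable M \<and>
     (\<forall>C\<in>atlas. bd_chart M C) \<and> (\<Union>C\<in>atlas. fst C) = topspace M \<and>
     (\<forall>(U, \<theta>)\<in>atlas. \<forall>(V, \<psi>)\<in>atlas. smooth_map_on (\<theta> ` (U \<inter> V)) (\<psi> \<circ> inv_into U \<theta>))"

definition mboundary :: "('m set \<times> ('m \<Rightarrow> 'e::euclidean_space)) set \<Rightarrow> 'm set" where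
  "mboundary atlas = {y. \<exists>(U, \<theta>)\<in>atlas. y \<in> U \<and> \<theta> y \<bullet> normal_vec = 0}"

text \<open>The interval \<open>[0,\<infinity>]\<close> is the type \<^typ>\<open>ennreal\<close>.\<close>

record 'm collared =
  Spc :: "'m topology"
  Bdy :: "'m set"
  Col :: "'m \<times> ennreal \<Rightarrow> 'm"
  Bpt :: "'m"

definition is_collared :: "'m collared \<Rightarrow> bool" where
  "is_collared W \<longleftrightarrow>
     embedding_map (prod_topology (subtopology (Spc W) (Bdy W)) euclidean) (Spc W) (Col W) \<and>
     proper_map (prod_topology (subtopology (Spc W) (Bdy W)) euclidean) (Spc W) (Col W) \<and>
     (\<forall>y\<in>Bdy W. Col W (y, 0) = y) \<and> Bpt W \<in> Bdy W"

definition apt :: "'m collared \<Rightarrow> real \<Rightarrow> 'm" where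
  "apt W t = Col W (Bpt W, ennreal t)"

definition epush :: "'m collared \<Rightarrow> 'm \<Rightarrow> 'm" where
  "epush W z =
     (if z \<in> Col W ` (Bdy W \<times> UNIV)
      then (case inv_into (Bdy W \<times> UNIV) (Col W) z of (y, t) \<Rightarrow> Col W (y, t + 1))
      else z)"

definition quotient_topology :: "'a topology \<Rightarrow> ('a \<Rightarrow> 'b) \<Rightarrow> 'b topology" where
  "quotient_topology Y f =
     topology (\<lambda>U. U \<subseteq> f ` topspace Y \<and> openin Y {x \<in> topspace Y. f x \<in> U})"

lemma openin_quotient_topology:
  "openin (quotient_topology Y f) U \<longleftrightarrow>
     U \<subseteq> f ` topspace Y \<and> openin Y {x \<in> topspace Y. f x \<in> U}"
proof -
  have "istopology (\<lambda>U. U \<subseteq> f ` topspace Y \<and> openin Y {x \<in> topspace Y. f x \<in> U})"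
  proof (unfold istopology_def, intro conjI allI impI; (elim conjE)?)
    fix S T
    assume "openin Y {x \<in> topspace Y. f x \<in> S}" "openin Y {x \<in> topspace Y. f x \<in> T}"
    moreover have "{x \<in> topspace Y. f x \<in> S \<inter> T} =
        {x \<in> topspace Y. f x \<in> S} \<inter> {x \<in> topspace Y. f x \<in> T}" by auto
    ultimately show "openin Y {x \<in> topspace Y. f x \<in> S \<inter> T}" by auto
  next
    fix \<K>
    assume "\<forall>K\<in>\<K>. K \<subseteq> f ` topspace Y \<and> openin Y {x \<in> topspace Y. f x \<in> K}"
    moreover have "{x \<in> topspace Y. f x \<in> \<Union>\<K>} = (\<Union>K\<in>\<K>. {x \<in> topspace Y. f x \<in> K})" by auto
    ultimately show "openin Y {x \<in> topspace Y. f x \<in> \<Union>\<K>}" by auto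
  qed auto
  then show ?thesis
    by (simp add: quotient_topology_def)
qed

text \<open>An unordered labelled configuration is a finite set of pairs (point, label); the space of
  these is the quotient of the ordered configurations by the symmetric group.\<close>

definition conf_space :: "nat \<Rightarrow> 'm topology \<Rightarrow> 'x topology \<Rightarrow> ('m \<times> 'x) set topology" where
  "conf_space k M X =
     quotient_topology
       (subtopology (product_topology (\<lambda>_. prod_topology M X) {..<k})
          {f. inj_on (fst \<circ> f) {..<k}})
       (\<lambda>f. f ` {..<k})"

type_synonym ('m, 'x) cpath = "real \<Rightarrow> ('m \<times> 'x) set"

definition pclass :: "'m topology \<Rightarrow> 'x topology \<Rightarrow> ('m, 'x) cpath \<Rightarrow> ('m, 'x) cpath set" where
  "pclass M X \<gamma> =
     {\<delta>. homotopic_with (\<lambda>r. r 0 = \<gamma> 0 \<and> r 1 = \<gamma> 1) (top_of_set {0..1})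
          (conf_space (card (\<gamma> 0)) M X) \<gamma> \<delta>}"

text \<open>\<open>delete_strands M X \<gamma> \<gamma>'\<close>: the path of configurations \<open>\<gamma>'\<close> consists of some of the
  strands of \<open>\<gamma>\<close>.\<close>

definition delete_strands ::
  "'m topology \<Rightarrow> 'x topology \<Rightarrow> ('m, 'x) cpath \<Rightarrow> ('m, 'x) cpath \<Rightarrow> bool" where
  "delete_strands M X \<gamma> \<gamma>' \<longleftrightarrow>
     (\<exists>(k::nat) f J. J \<subseteq> {..<k} \<and> (\<forall>i<k. pathin (prod_topology M X) (f i)) \<and>
        (\<forall>t\<in>{0..1}. inj_on (\<lambda>i. fst (f i t)) {..<k} \<and>
           \<gamma> t = (\<lambda>i. f i t) ` {..<k} \<and> \<gamma>' t = (\<lambda>i. f i t) ` J))"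

definition pconcat :: "('m, 'x) cpath \<Rightarrow> ('m, 'x) cpath \<Rightarrow> ('m, 'x) cpath" where
  "pconcat \<gamma> \<delta> = (\<lambda>t. if t \<le> 1/2 then \<gamma> (2 * t) else \<delta> (2 * t - 1))"

text \<open>First a, then b. The strands that are kept are those passing through a common point of the
  end of the first path and the start of the second.\<close>

definition partial_comp ::
  "'m topology \<Rightarrow> 'x topology \<Rightarrow> ('m, 'x) cpath set \<Rightarrow> ('m, 'x) cpath set \<Rightarrow> ('m, 'x) cpath set"
where
  "partial_comp M X a b =
     \<Union>{pclass M X (pconcat \<gamma>' \<delta>') | \<gamma> \<delta> \<gamma>' \<delta>'. \<gamma> \<in> a \<and> \<delta> \<in> b \<and>
          delete_strands M X \<gamma> \<gamma>' \<and> \<gamma>' 1 = \<gamma> 1 \<inter> \<delta> 0 \<and>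
          delete_strands M X \<delta> \<delta>' \<and> \<delta>' 0 = \<gamma> 1 \<inter> \<delta> 0}"

definition std_conf :: "'m collared \<Rightarrow> 'x \<Rightarrow> nat \<Rightarrow> ('m \<times> 'x) set" where
  "std_conf W x0 m = (\<lambda>i. (apt W (real i), x0)) ` {1..m}"

type_synonym ('m, 'x) pbraid = "nat \<times> nat \<times> ('m, 'x) cpath set"

definition braid_cat ::
  "'m collared \<Rightarrow> 'x topology \<Rightarrow> 'x \<Rightarrow> (nat, ('m, 'x) pbraid) cat" where
  "braid_cat W X x0 =
     \<lparr>Obj = UNIV,
      Arr = {(m, m', pclass (Spc W) X \<gamma>) | m m' k \<gamma>.
               k \<le> min m m' \<and> pathin (conf_space k (Spc W) X) \<gamma> \<and>
               \<gamma> 0 \<subseteq> std_conf W x0 m \<and> \<gamma> 1 \<subseteq> std_conf W x0 m'},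
      Dom = (\<lambda>(m, m', a). m),
      Cod = (\<lambda>(m, m', a). m'),
      Idn = (\<lambda>m. (m, m, pclass (Spc W) X (\<lambda>t. std_conf W x0 m))),
      Cmp = (\<lambda>(l, l', b) (m, m', a). (m, l', partial_comp (Spc W) X a b))\<rparr>"

definition move_conf :: "('m \<Rightarrow> 'n) \<Rightarrow> ('m \<times> 'x) set \<Rightarrow> ('n \<times> 'x) set" where
  "move_conf h S = (\<lambda>(z, x). (h z, x)) ` S"

definition s_functor ::
  "'m collared \<Rightarrow> 'x topology \<Rightarrow> 'x \<Rightarrow> (nat, ('m, 'x) pbraid, nat, ('m, 'x) pbraid) functr" where
  "s_functor W X x0 =
     \<lparr>FObj = Suc,
      FArr = (\<lambda>(m, m', a). (Suc m, Suc m',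
        \<Union>\<gamma>\<in>a. pclass (Spc W) X (\<lambda>t. insert (apt W 1, x0) (move_conf (epush W) (\<gamma> t)))))\<rparr>"

definition iota :: "'m collared \<Rightarrow> 'x topology \<Rightarrow> 'x \<Rightarrow> nat \<Rightarrow> ('m, 'x) pbraid" where
  "iota W X x0 m =
     (m, Suc m, pclass (Spc W) X (\<lambda>t. (\<lambda>i. (apt W (real i + t), x0)) ` {1..m}))"

definition dagger ::
  "'m collared \<Rightarrow> 'x topology \<Rightarrow> 'x \<Rightarrow> (unit, nat, ('m, 'x) pbraid) stabilisers" where
  "dagger W X x0 =
     \<lparr>SIdx = UNIV, SFun = (\<lambda>_. s_functor W X x0), SNat = (\<lambda>_. iota W X x0)\<rparr>"

definition disc ::
  "('e::euclidean_space \<times> ennreal \<Rightarrow> 'e) \<Rightarrow> 'e \<Rightarrow> 'e collared" where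
  "disc cD pD = \<lparr>Spc = top_of_set (cball 0 1), Bdy = sphere 0 1, Col = cD, Bpt = pD\<rparr>"

definition arc_set :: "'m collared \<Rightarrow> nat \<Rightarrow> 'm set" where
  "arc_set W N = apt W ` {1/2..real N}"

definition arc_embedding :: "'d collared \<Rightarrow> 'm collared \<Rightarrow> nat \<Rightarrow> ('d \<Rightarrow> 'm) \<Rightarrow> bool" where
  "arc_embedding D W N \<phi> \<longleftrightarrow>
     embedding_map (Spc D) (Spc W) \<phi> \<and>
     \<phi> ` topspace (Spc D) \<subseteq> Col W ` (Bdy W \<times> {0..ennreal (real N + 1/2)}) \<and>
     arc_set W N \<subseteq> Spc W interior_of (\<phi> ` topspace (Spc D)) \<and>
     (\<forall>i\<in>{1..N}. \<phi> (apt D (real i)) = apt W (real i)) \<and>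
     \<phi> ` arc_set D N = arc_set W N \<and>
     (\<exists>U V. openin (Spc D) U \<and> arc_set D N \<subseteq> U \<and> openin (Spc W) V \<and> arc_set W N \<subseteq> V \<and> \<phi> ` U = V)"

text \<open>One embedding for every N, all inducing the same isomorphism between the local homology
  groups in degree n at the first marked points, that is, the same local orientation.\<close>

definition arc_embeddings ::
  "nat \<Rightarrow> 'd collared \<Rightarrow> 'm collared \<Rightarrow> (nat \<Rightarrow> 'd \<Rightarrow> 'm) \<Rightarrow> bool" where
  "arc_embeddings n D W \<phi> \<longleftrightarrow>
     (\<forall>N. arc_embedding D W N (\<phi> N)) \<and>
     (\<forall>N\<ge>1. \<forall>N'\<ge>1.
        \<forall>\<omega>\<in>carrier (relative_homology_group (int n) (Spc D) (topspace (Spc D) - {apt D 1})).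
          hom_induced (int n) (Spc D) (topspace (Spc D) - {apt D 1})
            (Spc W) (topspace (Spc W) - {apt W 1}) (\<phi> N) \<omega> =
          hom_induced (int n) (Spc D) (topspace (Spc D) - {apt D 1})
            (Spc W) (topspace (Spc W) - {apt W 1}) (\<phi> N') \<omega>)"

text \<open>The order-preserving slide from \<open>a\<^sub>1, \<dots>, a\<^sub>m\<^sub>+\<^sub>l\<close> to
  \<open>a\<^sub>1, \<dots>, a\<^sub>m, a\<^sub>N\<^sub>+\<^sub>2, \<dots>, a\<^sub>N\<^sub>+\<^sub>1\<^sub>+\<^sub>l\<close>.\<close>

definition slide :: "'m collared \<Rightarrow> 'x \<Rightarrow> nat \<Rightarrow> nat \<Rightarrow> nat \<Rightarrow> ('m, 'x) cpath" where
  "slide W x0 N m l = (\<lambda>t.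
     (\<lambda>i. (apt W (real i + (if i \<le> m then 0 else t * (real N + 1 - real m))), x0)) ` {1..m + l})"

text \<open>The module structure on arrows, formed with the least admissible N.\<close>

definition oplus ::
  "'m collared \<Rightarrow> 'x topology \<Rightarrow> 'x \<Rightarrow> (nat \<Rightarrow> 'd \<Rightarrow> 'm) \<Rightarrow>
     ('d, 'x) pbraid \<Rightarrow> ('m, 'x) pbraid \<Rightarrow> ('m, 'x) pbraid" where
  "oplus W X x0 \<phi> = (\<lambda>(m, m', b) (l, l', g).
     (let N = max m m';
          mid = (\<Union>\<beta>\<in>b. \<Union>\<gamma>\<in>g. pclass (Spc W) X
                   (\<lambda>t. move_conf (\<phi> N) (\<beta> t) \<union> move_conf (epush W ^^ (N + 1)) (\<gamma> t)))
      in (m + l, m' + l',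
          partial_comp (Spc W) X
            (partial_comp (Spc W) X (pclass (Spc W) X (slide W x0 N m l)) mid)
            (pclass (Spc W) X (\<lambda>t. slide W x0 N m' l' (1 - t))))))"

definition ddagger ::
  "'d collared \<Rightarrow> 'm collared \<Rightarrow> 'x topology \<Rightarrow> 'x \<Rightarrow> (nat \<Rightarrow> 'd \<Rightarrow> 'm) \<Rightarrow>
     (nat, nat, ('m, 'x) pbraid) stabilisers" where
  "ddagger D W X x0 \<phi> =
     \<lparr>SIdx = Obj (braid_cat D X x0),
      SFun = (\<lambda>m. \<lparr>FObj = (\<lambda>l. m + l), FArr = oplus W X x0 \<phi> (Idn (braid_cat D X x0) m)\<rparr>),
      SNat = (\<lambda>m l. oplus W X x0 \<phi> (THE f. f \<in> homset (braid_cat D X x0) 0 m)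
                      (Idn (braid_cat W X x0) l))\<rparr>"

end

theory Submission
  imports Defs
begin

text \<open>
  Both degrees see only the order-preserving slides of points along the arc, because all the
  stabilisation maps are of this kind and the functors \<open>m \<oplus> -\<close> preserve slides. Hence everything
  can be computed in the category of order-preserving injections \<open>{1..k} \<rightarrow> {1..N}\<close>.

  By the universal property of cokernels, \<open>deg T < d\<close> with respect to a set of indices means the
  following: for all indices \<open>m\<^sub>1, \<dots>, m\<^sub>d\<close>, an arrow g out of \<open>T(m\<^sub>1 + \<dots> + m\<^sub>d + n)\<close> that
  annihilates \<open>T(u\<^sub>j)\<close> for every j is zero, where \<open>u\<^sub>j\<close> is the order-preserving injection
  missing the j-th of d consecutive blocks of sizes \<open>m\<^sub>1, \<dots>, m\<^sub>d\<close>. Suppose that this holds when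
  all blocks are singletons, and let g be as above for arbitrary blocks. Then \<open>g \<circ> T(v) = 0\<close> for
  every order-preserving injection v from \<open>{1..k}\<close>, by induction on k: if \<open>k < d\<close>, then v misses a
  whole block and factors through some \<open>u\<^sub>j\<close>; otherwise the induction hypothesis says that
  \<open>g \<circ> T(v)\<close> annihilates the arrows for d singleton blocks. Take v to be the identity.

  That slides compose as expected after deletion of strands rests on lifting a homotopy of
  unordered configurations to a homotopy of its strands.
\<close>

section \<open>Degree of a functor with values in a category with cokernels\<close>

text \<open>In \<open>braid_cat\<close> only composites of slides are evaluated. The degrees are
  carried over by a map of arrows that preserves the stabilisation data, not by an equivalence of
  categories; since all cokernels are chosen in the same target category, this transfer yields
  equalities of functor values and not merely isomorphisms.

  Arrows of \<open>braid_cat\<close> are sets of paths, and each operation takes a union over all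
  representatives, so every computation has to show that all nonempty contributions coincide. The
  delicate case is the push e: it sends the basepoint a_0, which is a point of M, to a_1. A
  representative that runs through the basepoint produces a collision when the new point at a_1 is
  inserted. Such a representative contributes the empty class, while a homotopy between good
  representatives may still cross the basepoint and has to be pushed off it.

  Continuity of e rests on the part of the collar at finite depth being open in M. This comes from
  invariance of domain in boundary charts.\<close>

lemma homsetD:
  "f \<in> homset C x y \<Longrightarrow> f \<in> Arr C \<and> Dom C f = x \<and> Cod C f = y"
  by (simp add: homset_def)

lemma cat_comp:
  assumes "is_category C" "f \<in> Arr C" "g \<in> Arr C" "Cod C f = Dom C g"
  shows "Cmp C g f \<in> Arr C" "Dom C (Cmp C g f) = Dom C f" "Cod C (Cmp C g f) = Cod C g"
  using assms by (auto simp: is_category_def homset_def)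

lemma cat_assoc:
  assumes "is_category C" "f \<in> Arr C" "g \<in> Arr C" "h \<in> Arr C" "Cod C f = Dom C g" "Cod C g = Dom C h"
  shows "Cmp C h (Cmp C g f) = Cmp C (Cmp C h g) f"
  using assms by (auto simp: is_category_def)

lemma zero_objectD:
  assumes "zero_object A z" "x \<in> Obj A"
  shows "\<exists>!f. f \<in> homset A z x" "\<exists>!f. f \<in> homset A x z"
  using assms by (simp_all add: zero_object_def)

section \<open>Zero arrows and zero objects\<close>

lemma zero_arrow_comp_left:
  assumes A: "is_category A" and f: "zero_arrow A f" and g: "g \<in> Arr A" "Dom A g = Cod A f"
  shows "zero_arrow A (Cmp A g f)"
proof -
  obtain z u v where z: "zero_object A z" "u \<in> homset A (Dom A f) z" "v \<in> homset A z (Cod A f)"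
      and fA: "f \<in> Arr A" and fe: "f = Cmp A v u"
    using f by (auto simp: zero_arrow_def)
  note u = homsetD[OF z(2)] and v = homsetD[OF z(3)]
  have "Cmp A g f = Cmp A (Cmp A g v) u"
    unfolding fe using cat_assoc[OF A, of u v g] u v g by simp
  moreover have "Cmp A g v \<in> homset A z (Cod A g)"
    using cat_comp[OF A, of v g] v g by (simp add: homset_def)
  ultimately show ?thesis
    using z(1,2) cat_comp[OF A fA g(1)] g(2) unfolding zero_arrow_def by auto
qed

lemma zero_arrow_comp_right:
  assumes A: "is_category A" and f: "zero_arrow A f" and g: "g \<in> Arr A" "Cod A g = Dom A f"
  shows "zero_arrow A (Cmp A f g)"
proof -
  obtain z u v where z: "zero_object A z" "u \<in> homset A (Dom A f) z" "v \<in> homset A z (Cod A f)"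
      and fA: "f \<in> Arr A" and fe: "f = Cmp A v u"
    using f by (auto simp: zero_arrow_def)
  note u = homsetD[OF z(2)] and v = homsetD[OF z(3)]
  have "Cmp A f g = Cmp A v (Cmp A u g)"
    unfolding fe using cat_assoc[OF A, of g u v] u v g by simp
  moreover have "Cmp A u g \<in> homset A (Dom A g) z"
    using cat_comp[OF A, of g u] u g by (simp add: homset_def)
  ultimately show ?thesis
    using z(1,3) cat_comp[OF A g(1) fA] g(2) unfolding zero_arrow_def by auto
qed

text \<open>If every arrow out of x is zero, so is its identity, and x is a retract of a zero
  object. Describing a zero object by the arrows out of it is the base case for expressing the
  degree by joint epicness.\<close>

lemma zero_object_iff:
  assumes A: "is_category A" and ex: "\<exists>z. zero_object A z" and x: "x \<in> Obj A"
  shows "zero_object A x \<longleftrightarrow> (\<forall>g\<in>Arr A. Dom A g = x \<longrightarrow> zero_arrow A g)"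
proof (intro iffI ballI impI)
  fix g assume x0: "zero_object A x" and g: "g \<in> Arr A" "Dom A g = x"
  have "Idn A x \<in> homset A x x" "Cmp A g (Idn A x) = g"
    using A x g by (auto simp: is_category_def)
  then show "zero_arrow A g"
    using x0 g unfolding zero_arrow_def by (intro exI[of _ x] exI[of _ "Idn A x"] exI[of _ g]) (simp add: homset_def)
next
  assume r: "\<forall>g\<in>Arr A. Dom A g = x \<longrightarrow> zero_arrow A g"
  have idx: "Idn A x \<in> Arr A" "Dom A (Idn A x) = x" "Cod A (Idn A x) = x"
    using A x by (auto simp: is_category_def homset_def)
  then obtain z u v where z: "zero_object A z" "u \<in> homset A x z" "v \<in> homset A z x"
      and e: "Idn A x = Cmp A v u"
    using bspec[OF r idx(1)] unfolding zero_arrow_def by auto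
  note u = homsetD[OF z(2)] and v = homsetD[OF z(3)]
  show "zero_object A x"
    unfolding zero_object_def
  proof (intro conjI ballI x)
    fix y assume y: "y \<in> Obj A"
    obtain a where a: "a \<in> homset A z y" "\<And>b. b \<in> homset A z y \<Longrightarrow> b = a"
      using zero_objectD(1)[OF z(1) y] by metis
    obtain a' where a': "a' \<in> homset A y z" "\<And>b. b \<in> homset A y z \<Longrightarrow> b = a'"
      using zero_objectD(2)[OF z(1) y] by metis
    note aa = homsetD[OF a(1)] homsetD[OF a'(1)]
    show "\<exists>!f. f \<in> homset A x y"
    proof (rule ex1I[of _ "Cmp A a u"])
      show "Cmp A a u \<in> homset A x y"
        using cat_comp[OF A, of u a] u aa by (simp add: homset_def)
      fix f assume "f \<in> homset A x y"
      note f = homsetD[OF this]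
      have "f = Cmp A f (Cmp A v u)"
        using A f unfolding e[symmetric] by (auto simp: is_category_def)
      also have "\<dots> = Cmp A (Cmp A f v) u"
        using cat_assoc[OF A, of u v f] u v f by simp
      also have "Cmp A f v = a"
        by (rule a(2)) (use cat_comp[OF A, of v f] v f in \<open>simp add: homset_def\<close>)
      finally show "f = Cmp A a u" .
    qed
    show "\<exists>!f. f \<in> homset A y x"
    proof (rule ex1I[of _ "Cmp A v a'"])
      show "Cmp A v a' \<in> homset A y x"
        using cat_comp[OF A, of a' v] v aa by (simp add: homset_def)
      fix f assume "f \<in> homset A y x"
      note f = homsetD[OF this]
      have "f = Cmp A (Cmp A v u) f"
        using A f unfolding e[symmetric] by (auto simp: is_category_def)
      also have "\<dots> = Cmp A v (Cmp A u f)"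
        using cat_assoc[OF A, of f u v] u v f by simp
      also have "Cmp A u f = a'"
        by (rule a'(2)) (use cat_comp[OF A, of f u] u f in \<open>simp add: homset_def\<close>)
      finally show "f = Cmp A v a'" .
    qed
  qed
qed

section \<open>Cokernel functors of a category with stabilisers\<close>

definition is_stabilised :: "('o, 'a) cat \<Rightarrow> ('i, 'o, 'a) stabilisers \<Rightarrow> bool" where
  "is_stabilised C S \<longleftrightarrow> is_category C \<and> (\<forall>i\<in>SIdx S. is_functor C C (SFun S i) \<and>
     (\<forall>x\<in>Obj C. SNat S i x \<in> homset C x (FObj (SFun S i) x)) \<and>
     (\<forall>f\<in>Arr C. Cmp C (SNat S i (Cod C f)) f = Cmp C (FArr (SFun S i) f) (SNat S i (Dom C f))))"

locale category_with_cokernels =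
  fixes A :: "('p, 'b) cat"
  assumes cat: "is_category A"
    and has_zero: "\<exists>z. zero_object A z"
    and has_coker: "f \<in> Arr A \<Longrightarrow> \<exists>q. is_cokernel A f q"
begin

lemma is_coker: "f \<in> Arr A \<Longrightarrow> is_cokernel A f (coker A f)"
  unfolding coker_def by (rule someI_ex) (rule has_coker)

lemma coker_arr:
  assumes "f \<in> Arr A"
  shows "coker A f \<in> Arr A" "Dom A (coker A f) = Cod A f" "zero_arrow A (Cmp A (coker A f) f)"
  using is_coker[OF assms] by (auto simp: is_cokernel_def)

lemma coker_factor:
  assumes "f \<in> Arr A" "g \<in> Arr A" "Dom A g = Cod A f" "zero_arrow A (Cmp A g f)"
  shows "\<exists>!h. h \<in> homset A (Cod A (coker A f)) (Cod A g) \<and> Cmp A h (coker A f) = g"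
  using is_coker[OF assms(1)] assms by (auto simp: is_cokernel_def)

lemma coker_epi:
  assumes f: "f \<in> Arr A"
    and h: "h \<in> homset A (Cod A (coker A f)) y" and h': "h' \<in> homset A (Cod A (coker A f)) y"
    and eq: "Cmp A h (coker A f) = Cmp A h' (coker A f)"
  shows "h = h'"
proof -
  note q = coker_arr[OF f] and hh = homsetD[OF h] homsetD[OF h']
  let ?g = "Cmp A h (coker A f)"
  have g: "?g \<in> Arr A" "Dom A ?g = Cod A f" "Cod A ?g = y"
    using cat_comp[OF cat q(1), of h] q hh by auto
  have "Cmp A ?g f = Cmp A h (Cmp A (coker A f) f)"
    using cat_assoc[OF cat f q(1), of h] q hh by simp
  also have "zero_arrow A \<dots>"
    by (rule zero_arrow_comp_left[OF cat q(3)]) (use cat_comp[OF cat f q(1)] q hh in auto)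
  finally have "\<exists>!k. k \<in> homset A (Cod A (coker A f)) (Cod A ?g) \<and> Cmp A k (coker A f) = ?g"
    by (intro coker_factor f g)
  then show ?thesis
    using h h' eq g(3) by metis
qed

text \<open>Let q be the cokernel and suppose h q = v u through a zero object z. The unique arrow w
  from the target of q to z satisfies w q = u, so h q = (v w) q, and q can be cancelled. This lets
  zero conditions pass between T and its cokernel functor.\<close>

lemma zero_arrow_coker_iff:
  assumes f: "f \<in> Arr A" and h: "h \<in> Arr A" "Dom A h = Cod A (coker A f)"
  shows "zero_arrow A (Cmp A h (coker A f)) \<longleftrightarrow> zero_arrow A h"
proof
  note q = coker_arr[OF f]
  assume "zero_arrow A (Cmp A h (coker A f))"
  then obtain z u v where z: "zero_object A z" "u \<in> homset A (Cod A f) z" "v \<in> homset A z (Cod A h)"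
      and e: "Cmp A h (coker A f) = Cmp A v u"
    using cat_comp[OF cat q(1) h(1)] h(2) q unfolding zero_arrow_def by auto
  note u = homsetD[OF z(2)] and v = homsetD[OF z(3)]
  obtain w where w: "w \<in> homset A (Cod A (coker A f)) z"
  proof -
    have "Cod A (coker A f) \<in> Obj A" using q(1) cat by (simp add: is_category_def)
    then show thesis using that zero_objectD(2)[OF z(1)] by blast
  qed
  note ww = homsetD[OF w]
  have "Cmp A w (coker A f) = u"
  proof -
    have "Cmp A w (coker A f) \<in> homset A (Cod A f) z"
      using cat_comp[OF cat q(1), of w] ww q by (simp add: homset_def)
    moreover have "Cod A f \<in> Obj A" using f cat by (simp add: is_category_def)
    ultimately show ?thesis
      using z(2) zero_objectD(2)[OF z(1)] by blast
  qed
  then have "Cmp A h (coker A f) = Cmp A (Cmp A v w) (coker A f)"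
    using e cat_assoc[OF cat q(1), of w v] ww v q by simp
  moreover have "Cmp A v w \<in> homset A (Cod A (coker A f)) (Cod A h)"
    using cat_comp[OF cat, of w v] ww v by (simp add: homset_def)
  ultimately have "h = Cmp A v w"
    using coker_epi[OF f, of h "Cod A h" "Cmp A v w"] h by (simp add: homset_def)
  then show "zero_arrow A h"
    unfolding zero_arrow_def using z w v h by auto
next
  assume "zero_arrow A h"
  then show "zero_arrow A (Cmp A h (coker A f))"
    by (rule zero_arrow_comp_right[OF cat]) (use coker_arr[OF f] h in auto)
qed

text \<open>\<open>coker_functor\<close> selects its arrows by \<open>THE\<close>. Naturality of
  \<open>SNat\<close> makes the universal property apply, so the selected arrow exists and completes
  the square formed with the two cokernels.\<close>

lemma coker_functor_square:
  assumes S: "is_stabilised C S" and i: "i \<in> SIdx S" and T: "is_functor C A T" and u: "u \<in> Arr C"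
  defines "F \<equiv> coker_functor C A (fcomp T (SFun S i)) (\<lambda>x. FArr T (SNat S i x))"
    and "q \<equiv> \<lambda>x. coker A (FArr T (SNat S i x))"
  shows "FArr F u \<in> homset A (FObj F (Dom C u)) (FObj F (Cod C u))"
    and "Cmp A (FArr F u) (q (Dom C u)) = Cmp A (q (Cod C u)) (FArr T (FArr (SFun S i) u))"
proof -
  let ?x = "Dom C u" and ?y = "Cod C u" and ?s = "SFun S i"
  have C: "is_category C" and s: "is_functor C C ?s" using S i by (auto simp: is_stabilised_def)
  have xy: "?x \<in> Obj C" "?y \<in> Obj C" using C u by (auto simp: is_category_def)
  have n: "SNat S i x \<in> Arr C" "Dom C (SNat S i x) = x" "Cod C (SNat S i x) = FObj ?s x"
    if "x \<in> Obj C" for x using S i that by (auto simp: is_stabilised_def homset_def)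
  have su: "FArr ?s u \<in> Arr C" "Dom C (FArr ?s u) = FObj ?s ?x" "Cod C (FArr ?s u) = FObj ?s ?y"
    using s u by (auto simp: is_functor_def homset_def)
  have Ta: "FArr T f \<in> Arr A" "Dom A (FArr T f) = FObj T (Dom C f)" "Cod A (FArr T f) = FObj T (Cod C f)"
    if "f \<in> Arr C" for f using T that by (auto simp: is_functor_def homset_def)
  have Tc: "FArr T (Cmp C g f) = Cmp A (FArr T g) (FArr T f)"
    if "f \<in> Arr C" "g \<in> Arr C" "Cod C f = Dom C g" for f g using T that by (auto simp: is_functor_def)
  have q: "q x \<in> Arr A" "Dom A (q x) = FObj T (FObj ?s x)" "zero_arrow A (Cmp A (q x) (FArr T (SNat S i x)))"
    if "x \<in> Obj C" for x
    unfolding q_def using coker_arr[OF Ta(1)[OF n(1)[OF that]]] Ta[OF n(1)[OF that]] n[OF that] by auto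
  let ?g = "Cmp A (q ?y) (FArr T (FArr ?s u))"
  have g: "?g \<in> Arr A" "Dom A ?g = FObj T (FObj ?s ?x)" "Cod A ?g = Cod A (q ?y)"
    using cat_comp[OF cat Ta(1)[OF su(1)] q(1)[OF xy(2)]] Ta[OF su(1)] su q[OF xy(2)] by auto
  have "Cmp A ?g (FArr T (SNat S i ?x)) = Cmp A (q ?y) (Cmp A (FArr T (FArr ?s u)) (FArr T (SNat S i ?x)))"
    using cat_assoc[OF cat Ta(1)[OF n(1)[OF xy(1)]] Ta(1)[OF su(1)] q(1)[OF xy(2)]]
      Ta[OF su(1)] Ta[OF n(1)[OF xy(1)]] su n[OF xy(1)] q[OF xy(2)] by simp
  also have "Cmp A (FArr T (FArr ?s u)) (FArr T (SNat S i ?x)) = FArr T (Cmp C (FArr ?s u) (SNat S i ?x))"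
    using Tc[OF n(1)[OF xy(1)] su(1)] n[OF xy(1)] su by simp
  \<comment> \<open>Naturality turns the composite into one that contains T of a component followed
    by its own cokernel, which is zero.\<close>
  also have "Cmp C (FArr ?s u) (SNat S i ?x) = Cmp C (SNat S i ?y) u"
    using S i u by (simp add: is_stabilised_def)
  also have "FArr T \<dots> = Cmp A (FArr T (SNat S i ?y)) (FArr T u)"
    using Tc[OF u n(1)[OF xy(2)]] n[OF xy(2)] by simp
  also have "Cmp A (q ?y) \<dots> = Cmp A (Cmp A (q ?y) (FArr T (SNat S i ?y))) (FArr T u)"
    using cat_assoc[OF cat Ta(1)[OF u] Ta(1)[OF n(1)[OF xy(2)]] q(1)[OF xy(2)]]
      Ta[OF u] Ta[OF n(1)[OF xy(2)]] n[OF xy(2)] q[OF xy(2)] by simp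
  also have "zero_arrow A \<dots>"
    by (rule zero_arrow_comp_right[OF cat q(3)[OF xy(2)] Ta(1)[OF u]])
      (use cat_comp[OF cat Ta(1)[OF n(1)[OF xy(2)]] q(1)[OF xy(2)]]
          Ta[OF u] Ta[OF n(1)[OF xy(2)]] n[OF xy(2)] q[OF xy(2)] in simp)
  finally have "zero_arrow A (Cmp A ?g (FArr T (SNat S i ?x)))" .
  then have "\<exists>!h. h \<in> homset A (Cod A (q ?x)) (Cod A (q ?y)) \<and> Cmp A h (q ?x) = ?g"
    using coker_factor[OF Ta(1)[OF n(1)[OF xy(1)]] g(1)] g Ta[OF n(1)[OF xy(1)]] n[OF xy(1)]
    unfolding q_def by simp
  from theI'[OF this] show "FArr F u \<in> homset A (FObj F ?x) (FObj F ?y)"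
    and "Cmp A (FArr F u) (q ?x) = ?g"
    unfolding F_def q_def coker_functor_def fcomp_def by auto
qed

text \<open>Both functor laws are checked after composing with the cokernel at the source, which is
  epic; there they become the laws for T after the stabiliser.\<close>

lemma coker_functor_is_functor:
  assumes S: "is_stabilised C S" and i: "i \<in> SIdx S" and T: "is_functor C A T"
  shows "is_functor C A (coker_functor C A (fcomp T (SFun S i)) (\<lambda>x. FArr T (SNat S i x)))"
    (is "is_functor C A ?F")
proof -
  let ?s = "SFun S i" and ?q = "\<lambda>x. coker A (FArr T (SNat S i x))"
  have C: "is_category C" and s: "is_functor C C ?s" using S i by (auto simp: is_stabilised_def)
  have n: "SNat S i x \<in> Arr C" "Dom C (SNat S i x) = x" "Cod C (SNat S i x) = FObj ?s x"
    if "x \<in> Obj C" for x using S i that by (auto simp: is_stabilised_def homset_def)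
  have Ta: "FArr T f \<in> Arr A" "Dom A (FArr T f) = FObj T (Dom C f)" "Cod A (FArr T f) = FObj T (Cod C f)"
    if "f \<in> Arr C" for f using T that by (auto simp: is_functor_def homset_def)
  note sq = coker_functor_square[OF S i T]
  have Fo: "FObj ?F x = Cod A (?q x)" for x
    by (simp add: coker_functor_def)
  have q: "?q x \<in> Arr A" "Dom A (?q x) = FObj T (FObj ?s x)" if "x \<in> Obj C" for x
    using coker_arr[OF Ta(1)[OF n(1)[OF that]]] Ta[OF n(1)[OF that]] n[OF that] by auto
  have Fx: "FObj ?F x \<in> Obj A" if "x \<in> Obj C" for x
    using q(1)[OF that] cat unfolding Fo by (simp add: is_category_def)
  have "FArr ?F (Idn C x) = Idn A (FObj ?F x)" if x: "x \<in> Obj C" for x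
  proof -
    have I: "Idn C x \<in> Arr C" "Dom C (Idn C x) = x" "Cod C (Idn C x) = x"
      using C x by (auto simp: is_category_def homset_def)
    have "FArr T (FArr ?s (Idn C x)) = Idn A (FObj T (FObj ?s x))"
      using s T x by (auto simp: is_functor_def)
    then have "Cmp A (FArr ?F (Idn C x)) (?q x) = ?q x"
      using sq(2)[OF I(1)] I cat q[OF x] by (auto simp: is_category_def)
    moreover have "Cmp A (Idn A (FObj ?F x)) (?q x) = ?q x"
      using cat q(1)[OF x] unfolding Fo by (auto simp: is_category_def)
    moreover have "Idn A (FObj ?F x) \<in> homset A (FObj ?F x) (FObj ?F x)"
      using cat Fx[OF x] by (auto simp: is_category_def)
    ultimately show ?thesis
      using coker_epi[OF Ta(1)[OF n(1)[OF x]]] sq(1)[OF I(1)] I unfolding Fo by metis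
  qed
  moreover have "FArr ?F (Cmp C g f) = Cmp A (FArr ?F g) (FArr ?F f)"
    if f: "f \<in> Arr C" and g: "g \<in> Arr C" and fg: "Cod C f = Dom C g" for f g
  proof -
    let ?x = "Dom C f" and ?y = "Dom C g" and ?z = "Cod C g"
    have xyz: "?x \<in> Obj C" "?y \<in> Obj C" "?z \<in> Obj C" using C f g by (auto simp: is_category_def)
    have gf: "Cmp C g f \<in> Arr C" "Dom C (Cmp C g f) = ?x" "Cod C (Cmp C g f) = ?z"
      using cat_comp[OF C f g fg] by auto
    have sf: "FArr ?s f \<in> Arr C" "Dom C (FArr ?s f) = FObj ?s ?x" "Cod C (FArr ?s f) = FObj ?s ?y"
      using s f fg by (auto simp: is_functor_def homset_def)
    have sg: "FArr ?s g \<in> Arr C" "Dom C (FArr ?s g) = FObj ?s ?y" "Cod C (FArr ?s g) = FObj ?s ?z"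
      using s g by (auto simp: is_functor_def homset_def)
    note Ff = homsetD[OF sq(1)[OF f]] and Fg = homsetD[OF sq(1)[OF g]]
    have "Cmp A (Cmp A (FArr ?F g) (FArr ?F f)) (?q ?x) = Cmp A (FArr ?F g) (Cmp A (FArr ?F f) (?q ?x))"
      using cat_assoc[OF cat q(1)[OF xyz(1)], of "FArr ?F f" "FArr ?F g"] Ff Fg fg Fo by metis
    also have "\<dots> = Cmp A (FArr ?F g) (Cmp A (?q ?y) (FArr T (FArr ?s f)))"
      using sq(2)[OF f] fg by simp
    also have "\<dots> = Cmp A (Cmp A (FArr ?F g) (?q ?y)) (FArr T (FArr ?s f))"
      by (rule cat_assoc[OF cat Ta(1)[OF sf(1)] q(1)[OF xyz(2)]])
        (use Fg Fo Ta[OF sf(1)] sf q[OF xyz(2)] in auto)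
    also have "\<dots> = Cmp A (Cmp A (?q ?z) (FArr T (FArr ?s g))) (FArr T (FArr ?s f))"
      using sq(2)[OF g] by simp
    also have "\<dots> = Cmp A (?q ?z) (Cmp A (FArr T (FArr ?s g)) (FArr T (FArr ?s f)))"
      by (rule cat_assoc[OF cat Ta(1)[OF sf(1)] Ta(1)[OF sg(1)] q(1)[OF xyz(3)], symmetric])
        (use Ta[OF sf(1)] Ta[OF sg(1)] sf sg q[OF xyz(3)] in auto)
    also have "Cmp A (FArr T (FArr ?s g)) (FArr T (FArr ?s f)) = FArr T (FArr ?s (Cmp C g f))"
    proof -
      have "FArr ?s (Cmp C g f) = Cmp C (FArr ?s g) (FArr ?s f)"
        using s f g fg by (auto simp: is_functor_def)
      then show ?thesis using T sf sg by (auto simp: is_functor_def)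
    qed
    also have "Cmp A (?q ?z) \<dots> = Cmp A (FArr ?F (Cmp C g f)) (?q ?x)"
      using sq(2)[OF gf(1)] gf by simp
    finally have "Cmp A (FArr ?F (Cmp C g f)) (?q ?x) = Cmp A (Cmp A (FArr ?F g) (FArr ?F f)) (?q ?x)"
      by simp
    moreover have "FArr ?F (Cmp C g f) \<in> homset A (Cod A (?q ?x)) (FObj ?F ?z)"
      using sq(1)[OF gf(1)] gf Fo by simp
    moreover have "Cmp A (FArr ?F g) (FArr ?F f) \<in> homset A (Cod A (?q ?x)) (FObj ?F ?z)"
      using cat_comp[OF cat, of "FArr ?F f" "FArr ?F g"] Ff Fg fg Fo unfolding homset_def by auto
    ultimately show ?thesis
      using coker_epi[OF Ta(1)[OF n(1)[OF xyz(1)]]] by blast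
  qed
  ultimately show ?thesis
    unfolding is_functor_def using Fx sq(1) by auto
qed

end

section \<open>Iterated stabilisation and the test for the degree\<close>

fun stab_obj :: "('i, 'o, 'a) stabilisers \<Rightarrow> 'i list \<Rightarrow> 'o \<Rightarrow> 'o" where
  "stab_obj S [] x = x"
| "stab_obj S (i # is) x = FObj (SFun S i) (stab_obj S is x)"

text \<open>The j-th arrow is the component of the j-th natural transformation, moved by the j - 1
  endofunctors before it in the list. All of these arrows end at \<open>stab_obj\<close>: they are
  the edges into the last vertex of the cube spanned by the stabilisations.\<close>

fun stab_arrs :: "('i, 'o, 'a) stabilisers \<Rightarrow> 'i list \<Rightarrow> 'o \<Rightarrow> 'a set" where
  "stab_arrs S [] x = {}"
| "stab_arrs S (i # is) x = insert (SNat S i (stab_obj S is x)) (FArr (SFun S i) ` stab_arrs S is x)"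

lemma stab_obj_Obj:
  assumes "is_stabilised C S" "set is \<subseteq> SIdx S" "x \<in> Obj C"
  shows "stab_obj S is x \<in> Obj C"
  using assms(2) by (induction "is") (use assms in \<open>auto simp: is_stabilised_def is_functor_def\<close>)

lemma stab_arrs_Arr:
  assumes S: "is_stabilised C S" and "set is \<subseteq> SIdx S" "x \<in> Obj C" "u \<in> stab_arrs S is x"
  shows "u \<in> Arr C \<and> Cod C u = stab_obj S is x"
  using assms(2-)
proof (induction "is" arbitrary: u)
  case (Cons i "is")
  then have i: "i \<in> SIdx S" and o: "stab_obj S is x \<in> Obj C"
    using stab_obj_Obj[OF S] by auto
  show ?case
  proof (cases "u = SNat S i (stab_obj S is x)")
    case True
    then show ?thesis using S i o by (auto simp: is_stabilised_def homset_def)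
  next
    case False
    then obtain v where v: "v \<in> stab_arrs S is x" "u = FArr (SFun S i) v" using Cons by auto
    then have "v \<in> Arr C \<and> Cod C v = stab_obj S is x" using Cons by auto
    then show ?thesis using S i v(2) by (auto simp: is_stabilised_def homset_def is_functor_def)
  qed
qed simp

text \<open>Joint epicness after T in the form that tests only for zero: g vanishes as soon as all g
  T(u) do. For empty U it says that every arrow out of T x is zero.\<close>

definition jointly_epic ::
  "('p, 'b) cat \<Rightarrow> ('o, 'a, 'p, 'b) functr \<Rightarrow> 'o \<Rightarrow> 'a set \<Rightarrow> bool" where
  "jointly_epic A T x U \<longleftrightarrow> (\<forall>g\<in>Arr A. Dom A g = FObj T x \<and>
     (\<forall>u\<in>U. zero_arrow A (Cmp A g (FArr T u))) \<longrightarrow> zero_arrow A g)"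

text \<open>By the universal property of cokernels, an arrow out of an iterated cokernel is an arrow out
  of a value of the original functor that annihilates all the stabilisation arrows.\<close>

lemma (in category_with_cokernels) deg_less_iff_jointly_epic:
  assumes S: "is_stabilised C S" and T: "is_functor C A T"
  shows "deg_less C A S d T \<longleftrightarrow>
    (\<forall>is. length is = d \<and> set is \<subseteq> SIdx S \<longrightarrow>
      (\<forall>x\<in>Obj C. jointly_epic A T (stab_obj S is x) (stab_arrs S is x)))"
  using T
proof (induction d arbitrary: T)
  case 0
  have "FObj T x \<in> Obj A" if "x \<in> Obj C" for x using 0 that by (auto simp: is_functor_def)
  then show ?case
    by (auto simp: jointly_epic_def zero_object_iff[OF cat has_zero])
next
  case (Suc d)
  let ?F = "\<lambda>i. coker_functor C A (fcomp T (SFun S i)) (\<lambda>x. FArr T (SNat S i x))"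
  \<comment> \<open>One stabilisation is peeled off the front of the list. Arrows h out of the
    cokernel correspond to arrows g = h q that annihilate T of the component at y; the remaining
    conditions match by \<open>corr\<close>.\<close>
  have key: "jointly_epic A (?F i) (stab_obj S is x) (stab_arrs S is x) \<longleftrightarrow>
      jointly_epic A T (stab_obj S (i # is) x) (stab_arrs S (i # is) x)"
    if i: "i \<in> SIdx S" and iis: "set is \<subseteq> SIdx S" and x: "x \<in> Obj C" for i "is" x
  proof -
    let ?y = "stab_obj S is x" and ?s = "SFun S i"
    let ?f = "FArr T (SNat S i ?y)"
    let ?q = "coker A ?f"
    have y: "?y \<in> Obj C" by (rule stab_obj_Obj[OF S iis x])
    have n: "SNat S i ?y \<in> Arr C" "Dom C (SNat S i ?y) = ?y" "Cod C (SNat S i ?y) = FObj ?s ?y"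
      using S i y by (auto simp: is_stabilised_def homset_def)
    have Ta: "FArr T f \<in> Arr A" "Dom A (FArr T f) = FObj T (Dom C f)" "Cod A (FArr T f) = FObj T (Cod C f)"
      if "f \<in> Arr C" for f using Suc.prems that by (auto simp: is_functor_def homset_def)
    note q = coker_arr[OF Ta(1)[OF n(1)]]
    have Fy: "FObj (?F i) ?y = Cod A ?q" by (simp add: coker_functor_def)
    \<comment> \<open>The composite (h q) T(s u) equals (h F(u)) q', where q' is the cokernel at the
      source of u and can be cancelled.\<close>
    have corr: "zero_arrow A (Cmp A (Cmp A h ?q) (FArr T (FArr ?s u))) \<longleftrightarrow>
         zero_arrow A (Cmp A h (FArr (?F i) u))"
      if h: "h \<in> Arr A" "Dom A h = Cod A ?q" and u: "u \<in> stab_arrs S is x" for h u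
    proof -
      have u: "u \<in> Arr C" "Cod C u = ?y" using stab_arrs_Arr[OF S iis x u] by auto
      have s: "is_functor C C ?s" using S i by (auto simp: is_stabilised_def)
      have su: "FArr ?s u \<in> Arr C" "Cod C (FArr ?s u) = FObj ?s ?y"
        using s u by (auto simp: is_functor_def homset_def)
      have ux: "Dom C u \<in> Obj C" using S u by (auto simp: is_stabilised_def is_category_def)
      have n': "SNat S i (Dom C u) \<in> Arr C" "Cod C (SNat S i (Dom C u)) = FObj ?s (Dom C u)"
        using S i ux by (auto simp: is_stabilised_def homset_def)
      note q' = coker_arr[OF Ta(1)[OF n'(1)]]
      note sq = coker_functor_square[OF S i Suc.prems u(1)]
      have Fu: "FArr (?F i) u \<in> Arr A" "Dom A (FArr (?F i) u) = Cod A (coker A (FArr T (SNat S i (Dom C u))))"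
        "Cod A (FArr (?F i) u) = Cod A ?q"
        using homsetD[OF sq(1)] u(2) by (auto simp: coker_functor_def)
      have "Cmp A (Cmp A h ?q) (FArr T (FArr ?s u)) = Cmp A h (Cmp A ?q (FArr T (FArr ?s u)))"
        by (rule cat_assoc[OF cat Ta(1)[OF su(1)] q(1) h(1), symmetric])
          (use Ta[OF su(1)] su q n Ta[OF n(1)] h in auto)
      also have "\<dots> = Cmp A h (Cmp A (FArr (?F i) u) (coker A (FArr T (SNat S i (Dom C u)))))"
        using sq(2) u(2) by simp
      also have "\<dots> = Cmp A (Cmp A h (FArr (?F i) u)) (coker A (FArr T (SNat S i (Dom C u))))"
        by (rule cat_assoc[OF cat q'(1) Fu(1) h(1)]) (use Fu h in auto)
      finally show ?thesis
        using zero_arrow_coker_iff[OF Ta(1)[OF n'(1)], of "Cmp A h (FArr (?F i) u)"]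
          cat_comp[OF cat Fu(1) h(1)] Fu h by simp
    qed
    have hq: "Cmp A h ?q \<in> Arr A" "Dom A (Cmp A h ?q) = FObj T (FObj ?s ?y)"
         "zero_arrow A (Cmp A (Cmp A h ?q) ?f)"
      if h: "h \<in> Arr A" "Dom A h = Cod A ?q" for h
    proof -
      show "Cmp A h ?q \<in> Arr A" "Dom A (Cmp A h ?q) = FObj T (FObj ?s ?y)"
        using cat_comp[OF cat q(1) h(1)] h q n Ta[OF n(1)] by auto
      have "Cmp A (Cmp A h ?q) ?f = Cmp A h (Cmp A ?q ?f)"
        by (rule cat_assoc[OF cat Ta(1)[OF n(1)] q(1) h(1), symmetric]) (use h q in auto)
      then show "zero_arrow A (Cmp A (Cmp A h ?q) ?f)"
        using zero_arrow_comp_left[OF cat q(3) h(1)] h cat_comp[OF cat Ta(1)[OF n(1)] q(1)] q by simp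
    qed
    show ?thesis
    proof
      assume L: "jointly_epic A (?F i) ?y (stab_arrs S is x)"
      show "jointly_epic A T (stab_obj S (i # is) x) (stab_arrs S (i # is) x)"
        unfolding jointly_epic_def
      proof (intro ballI impI, elim conjE)
        fix g assume g: "g \<in> Arr A" "Dom A g = FObj T (stab_obj S (i # is) x)"
          and z: "\<forall>u\<in>stab_arrs S (i # is) x. zero_arrow A (Cmp A g (FArr T u))"
        have "zero_arrow A (Cmp A g ?f)" using z by simp
        then obtain h where h: "h \<in> homset A (Cod A ?q) (Cod A g)" "Cmp A h ?q = g"
          using coker_factor[OF Ta(1)[OF n(1)] g(1)] g n Ta[OF n(1)] by auto
        note hh = homsetD[OF h(1)]
        have "zero_arrow A h"
          using L hh z corr[of h] h(2) unfolding jointly_epic_def Fy by auto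
        then show "zero_arrow A g"
          using zero_arrow_coker_iff[OF Ta(1)[OF n(1)], of h] hh h(2) by auto
      qed
    next
      assume R: "jointly_epic A T (stab_obj S (i # is) x) (stab_arrs S (i # is) x)"
      show "jointly_epic A (?F i) ?y (stab_arrs S is x)"
        unfolding jointly_epic_def Fy
      proof (intro ballI impI, elim conjE)
        fix h assume h: "h \<in> Arr A" "Dom A h = Cod A ?q"
          and z: "\<forall>u\<in>stab_arrs S is x. zero_arrow A (Cmp A h (FArr (?F i) u))"
        have "zero_arrow A (Cmp A h ?q)"
          using R hq[OF h] corr[OF h] z unfolding jointly_epic_def by auto
        then show "zero_arrow A h"
          using zero_arrow_coker_iff[OF Ta(1)[OF n(1)] h] by simp
      qed
    qed
  qed
  have "deg_less C A S (Suc d) T \<longleftrightarrow> (\<forall>i\<in>SIdx S. \<forall>is. length is = d \<and> set is \<subseteq> SIdx S \<longrightarrow>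
      (\<forall>x\<in>Obj C. jointly_epic A T (stab_obj S (i # is) x) (stab_arrs S (i # is) x)))"
    using Suc.IH[OF coker_functor_is_functor[OF S _ Suc.prems]] key by auto
  also have "\<dots> \<longleftrightarrow> (\<forall>is. length is = Suc d \<and> set is \<subseteq> SIdx S \<longrightarrow>
      (\<forall>x\<in>Obj C. jointly_epic A T (stab_obj S is x) (stab_arrs S is x)))"
    by (auto simp: length_Suc_conv simp del: stab_obj.simps stab_arrs.simps)
  finally show ?case .
qed

text \<open>The recursion defining the degree evaluates a functor only on stabilisation arrows, so the
  degree can be computed on any collection of arrows closed under the stabilisers.\<close>

lemma deg_less_transfer:
  fixes C :: "('o, 'a) cat" and C' :: "('o, 'a') cat"
  assumes "Obj C' = Obj C" "SIdx S' = r ` SIdx S"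
    and "\<And>f. f \<in> Arr C \<Longrightarrow> Dom C' (J f) = Dom C f \<and> Cod C' (J f) = Cod C f \<and>
            Dom C f \<in> Obj C \<and> Cod C f \<in> Obj C"
    and "\<And>i x. i \<in> SIdx S \<Longrightarrow> x \<in> Obj C \<Longrightarrow> FObj (SFun S i) x \<in> Obj C \<and>
            FObj (SFun S' (r i)) x = FObj (SFun S i) x"
    and "\<And>i f. i \<in> SIdx S \<Longrightarrow> f \<in> Arr C \<Longrightarrow> FArr (SFun S i) f \<in> Arr C \<and>
            FArr (SFun S' (r i)) (J f) = J (FArr (SFun S i) f)"
    and "\<And>i x. i \<in> SIdx S \<Longrightarrow> x \<in> Obj C \<Longrightarrow> SNat S i x \<in> Arr C \<and> SNat S' (r i) x = J (SNat S i x)"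
    and "\<And>x. x \<in> Obj C \<Longrightarrow> FObj T' x = FObj T x"
    and "\<And>f. f \<in> Arr C \<Longrightarrow> FArr T' (J f) = FArr T f"
  shows "deg_less C' A S' d T' \<longleftrightarrow> deg_less C A S d T"
  using assms(7,8)
proof (induction d arbitrary: T T')
  case 0
  then show ?case using assms(1) by auto
next
  case (Suc d)
  \<comment> \<open>Both sides form cokernels of the same arrows of A, and \<open>coker\<close> is
    one fixed choice, so the two cokernel functors satisfy the hypotheses again, with strict
    equality.\<close>
  have "deg_less C' A S' d (coker_functor C' A (fcomp T' (SFun S' (r i))) (\<lambda>x. FArr T' (SNat S' (r i) x))) \<longleftrightarrow>
        deg_less C A S d (coker_functor C A (fcomp T (SFun S i)) (\<lambda>x. FArr T (SNat S i x)))"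
    if i: "i \<in> SIdx S" for i
    by (rule Suc.IH)
      (use assms(3-6) Suc.prems i in \<open>auto simp: coker_functor_def fcomp_def\<close>)
  then show ?case
    by (simp add: assms(2))
qed

section \<open>Order-preserving injections\<close>

text \<open>Relations are used in place of functions because partial braids compose by keeping the
  strands that meet, which is composition of relations. The equivalence makes a relation injective
  and single-valued, an order isomorphism from its domain to its range. Naturals number the marked
  points, reals give positions on the arc.\<close>

definition mono_rel :: "('a::linorder \<times> 'b::linorder) set \<Rightarrow> bool" where
  "mono_rel P \<longleftrightarrow> (\<forall>u v u' v'. (u, v) \<in> P \<longrightarrow> (u', v') \<in> P \<longrightarrow> (u < u' \<longleftrightarrow> v < v'))"

lemma mono_relD: "mono_rel P \<Longrightarrow> (u, v) \<in> P \<Longrightarrow> (u', v') \<in> P \<Longrightarrow> u < u' \<longleftrightarrow> v < v'"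
  unfolding mono_rel_def by blast

lemma mono_rel_eq: "mono_rel P \<Longrightarrow> (u, v) \<in> P \<Longrightarrow> (u', v') \<in> P \<Longrightarrow> u = u' \<longleftrightarrow> v = v'"
  using mono_relD[of P u v u' v'] mono_relD[of P u' v' u v] by (meson less_irrefl linorder_neqE)

lemma mono_rel_subset: "mono_rel P \<Longrightarrow> Q \<subseteq> P \<Longrightarrow> mono_rel Q"
  unfolding mono_rel_def by blast

lemma mono_rel_converse: "mono_rel P \<Longrightarrow> mono_rel (P\<inverse>)"
  unfolding mono_rel_def by auto

lemma mono_rel_relcomp:
  assumes "mono_rel P" "mono_rel Q"
  shows "mono_rel (P O Q)"
  unfolding mono_rel_def using mono_relD[OF assms(1)] mono_relD[OF assms(2)] by blast

lemma mono_rel_Id_on: "mono_rel (Id_on A)"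
  by (auto simp: mono_rel_def)

lemma card_mono_rel_Domain:
  assumes "mono_rel P"
  shows "card P = card (Domain P)"
proof -
  have "inj_on fst P" using mono_rel_eq[OF assms] by (auto simp: inj_on_def)
  then show ?thesis by (metis card_image fst_eq_Domain)
qed

lemma card_mono_rel_Range:
  assumes "mono_rel P"
  shows "card P = card (Range P)"
proof -
  have "inj_on snd P" using mono_rel_eq[OF assms] by (auto simp: inj_on_def)
  then show ?thesis by (metis card_image snd_eq_Range)
qed

text \<open>Source and target are stored because the graph alone does not determine the target.
  \<open>P O Q\<close> is read from left to right: it is Q after P.\<close>

definition oinj_cat :: "(nat, nat \<times> nat \<times> (nat \<times> nat) set) cat" where
  "oinj_cat =
     \<lparr>Obj = UNIV,
      Arr = {(m, m', P). P \<subseteq> {1..m} \<times> {1..m'} \<and> Domain P = {1..m} \<and> mono_rel P},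
      Dom = (\<lambda>(m, m', P). m),
      Cod = (\<lambda>(m, m', P). m'),
      Idn = (\<lambda>m. (m, m, Id_on {1..m})),
      Cmp = (\<lambda>(l, l', Q) (m, m', P). (m, l', P O Q))\<rparr>"

definition shift_rel :: "nat \<Rightarrow> (nat \<times> nat) set \<Rightarrow> (nat \<times> nat) set" where
  "shift_rel m P = Id_on {1..m} \<union> (\<lambda>(i, j). (m + i, m + j)) ` P"

lemma shift_rel_iff:
  "(a, b) \<in> shift_rel m P \<longleftrightarrow> a = b \<and> 1 \<le> a \<and> a \<le> m \<or> (\<exists>i j. (i, j) \<in> P \<and> a = m + i \<and> b = m + j)"
  unfolding shift_rel_def by (auto simp: Id_on_iff image_iff)

text \<open>The index set is a parameter so that both structures have a model here:
  \<open>{1}\<close> for the single stabiliser and \<open>UNIV\<close> for the family.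
  \<open>SNat\<close> misses the first m points, since new points enter at the boundary end of the
  arc.\<close>

definition oinj_stab :: "nat set \<Rightarrow> (nat, nat, nat \<times> nat \<times> (nat \<times> nat) set) stabilisers" where
  "oinj_stab K =
     \<lparr>SIdx = K,
      SFun = (\<lambda>m. \<lparr>FObj = (\<lambda>l. m + l), FArr = (\<lambda>(l, l', P). (m + l, m + l', shift_rel m P))\<rparr>),
      SNat = (\<lambda>m l. (l, m + l, (\<lambda>i. (i, m + i)) ` {1..l}))\<rparr>"

lemma oinj_cat_simps [simp]:
  "Obj oinj_cat = UNIV" "Dom oinj_cat (m, m', P) = m" "Cod oinj_cat (m, m', P) = m'"
  "Idn oinj_cat m = (m, m, Id_on {1..m})"
  "Cmp oinj_cat (l, l', Q) (m, m', P) = (m, l', P O Q)"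
  by (simp_all add: oinj_cat_def)

lemma Arr_oinj_cat:
  "(m, m', P) \<in> Arr oinj_cat \<longleftrightarrow> P \<subseteq> {1..m} \<times> {1..m'} \<and> Domain P = {1..m} \<and> mono_rel P"
  by (simp add: oinj_cat_def)

lemma oinj_stab_simps [simp]:
  "SIdx (oinj_stab K) = K" "FObj (SFun (oinj_stab K) m) l = m + l"
  "FArr (SFun (oinj_stab K) m) (l, l', P) = (m + l, m + l', shift_rel m P)"
  "SNat (oinj_stab K) m l = (l, m + l, (\<lambda>i. (i, m + i)) ` {1..l})"
  by (simp_all add: oinj_stab_def)

lemma is_category_oinj_cat: "is_category oinj_cat"
proof -
  have "(m, l', P O Q) \<in> Arr oinj_cat" if "(m, m', P) \<in> Arr oinj_cat" "(m', l', Q) \<in> Arr oinj_cat"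
    for m m' l' P Q
  proof -
    have "Domain (P O Q) = {1..m}"
    proof
      show "Domain (P O Q) \<subseteq> {1..m}" using that unfolding Arr_oinj_cat by blast
      show "{1..m} \<subseteq> Domain (P O Q)"
      proof
        fix x assume "x \<in> {1..m}"
        then have "x \<in> Domain P" using that(1) unfolding Arr_oinj_cat by simp
        then obtain y where y: "(x, y) \<in> P" by blast
        then have "y \<in> Domain Q" using that unfolding Arr_oinj_cat by blast
        then show "x \<in> Domain (P O Q)" using y by blast
      qed
    qed
    then show ?thesis
      using that mono_rel_relcomp unfolding Arr_oinj_cat by blast
  qed
  moreover have "(m, m, Id_on {1..m}) \<in> Arr oinj_cat" for m
    by (auto simp: Arr_oinj_cat mono_rel_Id_on)
  moreover have "P O Id_on {1..m'} = P" "Id_on {1..m} O P = P" if "(m, m', P) \<in> Arr oinj_cat" for m m' P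
    using that unfolding Arr_oinj_cat by auto
  ultimately show ?thesis
    unfolding is_category_def homset_def by (auto simp: O_assoc)
qed

lemma shift_rel_Arr:
  assumes "(l, l', P) \<in> Arr oinj_cat"
  shows "(m + l, m + l', shift_rel m P) \<in> Arr oinj_cat"
proof -
  have P: "P \<subseteq> {1..l} \<times> {1..l'}" "Domain P = {1..l}" "mono_rel P"
    using assms by (auto simp: Arr_oinj_cat)
  have "Domain (shift_rel m P) = {1..m} \<union> (+) m ` Domain P"
    unfolding set_eq_iff Domain_iff shift_rel_iff by (auto simp: image_iff Domain_iff)
  also have "\<dots> = {1..m + l}"
    unfolding P(2) by (simp add: image_add_atLeastAtMost) auto
  finally have "Domain (shift_rel m P) = {1..m + l}" .
  moreover have "mono_rel (shift_rel m P)"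
    unfolding mono_rel_def
  proof (intro allI impI)
    fix u v u' v' assume "(u, v) \<in> shift_rel m P" "(u', v') \<in> shift_rel m P"
    then show "u < u' \<longleftrightarrow> v < v'"
      unfolding shift_rel_def using P(1) mono_relD[OF P(3)] by fastforce
  qed
  moreover have "shift_rel m P \<subseteq> {1..m + l} \<times> {1..m + l'}"
    using P(1) by (auto simp: shift_rel_def)
  ultimately show ?thesis by (simp add: Arr_oinj_cat)
qed

lemma shift_rel_relcomp:
  assumes "P \<subseteq> {1..l} \<times> {1..l'}" "Q \<subseteq> {1..l'} \<times> {1..l''}"
  shows "shift_rel m (P O Q) = shift_rel m P O shift_rel m Q"
proof (intro equalityI subrelI)
  fix a c assume "(a, c) \<in> shift_rel m (P O Q)"
  then show "(a, c) \<in> shift_rel m P O shift_rel m Q"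
    unfolding shift_rel_iff relcomp_unfold mem_Collect_eq prod.case by blast
next
  fix a c assume "(a, c) \<in> shift_rel m P O shift_rel m Q"
  then obtain b where "(a, b) \<in> shift_rel m P" "(b, c) \<in> shift_rel m Q" by blast
  then show "(a, c) \<in> shift_rel m (P O Q)"
    using assms unfolding shift_rel_iff by fastforce
qed

lemma SNat_oinj_Arr: "(l, m + l, (\<lambda>i. (i, m + i)) ` {1..l}) \<in> Arr oinj_cat"
  by (auto simp: Arr_oinj_cat mono_rel_def)

lemma is_stabilised_oinj: "is_stabilised oinj_cat (oinj_stab K)"
proof -
  have "shift_rel m (Id_on {1..l}) = Id_on {1..m + l}" for m l
  proof (intro equalityI subrelI)
    fix a b assume "(a, b) \<in> Id_on {1..m + l}"
    then show "(a, b) \<in> shift_rel m (Id_on {1..l})"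
      by (cases "a \<le> m") (auto simp: shift_rel_iff Id_on_iff intro!: exI[of _ "a - m"])
  qed (auto simp: shift_rel_iff Id_on_iff)
  moreover have Arr_shift_relcomp: "shift_rel m (P O Q) = shift_rel m P O shift_rel m Q"
    if "(l, l', P) \<in> Arr oinj_cat" "(l', l'', Q) \<in> Arr oinj_cat" for l l' l'' P Q m
    using that shift_rel_relcomp unfolding Arr_oinj_cat by blast
  ultimately have "is_functor oinj_cat oinj_cat (SFun (oinj_stab K) m)" for m
    using shift_rel_Arr Arr_shift_relcomp unfolding is_functor_def homset_def
    by auto
  \<comment> \<open>Naturality of the stabiliser: both sides send i to m plus the image of i under
    P.\<close>
  moreover have "P O (\<lambda>i. (i, m + i)) ` {1..l'} = (\<lambda>i. (i, m + i)) ` {1..l} O shift_rel m P"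
    if "(l, l', P) \<in> Arr oinj_cat" for l l' P m
  proof -
    have P: "P \<subseteq> {1..l} \<times> {1..l'}" using that by (auto simp: Arr_oinj_cat)
    show ?thesis
    proof (intro Set.set_eqI iffI; clarsimp simp: relcomp_unfold)
      fix x y assume xy: "(x, y) \<in> P" "Suc 0 \<le> y" "y \<le> l'"
      then have "x \<in> {Suc 0..l}" "(m + x, m + y) \<in> shift_rel m P"
        using P by (auto simp: shift_rel_def)
      then show "\<exists>w. (x, w) \<in> (\<lambda>i. (i, m + i)) ` {Suc 0..l} \<and> (w, m + y) \<in> shift_rel m P"
        by blast
    next
      fix x y assume x: "(m + x, y) \<in> shift_rel m P" "Suc 0 \<le> x" "x \<le> l"
      then obtain y' where "(x, y') \<in> P" "y = m + y'"
        by (auto simp: shift_rel_def)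
      then show "\<exists>w. (x, w) \<in> P \<and> (w, y) \<in> (\<lambda>i. (i, m + i)) ` {Suc 0..l'}"
        using P by auto
    qed
  qed
  ultimately show ?thesis
    unfolding is_stabilised_def homset_def using is_category_oinj_cat SNat_oinj_Arr by auto
qed

section \<open>Injections that miss a block, and the passage from singleton blocks to all
  blocks\<close>

lemma stab_obj_oinj [simp]: "stab_obj (oinj_stab K) ms n = sum_list ms + n"
  by (induction ms) auto

text \<open>The arrows \<^term>\<open>stab_arrs (oinj_stab K) ms n\<close> miss pairwise disjoint blocks.\<close>

lemma stab_arrs_oinj_cover:
  assumes "S \<subseteq> {1..sum_list ms + n}" "card S < length ms"
  shows "\<exists>l P. (l, sum_list ms + n, P) \<in> stab_arrs (oinj_stab K) ms n \<and> S \<subseteq> Range P"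
  using assms
proof (induction ms arbitrary: S)
  case (Cons m ms)
  let ?N = "sum_list ms + n"
  show ?case
  \<comment> \<open>If S avoids the first block, the injection missing that block covers S; this
    includes an empty block. Otherwise the block absorbs a point of S, and what is left, moved down
    by m, has fewer points than there are remaining blocks.\<close>
  proof (cases "S \<inter> {1..m} = {}")
    case True
    have "x \<in> Range ((\<lambda>i. (i, m + i)) ` {1..?N})" if "x \<in> S" for x
    proof -
      have "x \<in> {1..m + ?N}" "x \<notin> {1..m}" using that True Cons.prems(1) by auto
      then have "(x - m, x) = (\<lambda>i. (i, m + i)) (x - m)" "x - m \<in> {1..?N}" by auto
      then show ?thesis by blast
    qed
    then have "S \<subseteq> Range ((\<lambda>i. (i, m + i)) ` {1..?N})" by blast
    moreover have "(?N, sum_list (m # ms) + n, (\<lambda>i. (i, m + i)) ` {1..?N}) \<in> stab_arrs (oinj_stab K) (m # ms) n"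
      by (simp add: add.assoc)
    ultimately show ?thesis by blast
  next
    case False
    define S' where "S' = (\<lambda>x. x - m) ` (S - {1..m})"
    have finS: "finite S" using Cons.prems(1) finite_subset by blast
    have "card S' \<le> card (S - {1..m})"
      unfolding S'_def by (rule card_image_le) (use finS in auto)
    also have "\<dots> < card S"
      by (rule psubset_card_mono[OF finS]) (use False in auto)
    finally have "card S' < length ms" using Cons.prems(2) by simp
    moreover have "S' \<subseteq> {1..?N}"
      using Cons.prems(1) unfolding S'_def by fastforce
    ultimately obtain l P where P: "(l, ?N, P) \<in> stab_arrs (oinj_stab K) ms n" "S' \<subseteq> Range P"
      using Cons.IH by blast
    have "(m + l, m + ?N, shift_rel m P) \<in> stab_arrs (oinj_stab K) (m # ms) n"
      using P(1) by (auto intro!: rev_image_eqI)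
    moreover have "S \<subseteq> Range (shift_rel m P)"
    proof
      fix x assume x: "x \<in> S"
      show "x \<in> Range (shift_rel m P)"
      proof (cases "x \<in> {1..m}")
        case False
        then have "x - m \<in> Range P" using x P(2) unfolding S'_def by blast
        then obtain i where "(i, x - m) \<in> P" by blast
        then have "(m + i, m + (x - m)) \<in> shift_rel m P" unfolding shift_rel_def by force
        moreover have "m + (x - m) = x" using False x Cons.prems(1) by auto
        ultimately show ?thesis by auto
      qed (auto simp: shift_rel_iff Range_iff)
    qed
    ultimately show ?thesis by (auto simp: add.assoc)
  qed
qed simp

text \<open>A block of size one removes a single point, so precomposition with such an arrow lowers
  the source by one: the descent that the induction on k needs.\<close>

lemma stab_arrs_oinj_ones:
  assumes "(l, N, P) \<in> stab_arrs (oinj_stab K) (replicate d 1) n"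
  shows "Suc l = N"
  using assms by (induction d arbitrary: l N P) auto

text \<open>This is the inequality with content, bounding the degree for all block sizes by the
  degree for blocks of size one; the opposite one merely discards indices.\<close>

lemma (in category_with_cokernels) deg_less_oinj_all:
  assumes T: "is_functor oinj_cat A T" and one: "deg_less oinj_cat A (oinj_stab {1}) d T"
  shows "deg_less oinj_cat A (oinj_stab UNIV) d T"
proof -
  let ?C = oinj_cat
  note iff = deg_less_iff_jointly_epic[OF is_stabilised_oinj T]
  \<comment> \<open>The base n is arbitrary, so the hypothesis reaches every object k with k \<ge>
    d.\<close>
  have epi: "jointly_epic A T (d + n) (stab_arrs (oinj_stab {1}) (replicate d 1) n)" for n
    using spec[OF one[unfolded iff], of "replicate d 1"] by (auto simp: sum_list_replicate)
  have Ta: "FArr T f \<in> Arr A" "Dom A (FArr T f) = FObj T (Dom ?C f)" "Cod A (FArr T f) = FObj T (Cod ?C f)"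
    if "f \<in> Arr ?C" for f using T that by (auto simp: is_functor_def homset_def)
  have Tc: "FArr T (Cmp ?C g f) = Cmp A (FArr T g) (FArr T f)"
    if "f \<in> Arr ?C" "g \<in> Arr ?C" "Cod ?C f = Dom ?C g" for f g using T that by (auto simp: is_functor_def)
  have "jointly_epic A T (sum_list ms + n) (stab_arrs (oinj_stab UNIV) ms n)"
    if len: "length ms = d" for ms n
    unfolding jointly_epic_def
  proof (intro ballI impI, elim conjE)
    let ?N = "sum_list ms + n"
    fix g assume g: "g \<in> Arr A" "Dom A g = FObj T ?N"
      and z: "\<forall>u\<in>stab_arrs (oinj_stab UNIV) ms n. zero_arrow A (Cmp A g (FArr T u))"
    have "zero_arrow A (Cmp A g (FArr T (k, ?N, V)))" if "(k, ?N, V) \<in> Arr ?C" for k V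
      using that
    proof (induction k arbitrary: V rule: less_induct)
      case (less k)
      let ?v = "(k, ?N, V)"
      have V: "V \<subseteq> {1..k} \<times> {1..?N}" "Domain V = {1..k}" "mono_rel V"
        using less.prems by (auto simp: Arr_oinj_cat)
      have cardV: "card (Range V) = k"
        using card_mono_rel_Domain[OF V(3)] card_mono_rel_Range[OF V(3)] V(2) by simp
      show ?case
      proof (cases "k < d")
        case True
        \<comment> \<open>The image of v avoids one of the d disjoint blocks, so v factors.\<close>
        moreover have "Range V \<subseteq> {1..?N}" using V(1) by auto
        ultimately obtain l P where P: "(l, ?N, P) \<in> stab_arrs (oinj_stab UNIV) ms n" "Range V \<subseteq> Range P"
          using stab_arrs_oinj_cover[of "Range V" ms n UNIV] cardV len by auto
        have PA: "(l, ?N, P) \<in> Arr ?C"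
          using stab_arrs_Arr[OF is_stabilised_oinj _ _ P(1)] by simp
        then have PP: "P \<subseteq> {1..l} \<times> {1..?N}" "mono_rel P" by (auto simp: Arr_oinj_cat)
        have "{1..k} \<subseteq> Domain (V O P\<inverse>)"
          using V(2) P(2) by blast
        then have w: "(k, l, V O P\<inverse>) \<in> Arr ?C"
          using V(1) PP(1) mono_rel_relcomp[OF V(3) mono_rel_converse[OF PP(2)]]
          unfolding Arr_oinj_cat by blast
        \<comment> \<open>The factor of v is \<open>V O P\<inverse>\<close>: P is invertible on its
          range, which contains the image of V.\<close>
        have "V O P\<inverse> O P = V"
        proof (intro Set.set_eqI iffI; clarify)
          fix x y i z assume "(x, y) \<in> V" "(i, y) \<in> P" "(i, z) \<in> P"
          then show "(x, z) \<in> V" using mono_rel_eq[OF PP(2)] by blast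
        next
          fix x y assume "(x, y) \<in> V"
          then show "(x, y) \<in> V O P\<inverse> O P" using P(2) by blast
        qed
        then have "?v = Cmp ?C (l, ?N, P) (k, l, V O P\<inverse>)" by (simp add: O_assoc)
        then have "FArr T ?v = Cmp A (FArr T (l, ?N, P)) (FArr T (k, l, V O P\<inverse>))"
          using Tc[OF w PA] by simp
        then have "Cmp A g (FArr T ?v) = Cmp A (Cmp A g (FArr T (l, ?N, P))) (FArr T (k, l, V O P\<inverse>))"
          using cat_assoc[OF cat Ta(1)[OF w] Ta(1)[OF PA] g(1)] Ta[OF w] Ta[OF PA] g by simp
        moreover have "zero_arrow A (Cmp A g (FArr T (l, ?N, P)))" using z P(1) by blast
        ultimately show ?thesis
          using zero_arrow_comp_right[OF cat _ Ta(1)[OF w], of "Cmp A g (FArr T (l, ?N, P))"]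
            Ta[OF w] Ta[OF PA] cat_comp[OF cat Ta(1)[OF PA] g(1)] g by simp
      next
        case False
        let ?g = "Cmp A g (FArr T ?v)"
        \<comment> \<open>The source of v is written as d + (k - d) to expose d singleton blocks in
          front of a base of size k - d.\<close>
        have g': "?g \<in> Arr A" "Dom A ?g = FObj T (d + (k - d))"
          using cat_comp[OF cat Ta(1)[OF less.prems] g(1)] Ta[OF less.prems] g False by auto
        have "zero_arrow A (Cmp A ?g (FArr T u))"
          if u: "u \<in> stab_arrs (oinj_stab {1}) (replicate d 1) (k - d)" for u
        proof -
          have uA: "u \<in> Arr ?C" "Cod ?C u = k"
            using stab_arrs_Arr[OF is_stabilised_oinj _ _ u] False
            by (auto simp: sum_list_replicate set_replicate_conv_if)
          then obtain l P where uP: "u = (l, k, P)" by (cases u) auto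
          have l: "l < k" using stab_arrs_oinj_ones[of l k P "{1}" d "k - d"] u uP by auto
          have vu: "(l, ?N, P O V) \<in> Arr ?C"
            using cat_comp[OF is_category_oinj_cat uA(1) less.prems] uA uP by auto
          have "Cmp A ?g (FArr T u) = Cmp A g (Cmp A (FArr T ?v) (FArr T u))"
            using cat_assoc[OF cat Ta(1)[OF uA(1)] Ta(1)[OF less.prems] g(1)]
              Ta[OF uA(1)] Ta[OF less.prems] g uA by simp
          also have "Cmp A (FArr T ?v) (FArr T u) = FArr T (l, ?N, P O V)"
            using Tc[OF uA(1) less.prems] uA uP by simp
          finally show ?thesis using less.IH[OF l vu] by simp
        qed
        then show ?thesis using epi[of "k - d"] g' unfolding jointly_epic_def by blast
      qed
    qed
    moreover have "(?N, ?N, Id_on {1..?N}) \<in> Arr ?C"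
      by (auto simp: Arr_oinj_cat mono_rel_Id_on)
    moreover have "FArr T (?N, ?N, Id_on {1..?N}) = Idn A (FObj T ?N)"
      using T unfolding is_functor_def by (metis UNIV_I oinj_cat_simps(1,4))
    moreover have "Cmp A g (Idn A (FObj T ?N)) = g"
      using cat g by (auto simp: is_category_def)
    ultimately show "zero_arrow A g" by metis
  qed
  then show ?thesis unfolding iff by simp
qed

lemma deg_less_oinj_mono:
  assumes "deg_less oinj_cat A (oinj_stab K) d T" "K' \<subseteq> K"
  shows "deg_less oinj_cat A (oinj_stab K') d T"
  using assms by (induction d arbitrary: T) (auto simp: oinj_stab_def)

section \<open>Strands of families of configurations\<close>

lemma topspace_quotient_topology: "topspace (quotient_topology Y f) = f ` topspace Y"
proof
  show "topspace (quotient_topology Y f) \<subseteq> f ` topspace Y"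
    using openin_topspace[of "quotient_topology Y f"] unfolding openin_quotient_topology by blast
  have "openin (quotient_topology Y f) (f ` topspace Y)"
  proof -
    have "{x \<in> topspace Y. f x \<in> f ` topspace Y} = topspace Y" by auto
    then show ?thesis by (simp add: openin_quotient_topology)
  qed
  then show "f ` topspace Y \<subseteq> topspace (quotient_topology Y f)"
    by (rule openin_subset)
qed

lemma continuous_map_quotient_topology: "continuous_map Y (quotient_topology Y f) f"
  unfolding continuous_map_def
  by (auto simp: topspace_quotient_topology openin_quotient_topology)

lemma conf_spaceD:
  assumes "C \<in> topspace (conf_space k M X)"
  shows "finite C" "card C = k" "inj_on fst C" "C \<subseteq> topspace M \<times> topspace X"
proof -
  obtain f where f: "f \<in> topspace (product_topology (\<lambda>_. prod_topology M X) {..<k})"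
      "inj_on (fst \<circ> f) {..<k}" "C = f ` {..<k}"
    using assms unfolding conf_space_def topspace_quotient_topology by auto
  show "finite C" using f(3) by simp
  show "card C = k" unfolding f(3) using card_image[of f "{..<k}"] inj_on_imageI2[OF f(2)] by simp
  show "inj_on fst C" unfolding f(3) by (rule inj_on_imageI[OF f(2)])
  show "C \<subseteq> topspace M \<times> topspace X"
  proof (unfold f(3), rule image_subsetI)
    fix i assume "i \<in> {..<k}"
    then show "f i \<in> topspace M \<times> topspace X" using f(1) by (auto simp: PiE_iff)
  qed
qed

text \<open>Among ordered configurations the condition is a union of preimages of V under the
  coordinates. These open sets are the ones used to follow single points of a configuration.\<close>

lemma openin_conf_space_meets:
  assumes "openin (prod_topology M X) V"
  shows "openin (conf_space k M X) {C \<in> topspace (conf_space k M X). C \<inter> V \<noteq> {}}"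
proof -
  let ?Y = "subtopology (product_topology (\<lambda>_. prod_topology M X) {..<k})
          {f. inj_on (fst \<circ> f) {..<k}}"
  let ?q = "\<lambda>f. f ` {..<k}"
  have "{f \<in> topspace ?Y. ?q f \<in> {C \<in> ?q ` topspace ?Y. C \<inter> V \<noteq> {}}} =
      (\<Union>i\<in>{..<k}. {f \<in> topspace ?Y. f i \<in> V})"
    by auto
  moreover have "openin ?Y {f \<in> topspace ?Y. f i \<in> V}" if "i \<in> {..<k}" for i
  proof (rule openin_continuous_map_preimage[OF _ assms])
    show "continuous_map ?Y (prod_topology M X) (\<lambda>f. f i)"
      using that by (intro continuous_map_from_subtopology continuous_map_product_projection)
  qed
  ultimately show ?thesis
    unfolding conf_space_def topspace_quotient_topology openin_quotient_topology
    by (auto intro!: openin_clauses(3))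
qed

text \<open>An enumeration of I lifts the map to ordered configurations, where continuity is
  coordinatewise; the quotient map then forgets the enumeration.\<close>

lemma continuous_map_conf_space:
  assumes I: "finite I"
    and h: "\<And>i. i \<in> I \<Longrightarrow> continuous_map Z (prod_topology M X) (h i)"
    and inj: "\<And>z. z \<in> topspace Z \<Longrightarrow> inj_on (\<lambda>i. fst (h i z)) I"
  shows "continuous_map Z (conf_space (card I) M X) (\<lambda>z. (\<lambda>i. h i z) ` I)"
proof -
  let ?k = "card I"
  let ?Y = "subtopology (product_topology (\<lambda>_. prod_topology M X) {..<?k})
          {f. inj_on (fst \<circ> f) {..<?k}}"
  obtain b where b: "bij_betw b {..<?k} I"
    using ex_bij_betw_nat_finite[OF I] by (auto simp: atLeast0LessThan)
  have bI: "b i \<in> I" if "i < ?k" for i using b that by (auto simp: bij_betw_def)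
  let ?g = "\<lambda>z. \<lambda>i\<in>{..<?k}. h (b i) z"
  have "continuous_map Z (product_topology (\<lambda>_. prod_topology M X) {..<?k}) ?g"
    unfolding continuous_map_componentwise
  proof (intro conjI ballI)
    fix i assume i: "i \<in> {..<?k}"
    have "continuous_map Z (prod_topology M X) (h (b i))" using h bI i by auto
    then show "continuous_map Z (prod_topology M X) (\<lambda>z. ?g z i)"
      by (rule continuous_map_eq) (use i in auto)
  qed auto
  moreover have "?g z \<in> {f. inj_on (fst \<circ> f) {..<?k}}" if "z \<in> topspace Z" for z
  proof -
    have "inj_on ((\<lambda>i. fst (h i z)) \<circ> b) {..<?k}"
      using b inj[OF that] by (auto simp: bij_betw_def intro: comp_inj_on)
    then show ?thesis by (simp add: inj_on_def)
  qed
  ultimately have "continuous_map Z ?Y ?g"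
    by (auto simp: continuous_map_in_subtopology)
  from continuous_map_compose[OF this continuous_map_quotient_topology]
  have "continuous_map Z (conf_space ?k M X) ((\<lambda>f. f ` {..<?k}) \<circ> ?g)"
    unfolding conf_space_def .
  then show ?thesis
  proof (rule continuous_map_eq)
    fix z
    have "?g z ` {..<?k} = (\<lambda>i. h i z) ` (b ` {..<?k})" by (auto simp: image_iff)
    then show "((\<lambda>f. f ` {..<?k}) \<circ> ?g) z = (\<lambda>i. h i z) ` I"
      using b by (simp add: bij_betw_def)
  qed
qed

text \<open>A lift of H over A to labelled points indexed by I. The index type is left free because
  strands are indexed by numbers or by pairs of positions.\<close>

definition strands ::
  "'m topology \<Rightarrow> 'x topology \<Rightarrow> 'z::topological_space set \<Rightarrow> 'i set \<Rightarrow> ('i \<Rightarrow> 'z \<Rightarrow> 'm \<times> 'x) \<Rightarrow>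
     ('z \<Rightarrow> ('m \<times> 'x) set) \<Rightarrow> bool" where
  "strands M X A I h H \<longleftrightarrow>
     (\<forall>i\<in>I. continuous_map (top_of_set A) (prod_topology M X) (h i)) \<and>
     (\<forall>z\<in>A. inj_on (\<lambda>i. fst (h i z)) I \<and> H z = (\<lambda>i. h i z) ` I)"

lemma strands_subset: "strands M X A I h H \<Longrightarrow> B \<subseteq> A \<Longrightarrow> strands M X B I h H"
  unfolding strands_def by (meson continuous_map_from_subtopology_mono subsetD)

section \<open>Existence and uniqueness of lifts to strands\<close>

lemma disjoint_neighbourhoods:
  assumes M: "Hausdorff_space M" and J: "finite J" and inj: "inj_on p J" and p: "p ` J \<subseteq> topspace M"
  shows "\<exists>U. \<forall>i\<in>J. openin M (U i) \<and> p i \<in> U i \<and> (\<forall>j\<in>J. i \<noteq> j \<longrightarrow> U i \<inter> U j = {})"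
proof -
  have "\<exists>D. openin M (fst D) \<and> openin M (snd D) \<and> p i \<in> fst D \<and> p j \<in> snd D \<and> disjnt (fst D) (snd D)"
    if "i \<in> J" "j \<in> J" "i \<noteq> j" for i j
  proof -
    have "p i \<in> topspace M" "p j \<in> topspace M" "p i \<noteq> p j"
      using that inj p by (auto simp: inj_on_def)
    then obtain U V where "openin M U" "openin M V" "p i \<in> U" "p j \<in> V" "disjnt U V"
      using M unfolding Hausdorff_space_def by metis
    then show ?thesis by (intro exI[of _ "(U, V)"]) simp
  qed
  then obtain D where D: "\<And>i j. i \<in> J \<Longrightarrow> j \<in> J \<Longrightarrow> i \<noteq> j \<Longrightarrow>
      openin M (fst (D i j)) \<and> openin M (snd (D i j)) \<and> p i \<in> fst (D i j) \<and> p j \<in> snd (D i j) \<and>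
      disjnt (fst (D i j)) (snd (D i j))"
    by metis
  define U where "U i = (\<Inter>j\<in>J - {i}. fst (D i j) \<inter> snd (D j i)) \<inter> topspace M" for i
  show ?thesis
  proof (intro exI[of _ U] ballI conjI impI)
    fix i assume i: "i \<in> J"
    show "openin M (U i)"
      unfolding U_def by (rule openin_INT) (use J D i in \<open>auto intro!: openin_Int\<close>)
    show "p i \<in> U i" using D i p by (auto simp: U_def)
    fix j assume "j \<in> J" "i \<noteq> j"
    then have "U i \<subseteq> fst (D i j)" "U j \<subseteq> snd (D i j)" "disjnt (fst (D i j)) (snd (D i j))"
      using D i by (auto simp: U_def)
    then show "U i \<inter> U j = {}" by (auto simp: disjnt_iff)
  qed
qed

text \<open>Disjoint neighbourhoods \<open>U i\<close> of the k points of \<open>H z0\<close> are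
  all hit by \<open>H z\<close> for z nearby. As \<open>H z\<close> has k points, it has exactly one
  in each, and \<open>h i z\<close> is that point. This is the covering property of ordered over
  unordered configurations.\<close>

lemma strands_locally:
  assumes M: "Hausdorff_space M" and H: "continuous_map (top_of_set A) (conf_space k M X) H"
    and z0: "z0 \<in> A"
  shows "\<exists>V h. open V \<and> z0 \<in> V \<and> strands M X (A \<inter> V) {..<k} h H"
proof -
  have HC: "H z \<in> topspace (conf_space k M X)" if "z \<in> A" for z
    using continuous_map_funspace[OF H] that by auto
  note HD = conf_spaceD[OF HC]
  obtain e where e: "bij_betw e {..<k} (H z0)"
    using ex_bij_betw_nat_finite[OF HD(1)[OF z0]] HD(2)[OF z0] by (auto simp: atLeast0LessThan)
  have "inj_on (fst \<circ> e) {..<k}"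
    using e HD(3)[OF z0] by (auto simp: bij_betw_def intro: comp_inj_on)
  moreover have "(fst \<circ> e) ` {..<k} \<subseteq> topspace M"
  proof (rule image_subsetI)
    fix i assume "i \<in> {..<k}"
    then have "e i \<in> H z0" using e by (auto simp: bij_betw_def)
    then show "(fst \<circ> e) i \<in> topspace M" using HD(4)[OF z0] by (auto simp: mem_Times_iff)
  qed
  ultimately obtain U where U: "\<And>i. i < k \<Longrightarrow> openin M (U i)" "\<And>i. i < k \<Longrightarrow> fst (e i) \<in> U i"
      "\<And>i j. i < k \<Longrightarrow> j < k \<Longrightarrow> i \<noteq> j \<Longrightarrow> U i \<inter> U j = {}"
    using disjoint_neighbourhoods[OF M, of "{..<k}" "fst \<circ> e"]
    by (metis comp_apply finite_lessThan lessThan_iff)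
  have UX: "openin (prod_topology M X) (U i \<times> topspace X)" if "i < k" for i
    using U(1)[OF that] by (simp add: openin_prod_Times_iff)
  have meet: "openin (top_of_set A) {z \<in> A. H z \<inter> V \<noteq> {}}" if "openin (prod_topology M X) V" for V
    using openin_continuous_map_preimage[OF H openin_conf_space_meets[OF that]] HC
    by (simp cong: conj_cong)
  let ?W = "{z \<in> A. \<forall>i<k. H z \<inter> U i \<times> topspace X \<noteq> {}}"
  have "?W = A \<inter> (\<Inter>i\<in>{..<k}. {z \<in> A. H z \<inter> U i \<times> topspace X \<noteq> {}})" by auto
  moreover have "openin (top_of_set A) (A \<inter> (\<Inter>i\<in>{..<k}. {z \<in> A. H z \<inter> U i \<times> topspace X \<noteq> {}}))"
    using meet[OF UX] by (cases "k = 0") (auto intro!: openin_Int openin_INT2)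
  ultimately have "openin (top_of_set A) ?W" by simp
  then obtain V where V: "open V" "?W = A \<inter> V" by (auto simp: openin_open)
  define h where "h i z = (THE p. p \<in> H z \<and> fst p \<in> U i)" for i z
  have hz: "h i z \<in> H z \<and> fst (h i z) \<in> U i \<and> (\<forall>p\<in>H z. fst p \<in> U i \<longrightarrow> p = h i z)"
    and Hz: "H z = (\<lambda>i. h i z) ` {..<k}" if z: "z \<in> A \<inter> V" and i: "i < k" for i z
  proof -
    have "\<forall>j. \<exists>r. j < k \<longrightarrow> r \<in> H z \<and> fst r \<in> U j" using z V(2) by fastforce
    then obtain r where r: "\<And>j. j < k \<Longrightarrow> r j \<in> H z \<and> fst (r j) \<in> U j" by metis
    have "inj_on r {..<k}"
      using r U(3) by (auto simp: inj_on_def) (metis disjoint_iff)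
    then have rH: "r ` {..<k} = H z"
      using r HD(1,2)[of z] z by (intro card_subset_eq) (auto simp: card_image)
    have uniq: "p = r j" if "p \<in> H z" "fst p \<in> U j" "j < k" for p j
    proof -
      obtain j' where "j' < k" "p = r j'" using \<open>p \<in> H z\<close> rH by auto
      then show ?thesis using that r[of j'] U(3)[of j j'] by (cases "j = j'") auto
    qed
    have hr: "h j z = r j" if "j < k" for j
      unfolding h_def using r[OF that] uniq that by (intro the_equality) auto
    show "h i z \<in> H z \<and> fst (h i z) \<in> U i \<and> (\<forall>p\<in>H z. fst p \<in> U i \<longrightarrow> p = h i z)"
      using r uniq hr i by auto
    show "H z = (\<lambda>i. h i z) ` {..<k}" using rH hr by (auto simp: image_iff)
  qed
  have "strands M X (A \<inter> V) {..<k} h H"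
    unfolding strands_def
  proof (intro conjI ballI)
    fix i assume "i \<in> {..<k}"
    then have i: "i < k" by simp
    show "continuous_map (top_of_set (A \<inter> V)) (prod_topology M X) (h i)"
      unfolding continuous_map_def
    proof (intro conjI allI impI)
      show "h i \<in> topspace (top_of_set (A \<inter> V)) \<rightarrow> topspace (prod_topology M X)"
      proof
        fix z assume "z \<in> topspace (top_of_set (A \<inter> V))"
        then have "z \<in> A \<inter> V" by simp
        then have "h i z \<in> H z" "H z \<subseteq> topspace M \<times> topspace X" using hz[OF _ i, of z] HD(4)[of z] by blast+
        then show "h i z \<in> topspace (prod_topology M X)" by auto
      qed
      fix Q assume Q: "openin (prod_topology M X) Q"
      \<comment> \<open>Continuity of a strand reduces to open sets of configurations that hit a
        given set: the point of \<open>H z\<close> in \<open>U i\<close> lies in Q iff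
        \<open>H z\<close> hits the part of Q over \<open>U i\<close>.\<close>
      have "{z \<in> topspace (top_of_set (A \<inter> V)). h i z \<in> Q} =
          (A \<inter> V) \<inter> {z \<in> A. H z \<inter> (Q \<inter> U i \<times> topspace X) \<noteq> {}}"
      proof (intro Set.set_eqI iffI)
        fix z assume "z \<in> {z \<in> topspace (top_of_set (A \<inter> V)). h i z \<in> Q}"
        then have z: "z \<in> A \<inter> V" "h i z \<in> Q" by auto
        have "h i z \<in> H z" "fst (h i z) \<in> U i" by (metis hz[OF z(1) i])+
        moreover have "snd (h i z) \<in> topspace X"
          using subsetD[OF HD(4) \<open>h i z \<in> H z\<close>] z(1) by (simp add: mem_Times_iff)
        ultimately have "h i z \<in> H z \<inter> (Q \<inter> U i \<times> topspace X)"
          using z(2) by (simp add: mem_Times_iff)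
        then have "H z \<inter> (Q \<inter> U i \<times> topspace X) \<noteq> {}" by (rule ex_in_conv[THEN iffD1, OF exI])
        then show "z \<in> (A \<inter> V) \<inter> {z \<in> A. H z \<inter> (Q \<inter> U i \<times> topspace X) \<noteq> {}}" using z(1) by simp
      next
        fix z assume "z \<in> (A \<inter> V) \<inter> {z \<in> A. H z \<inter> (Q \<inter> U i \<times> topspace X) \<noteq> {}}"
        then obtain p where p: "z \<in> A \<inter> V" "p \<in> H z" "p \<in> Q" "fst p \<in> U i" by auto
        then have "p = h i z" using hz[OF p(1) i] by metis
        then show "z \<in> {z \<in> topspace (top_of_set (A \<inter> V)). h i z \<in> Q}" using p(1,3) by simp
      qed
      moreover have "openin (top_of_set A) {z \<in> A. H z \<inter> (Q \<inter> U i \<times> topspace X) \<noteq> {}}"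
        by (rule meet) (use Q UX[OF i] in \<open>auto intro: openin_Int\<close>)
      ultimately show "openin (top_of_set (A \<inter> V)) {z \<in> topspace (top_of_set (A \<inter> V)). h i z \<in> Q}"
        using V(1) by (auto simp: openin_open)
    qed
  next
    fix z assume z: "z \<in> A \<inter> V"
    show "inj_on (\<lambda>i. fst (h i z)) {..<k}"
    proof (rule inj_onI, rule ccontr)
      fix i j assume ij: "i \<in> {..<k}" "j \<in> {..<k}" "fst (h i z) = fst (h j z)" "i \<noteq> j"
      then have "fst (h i z) \<in> U i \<inter> U j" using hz[OF z, of i] hz[OF z, of j] by (metis IntI lessThan_iff)
      then show False using U(3)[of i j] ij by blast
    qed
    show "H z = (\<lambda>i. h i z) ` {..<k}"
    proof (cases "k = 0")
      case True then show ?thesis using HD(1,2)[of z] z by auto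
    qed (use Hz[OF z] in auto)
  qed
  moreover have "z0 \<in> V"
  proof -
    have "e i \<in> H z0 \<inter> U i \<times> topspace X" if "i < k" for i
    proof -
      have "e i \<in> H z0" using e that by (auto simp: bij_betw_def)
      then show ?thesis using U(2)[OF that] subsetD[OF HD(4)[OF z0], of "e i"] by (simp add: mem_Times_iff)
    qed
    then have "z0 \<in> ?W" using z0 by blast
    then show ?thesis using V(2) by blast
  qed
  ultimately show ?thesis using V(1) by blast
qed

text \<open>Uniqueness of lifts over a connected set. The sets \<open>E j\<close> where strand i has
  the position of strand j of the other family are closed, finitely many, disjoint and cover A, so
  they are also open. Labels agree too, because a configuration has one label at each of its
  points.\<close>

lemma strands_match:
  assumes M: "Hausdorff_space M" and A: "connected A" "A \<noteq> {}" and I': "finite I'"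
    and f: "strands M X A I f H" and g: "strands M X A I' g H" and i: "i \<in> I"
  shows "\<exists>j\<in>I'. \<forall>z\<in>A. f i z = g j z"
proof -
  define E where "E j = {z \<in> A. fst (f i z) = fst (g j z)}" for j
  have clo: "closedin (top_of_set A) (E j)" if "j \<in> I'" for j
  proof -
    have "continuous_map (top_of_set A) M (fst \<circ> f i)" "continuous_map (top_of_set A) M (fst \<circ> g j)"
      using f g i that unfolding strands_def by (auto intro: continuous_map_compose continuous_map_fst)
    from closedin_continuous_maps_eq[OF M this] show ?thesis by (simp add: E_def)
  qed
  have fg: "f i z \<in> (\<lambda>j. g j z) ` I'" if "z \<in> A" for z
    using f g i that unfolding strands_def by blast
  obtain z0 where z0: "z0 \<in> A" using A(2) by blast
  then obtain j where j: "j \<in> I'" "f i z0 = g j z0" using fg by blast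
  have "E j = A - (\<Union>j'\<in>I' - {j}. E j')"
  proof (intro equalityI subsetI)
    fix z assume z: "z \<in> E j"
    then have "z \<notin> E j'" if "j' \<in> I' - {j}" for j'
      using g j(1) that unfolding strands_def E_def inj_on_def by fastforce
    then show "z \<in> A - (\<Union>j'\<in>I' - {j}. E j')" using z by (auto simp: E_def)
  next
    fix z assume z: "z \<in> A - (\<Union>j'\<in>I' - {j}. E j')"
    then obtain j' where "j' \<in> I'" "f i z = g j' z" using fg by blast
    then show "z \<in> E j" using z by (cases "j' = j") (auto simp: E_def)
  qed
  moreover have "closedin (top_of_set A) (\<Union>j'\<in>I' - {j}. E j')"
    using clo I' by (intro closedin_Union) auto
  ultimately have "openin (top_of_set A) (E j)"
    using openin_diff[OF openin_topspace[of "top_of_set A"]] by simp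
  moreover have "E j \<noteq> {}" using z0 j by (auto simp: E_def)
  ultimately have "E j = A"
    using A(1) clo[OF j(1)] unfolding connected_clopen by blast
  have "f i z = g j z" if z: "z \<in> A" for z
  proof -
    have "inj_on fst (H z)"
      using g z unfolding strands_def by (auto simp: inj_on_def)
    moreover have "H z = (\<lambda>i. f i z) ` I" "H z = (\<lambda>j. g j z) ` I'"
      using f g z unfolding strands_def by blast+
    then have "f i z \<in> H z" "g j z \<in> H z" using i j(1) by blast+
    moreover have "fst (f i z) = fst (g j z)" using \<open>E j = A\<close> z by (auto simp: E_def)
    ultimately show ?thesis by (auto simp: inj_on_def)
  qed
  then show ?thesis using j(1) by blast
qed

lemma continuous_map_closed_Un:
  assumes "closedin Z A" "closedin Z B" "topspace Z \<subseteq> A \<union> B"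
    and "continuous_map (subtopology Z A) Y g" "continuous_map (subtopology Z B) Y g"
  shows "continuous_map Z Y g"
  by (rule pasting_lemma_closed[of "UNIV :: bool set" Z "\<lambda>b. if b then A else B" Y "\<lambda>_. g"])
    (use assms in \<open>auto split: if_splits\<close>)

text \<open>On the connected overlap the two lifts differ by one fixed permutation, by uniqueness of
  lifts. Renumbering the second lift makes the strands agree there, and they paste along closed
  sets.\<close>

lemma strands_Un:
  assumes M: "Hausdorff_space M" and clo: "closed A" "closed B" and con: "connected (A \<inter> B)"
    and f: "strands M X A {..<k} f H" and g: "strands M X B {..<k} g H"
  shows "\<exists>h. strands M X (A \<union> B) {..<k::nat} h H"
proof -
  have "\<exists>\<sigma>. bij_betw \<sigma> {..<k} {..<k} \<and> (\<forall>i<k. \<forall>z\<in>A \<inter> B. f i z = g (\<sigma> i) z)"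
  proof (cases "A \<inter> B = {}")
    case True
    then show ?thesis by (intro exI[of _ id]) auto
  next
    case False
    have fg: "strands M X (A \<inter> B) {..<k} f H" "strands M X (A \<inter> B) {..<k} g H"
      using f g strands_subset by blast+
    have "\<forall>i. \<exists>j. i < k \<longrightarrow> j < k \<and> (\<forall>z\<in>A \<inter> B. f i z = g j z)"
      using strands_match[OF M con False _ fg] by (meson finite_lessThan lessThan_iff)
    then obtain \<sigma> where \<sigma>: "\<And>i. i < k \<Longrightarrow> \<sigma> i < k \<and> (\<forall>z\<in>A \<inter> B. f i z = g (\<sigma> i) z)"
      by metis
    obtain z where z: "z \<in> A \<inter> B" using False by blast
    have "inj_on \<sigma> {..<k}"
    proof (rule inj_onI)
      fix i j assume "i \<in> {..<k}" "j \<in> {..<k}" "\<sigma> i = \<sigma> j"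
      then have "f i z = f j z" using \<sigma> z by simp
      then show "i = j"
        using fg(1) z \<open>i \<in> {..<k}\<close> \<open>j \<in> {..<k}\<close> unfolding strands_def inj_on_def by metis
    qed
    moreover have "\<sigma> ` {..<k} \<subseteq> {..<k}" using \<sigma> by auto
    ultimately have "bij_betw \<sigma> {..<k} {..<k}"
      by (simp add: bij_betw_def endo_inj_surj)
    then show ?thesis using \<sigma> by blast
  qed
  then obtain \<sigma> where b: "bij_betw \<sigma> {..<k} {..<k}"
    and fg: "\<And>i z. i < k \<Longrightarrow> z \<in> A \<inter> B \<Longrightarrow> f i z = g (\<sigma> i) z" by blast
  define h where "h i z = (if z \<in> A then f i z else g (\<sigma> i) z)" for i z
  have \<sigma>k: "\<sigma> i < k" if "i < k" for i using b that by (auto simp: bij_betw_def)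
  have hA: "h i z = f i z" if "z \<in> A" for i z using that by (simp add: h_def)
  have hB: "h i z = g (\<sigma> i) z" if "z \<in> B" "i < k" for i z using that fg by (simp add: h_def)
  have "strands M X (A \<union> B) {..<k} h H"
    unfolding strands_def
  proof (intro conjI ballI)
    fix i assume "i \<in> {..<k}"
    then have i: "i < k" by simp
    show "continuous_map (top_of_set (A \<union> B)) (prod_topology M X) (h i)"
    proof (rule continuous_map_closed_Un)
      show "closedin (top_of_set (A \<union> B)) A" "closedin (top_of_set (A \<union> B)) B"
        using clo by (auto simp: closedin_closed)
      have "continuous_map (top_of_set A) (prod_topology M X) (f i)"
        using f i by (simp add: strands_def)
      then have "continuous_map (top_of_set A) (prod_topology M X) (h i)"
        by (rule continuous_map_eq) (simp add: hA)
      then show "continuous_map (subtopology (top_of_set (A \<union> B)) A) (prod_topology M X) (h i)"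
        by (simp add: subtopology_subtopology Int_absorb1)
      have "continuous_map (top_of_set B) (prod_topology M X) (g (\<sigma> i))"
        using g \<sigma>k[OF i] by (simp add: strands_def)
      then have "continuous_map (top_of_set B) (prod_topology M X) (h i)"
        by (rule continuous_map_eq) (simp add: hB i)
      then show "continuous_map (subtopology (top_of_set (A \<union> B)) B) (prod_topology M X) (h i)"
        by (simp add: subtopology_subtopology Int_absorb1)
    qed simp
  next
    fix z assume z: "z \<in> A \<union> B"
    show "inj_on (\<lambda>i. fst (h i z)) {..<k}"
    proof (cases "z \<in> A")
      case True then show ?thesis using f by (simp add: strands_def hA)
    next
      case False
      then have "z \<in> B" using z by blast
      then have "inj_on ((\<lambda>i. fst (g i z)) \<circ> \<sigma>) {..<k}"
        using g b by (auto simp: strands_def bij_betw_def intro: comp_inj_on)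
      then show ?thesis using hB[OF \<open>z \<in> B\<close>] by (simp add: inj_on_def)
    qed
    show "H z = (\<lambda>i. h i z) ` {..<k}"
    proof (cases "z \<in> A")
      case True then show ?thesis using f by (simp add: strands_def hA)
    next
      case False
      then have "z \<in> B" using z by blast
      then have "H z = (\<lambda>i. g i z) ` (\<sigma> ` {..<k})" using g b by (simp add: strands_def bij_betw_def)
      also have "\<dots> = (\<lambda>i. h i z) ` {..<k}" using hB[OF \<open>z \<in> B\<close>] by (auto simp: image_iff)
      finally show ?thesis .
    qed
  qed
  then show ?thesis by blast
qed

text \<open>Bisection in each coordinate in turn replaces a subdivision of the rectangle.
  \<open>R J K\<close> is the part of the rectangle inside J x K; adjacent parts overlap in convex,
  hence connected, sets, as gluing requires.\<close>

lemma strands_rectangle: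
  fixes H :: "real \<times> real \<Rightarrow> ('m \<times> 'x) set"
  assumes M: "Hausdorff_space M" and ab: "a \<le> b" and cd: "c \<le> d"
    and H: "continuous_map (top_of_set ({a..b} \<times> {c..d})) (conf_space k M X) H"
  shows "\<exists>h. strands M X ({a..b} \<times> {c..d}) {..<k} h H"
proof -
  define R where "R J K = (({a..b} \<inter> J) \<times> ({c..d} \<inter> K) :: (real \<times> real) set)" for J K
  have loc: "\<exists>\<epsilon>>0. \<exists>h. strands M X (R {s-\<epsilon>..s+\<epsilon>} {t-\<epsilon>..t+\<epsilon>}) {..<k} h H"
    if st: "s \<in> {a..b}" "t \<in> {c..d}" for s t
  proof -
    obtain V h where V: "open V" "(s, t) \<in> V" "strands M X ({a..b} \<times> {c..d} \<inter> V) {..<k} h H"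
      using strands_locally[OF M H, of "(s, t)"] st by auto
    obtain V1 V2 where V12: "open V1" "open V2" "(s, t) \<in> V1 \<times> V2" "V1 \<times> V2 \<subseteq> V"
      using open_prod_elim[OF V(1,2)] by metis
    obtain e1 e2 where e: "e1 > 0" "cball s e1 \<subseteq> V1" "e2 > 0" "cball t e2 \<subseteq> V2"
      using V12 open_contains_cball by (metis mem_Sigma_iff)
    let ?e = "min e1 e2"
    have "{s-?e..s+?e} \<subseteq> V1" "{t-?e..t+?e} \<subseteq> V2"
      using e(2,4) unfolding cball_eq_atLeastAtMost by (meson order_trans atLeastatMost_subset_iff
          add_left_mono diff_left_mono min.cobounded1 min.cobounded2)+
    then have "R {s-?e..s+?e} {t-?e..t+?e} \<subseteq> {a..b} \<times> {c..d} \<inter> V"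
      using V12(4) unfolding R_def by blast
    then have "strands M X (R {s-?e..s+?e} {t-?e..t+?e}) {..<k} h H"
      using V(3) strands_subset by blast
    moreover have "?e > 0" using e by simp
    ultimately show ?thesis by blast
  qed
  have closedR: "closed (R J K)" if "closed J" "closed K" for J K
    unfolding R_def using that by (intro closed_Times closed_Int) auto
  have connR: "connected (R J K)" if "convex J" "convex K" for J K
    unfolding R_def using that by (intro convex_connected convex_Times convex_Int) auto
  \<comment> \<open>For fixed s the lifts near the points (s, t) are joined along t. The width is
    quantified inside the property being bisected, so that it may shrink with every joining.\<close>
  have strip: "\<exists>\<epsilon>>0. \<exists>h. strands M X (R {s-\<epsilon>..s+\<epsilon>} {c..d}) {..<k} h H" if s: "s \<in> {a..b}" for s
    using cd
  proof (induction c d rule: Bolzano)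
    case (trans p q r)
    obtain e1 h1 where 1: "e1 > 0" "strands M X (R {s-e1..s+e1} {p..q}) {..<k} h1 H" using trans(1) by blast
    obtain e2 h2 where 2: "e2 > 0" "strands M X (R {s-e2..s+e2} {q..r}) {..<k} h2 H" using trans(2) by blast
    let ?e = "min e1 e2"
    let ?J = "{s-?e..s+?e}"
    have "strands M X (R ?J {p..q}) {..<k} h1 H"
      by (rule strands_subset[OF 1(2)]) (auto simp: R_def)
    moreover have "strands M X (R ?J {q..r}) {..<k} h2 H"
      by (rule strands_subset[OF 2(2)]) (auto simp: R_def)
    moreover have "R ?J {p..q} \<inter> R ?J {q..r} = R ?J ({p..q} \<inter> {q..r})" by (auto simp: R_def)
    ultimately have "\<exists>h. strands M X (R ?J {p..q} \<union> R ?J {q..r}) {..<k} h H"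
      using strands_Un[OF M closedR closedR] connR by (metis closed_atLeastAtMost convex_Int convex_real_interval(5))
    moreover have "R ?J {p..q} \<union> R ?J {q..r} = R ?J {p..r}" using trans(3,4) by (auto simp: R_def)
    ultimately show ?case using 1 2 by (intro exI[of _ ?e]) auto
  next
    case (local t)
    then obtain e h where e: "e > 0" "strands M X (R {s-e..s+e} {t-e..t+e}) {..<k} h H"
      using loc[OF s, of t] by auto
    have "strands M X (R {s-e..s+e} {p..q}) {..<k} h H" if "p \<le> t \<and> t \<le> q \<and> q - p < e" for p q
      by (rule strands_subset[OF e(2)]) (use that in \<open>auto simp: R_def\<close>)
    then show ?case using e(1) by (intro exI[of _ e]) blast
  qed
  have "\<exists>h. strands M X (R {a..b} {c..d}) {..<k} h H"
    using ab
  proof (induction a b rule: Bolzano)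
    case (trans p q r)
    have "R {p..q} {c..d} \<inter> R {q..r} {c..d} = R ({p..q} \<inter> {q..r}) {c..d}" by (auto simp: R_def)
    then have "\<exists>h. strands M X (R {p..q} {c..d} \<union> R {q..r} {c..d}) {..<k} h H"
      using strands_Un[OF M closedR closedR] connR trans(1,2)
      by (metis closed_atLeastAtMost convex_Int convex_real_interval(5))
    moreover have "R {p..q} {c..d} \<union> R {q..r} {c..d} = R {p..r} {c..d}" using trans(3,4) by (auto simp: R_def)
    ultimately show ?case by simp
  next
    case (local s)
    then obtain e h where e: "e > 0" "strands M X (R {s-e..s+e} {c..d}) {..<k} h H"
      using strip[of s] by auto
    have "strands M X (R {p..q} {c..d}) {..<k} h H" if "p \<le> s \<and> s \<le> q \<and> q - p < e" for p q
      by (rule strands_subset[OF e(2)]) (use that in \<open>auto simp: R_def\<close>)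
    then show ?case using e(1) by (intro exI[of _ e]) blast
  qed
  then show ?thesis by (simp add: R_def)
qed

section \<open>Homotopy classes and composition of partial braids\<close>

text \<open>The first coordinate of the square is the parameter of the homotopy, the second the time
  along the path. Fixed ends are demanded of every strand and not only of the configuration.\<close>

definition strand_homotopy ::
  "'m topology \<Rightarrow> 'x topology \<Rightarrow> 'i set \<Rightarrow> ('i \<Rightarrow> real \<times> real \<Rightarrow> 'm \<times> 'x) \<Rightarrow>
     ('m, 'x) cpath \<Rightarrow> ('m, 'x) cpath \<Rightarrow> bool" where
  "strand_homotopy M X I h \<gamma> \<delta> \<longleftrightarrow>
     (\<forall>i\<in>I. continuous_map (top_of_set ({0..1} \<times> {0..1})) (prod_topology M X) (h i)) \<and>
     (\<forall>z\<in>{0..1} \<times> {0..1}. inj_on (\<lambda>i. fst (h i z)) I) \<and>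
     (\<forall>t\<in>{0..1}. \<gamma> t = (\<lambda>i. h i (0, t)) ` I \<and> \<delta> t = (\<lambda>i. h i (1, t)) ` I) \<and>
     (\<forall>i\<in>I. \<forall>s\<in>{0..1}. h i (s, 0) = h i (0, 0) \<and> h i (s, 1) = h i (0, 1))"

lemma strand_homotopyD:
  assumes "strand_homotopy M X I h \<gamma> \<delta>"
  shows "i \<in> I \<Longrightarrow> continuous_map (top_of_set ({0..1} \<times> {0..1})) (prod_topology M X) (h i)"
    and "z \<in> {0..1} \<times> {0..1} \<Longrightarrow> inj_on (\<lambda>i. fst (h i z)) I"
    and "t \<in> {0..1} \<Longrightarrow> \<gamma> t = (\<lambda>i. h i (0, t)) ` I"
    and "t \<in> {0..1} \<Longrightarrow> \<delta> t = (\<lambda>i. h i (1, t)) ` I"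
    and "i \<in> I \<Longrightarrow> s \<in> {0..1} \<Longrightarrow> h i (s, 0) = h i (0, 0)"
    and "i \<in> I \<Longrightarrow> s \<in> {0..1} \<Longrightarrow> h i (s, 1) = h i (0, 1)"
  using assms unfolding strand_homotopy_def by blast+

section \<open>Homotopy classes and their strands\<close>

lemma mem_pclass_iff:
  "\<delta> \<in> pclass M X \<gamma> \<longleftrightarrow>
     (\<exists>H :: real \<times> real \<Rightarrow> _. continuous_map (top_of_set ({0..1} \<times> {0..1})) (conf_space (card (\<gamma> 0)) M X) H \<and>
        (\<forall>t\<in>{0..1}. H (0, t) = \<gamma> t \<and> H (1, t) = \<delta> t) \<and>
        (\<forall>s\<in>{0..1}. H (s, 0) = \<gamma> 0 \<and> H (s, 1) = \<gamma> 1))"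
  unfolding pclass_def mem_Collect_eq by (subst homotopic_with) auto

lemma pclass_homotopyE:
  assumes "\<delta> \<in> pclass M X \<gamma>"
  obtains H :: "real \<times> real \<Rightarrow> _" where
    "continuous_map (top_of_set ({0..1} \<times> {0..1})) (conf_space (card (\<gamma> 0)) M X) H"
    "\<forall>t\<in>{0..1}. H (0, t) = \<gamma> t \<and> H (1, t) = \<delta> t"
    "\<forall>s\<in>{0..1}. H (s, 0) = \<gamma> 0 \<and> H (s, 1) = \<gamma> 1"
  using assms unfolding mem_pclass_iff by (elim exE conjE)

lemma pclass_endpoints:
  assumes "\<delta> \<in> pclass M X \<gamma>"
  shows "\<delta> 0 = \<gamma> 0" "\<delta> 1 = \<gamma> 1"
  using homotopic_with_imp_property[of _ _ _ \<gamma> \<delta>] assms unfolding pclass_def by blast+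

text \<open>A class with a member certifies that its representative is a path of configurations of
  constant size. A family whose number of points drops has an empty class and disappears from
  unions.\<close>

lemma pclass_path:
  assumes "\<delta> \<in> pclass M X \<gamma>"
  shows "pathin (conf_space (card (\<gamma> 0)) M X) \<gamma>" "pathin (conf_space (card (\<gamma> 0)) M X) \<delta>"
  using assms homotopic_with_imp_continuous_maps unfolding pclass_def pathin_def by blast+

lemma pathin_conf_space_card:
  assumes "pathin (conf_space k M X) \<gamma>" "t \<in> {0..1}"
  shows "card (\<gamma> t) = k" "inj_on fst (\<gamma> t)" "finite (\<gamma> t)"
proof -
  have "\<gamma> t \<in> topspace (conf_space k M X)"
    using assms unfolding pathin_def continuous_map_def by auto
  then show "card (\<gamma> t) = k" "inj_on fst (\<gamma> t)" "finite (\<gamma> t)" by (rule conf_spaceD)+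
qed

lemma pclass_eq:
  assumes "\<delta> \<in> pclass M X \<gamma>"
  shows "pclass M X \<delta> = pclass M X \<gamma>"
  using assms homotopic_with_sym homotopic_with_trans pclass_endpoints[OF assms]
  unfolding pclass_def by (auto; blast)

lemma pclass_cong:
  assumes "\<And>t. t \<in> {0..1} \<Longrightarrow> \<gamma> t = \<delta> t"
  shows "pclass M X \<gamma> = pclass M X \<delta>"
proof -
  have "\<gamma> 0 = \<delta> 0" "\<gamma> 1 = \<delta> 1" using assms by auto
  then show ?thesis using assms by (auto simp: mem_pclass_iff)
qed

lemma pclassI:
  assumes I: "finite I" and h: "strand_homotopy M X I h \<gamma> \<delta>"
  shows "\<delta> \<in> pclass M X \<gamma>"
proof -
  note D = strand_homotopyD[OF h]
  have "inj_on (\<lambda>i. fst (h i (0, 0))) I" by (rule D(2)) simp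
  then have "inj_on (\<lambda>i. h i (0, 0)) I" by (auto simp: inj_on_def)
  moreover have \<gamma>: "\<gamma> 0 = (\<lambda>i. h i (0, 0)) ` I" "\<gamma> 1 = (\<lambda>i. h i (0, 1)) ` I"
    by (rule D(3), simp)+
  ultimately have card: "card (\<gamma> 0) = card I" by (simp add: card_image)
  have "continuous_map (top_of_set ({0..1} \<times> {0..1})) (conf_space (card I) M X) (\<lambda>z. (\<lambda>i. h i z) ` I)"
    by (rule continuous_map_conf_space[OF I]) (use D(1,2) in simp_all)
  then show ?thesis
    unfolding mem_pclass_iff card
  proof (intro exI[of _ "\<lambda>z. (\<lambda>i. h i z) ` I"] conjI ballI)
    fix s :: real assume s: "s \<in> {0..1}"
    show "(\<lambda>i. h i (s, 0)) ` I = \<gamma> 0" unfolding \<gamma> by (rule image_cong[OF refl D(5)[OF _ s]])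
    show "(\<lambda>i. h i (s, 1)) ` I = \<gamma> 1" unfolding \<gamma> by (rule image_cong[OF refl D(6)[OF _ s]])
  qed (simp_all add: D(3,4))
qed

text \<open>The homotopy is lifted over the whole square. On the sides t = 0 and t = 1 the
  configuration is constant, so comparison with constant strands shows that each lifted strand is
  constant there.\<close>

lemma pclassE:
  assumes M: "Hausdorff_space M" and \<delta>: "\<delta> \<in> pclass M X \<gamma>"
  obtains h where "strand_homotopy M X {..<card (\<gamma> 0)} h \<gamma> \<delta>"
proof -
  let ?k = "card (\<gamma> 0)"
  obtain H :: "real \<times> real \<Rightarrow> _" where H': "continuous_map (top_of_set ({0..1} \<times> {0..1})) (conf_space ?k M X) H"
      "\<forall>t\<in>{0..1}. H (0, t) = \<gamma> t \<and> H (1, t) = \<delta> t"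
      "\<forall>s\<in>{0..1}. H (s, 0) = \<gamma> 0 \<and> H (s, 1) = \<gamma> 1"
    by (rule pclass_homotopyE[OF \<delta>])
  note H = H'(1) bspec[OF H'(2)] bspec[OF H'(3)]
  obtain h where h: "strands M X ({0..1} \<times> {0..1}) {..<?k} h H"
    using strands_rectangle[OF M zero_le_one zero_le_one H(1)] by blast
  have const: "h i (s, e) = h i (0, e)" if e: "e = 0 \<or> e = 1" and i: "i < ?k" and s: "s \<in> {0..1}"
    for i and s e :: real
  proof -
    have "continuous_map (top_of_set {0..1}) (top_of_set ({0..1} \<times> {0..1})) (\<lambda>s. (s, e))"
      using e by (auto simp: continuous_map_in_subtopology intro!: continuous_intros)
    then have str: "strands M X {0..1} {..<?k} (\<lambda>i s. h i (s, e)) (\<lambda>s. H (s, e))"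
      using h e unfolding strands_def
      by (auto intro: continuous_map_compose[unfolded o_def, where X' = "top_of_set ({0..1} \<times> {0..1})"])
    have "H (s, e) = (\<lambda>i. h i (0, e)) ` {..<?k}" "inj_on (\<lambda>i. fst (h i (0, e))) {..<?k}"
      if "s \<in> {0..1}" for s
    proof -
      have "H (s, e) = H (0, e)" using H(2)[of 0] H(2)[of 1] H(3)[OF that] H(3)[of 0] e by auto
      moreover have "H (0, e) = (\<lambda>i. h i (0, e)) ` {..<?k} \<and> inj_on (\<lambda>i. fst (h i (0, e))) {..<?k}"
        using str unfolding strands_def by (metis atLeastAtMost_iff order_refl zero_le_one)
      ultimately show "H (s, e) = (\<lambda>i. h i (0, e)) ` {..<?k}" "inj_on (\<lambda>i. fst (h i (0, e))) {..<?k}"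
        by metis+
    qed
    moreover have "h j (0, e) \<in> topspace (prod_topology M X)" if "j < ?k" for j
    proof -
      have "continuous_map (top_of_set ({0..1} \<times> {0..1})) (prod_topology M X) (h j)"
        using h that unfolding strands_def by simp
      from continuous_map_funspace[OF this] show ?thesis using e by (auto simp: Pi_iff)
    qed
    ultimately have "strands M X {0..1::real} {..<?k} (\<lambda>i s. h i (0, e)) (\<lambda>s. H (s, e))"
      unfolding strands_def by auto
    from strands_match[OF M _ _ _ str this, of i] i obtain j where
      j: "j < ?k" "\<And>s. s \<in> {0..1} \<Longrightarrow> h i (s, e) = h j (0, e)" by auto
    then have "h i (0, e) = h j (0, e)" by auto
    then show ?thesis using j(2)[OF s] by simp
  qed
  have "strand_homotopy M X {..<?k} h \<gamma> \<delta>"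
    unfolding strand_homotopy_def
  proof (intro conjI ballI)
    fix t :: real assume t: "t \<in> {0..1}"
    have "H (0, t) = (\<lambda>i. h i (0, t)) ` {..<?k}" "H (1, t) = (\<lambda>i. h i (1, t)) ` {..<?k}"
      using h t unfolding strands_def by auto
    then show "\<gamma> t = (\<lambda>i. h i (0, t)) ` {..<?k}" "\<delta> t = (\<lambda>i. h i (1, t)) ` {..<?k}"
      using H(2)[OF t] by auto
  next
    fix i and s :: real assume "i \<in> {..<?k}" "s \<in> {0..1}"
    then show "h i (s, 0) = h i (0, 0)" "h i (s, 1) = h i (0, 1)"
      using const[of 0 i s] const[of 1 i s] by auto
  qed (use h in \<open>unfold strands_def, blast+\<close>)
  then show thesis by (rule that)
qed

lemma strands_pathin:
  assumes "finite I" "strands M X {0..1} I f \<gamma>"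
  shows "pathin (conf_space (card I) M X) \<gamma>"
proof -
  have "continuous_map (top_of_set {0..1}) (conf_space (card I) M X) (\<lambda>z. (\<lambda>i. f i z) ` I)"
    by (rule continuous_map_conf_space[OF assms(1)]) (use assms in \<open>auto simp: strands_def\<close>)
  then show ?thesis
    unfolding pathin_def by (rule continuous_map_eq) (use assms in \<open>auto simp: strands_def\<close>)
qed

lemma pclass_refl:
  assumes "finite I" "strands M X {0..1} I f \<gamma>"
  shows "\<gamma> \<in> pclass M X \<gamma>"
proof -
  have p: "pathin (conf_space (card I) M X) \<gamma>" by (rule strands_pathin[OF assms])
  then have "card (\<gamma> 0) = card I" by (rule pathin_conf_space_card) simp
  then show ?thesis using p by (simp add: pclass_def pathin_def)
qed

section \<open>Deletion of strands and concatenation\<close>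

lemma delete_strandsI:
  assumes I: "finite I" and f: "strands M X {0..1} I f \<gamma>" and J: "J \<subseteq> I"
    and \<gamma>': "\<And>t. t \<in> {0..1} \<Longrightarrow> \<gamma>' t = (\<lambda>i. f i t) ` J"
  shows "delete_strands M X \<gamma> \<gamma>'"
proof -
  obtain b where b: "bij_betw b {..<card I} I"
    using ex_bij_betw_nat_finite[OF I] by (auto simp: atLeast0LessThan)
  let ?J = "{i \<in> {..<card I}. b i \<in> J}"
  have bJ: "b ` ?J = J" "b ` {..<card I} = I" "inj_on b {..<card I}"
    using b J by (auto simp: bij_betw_def)
  show ?thesis
    unfolding delete_strands_def
  proof (intro exI[of _ "card I"] exI[of _ "\<lambda>i. f (b i)"] exI[of _ ?J] conjI allI impI ballI)
    fix i assume "i < card I"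
    then have "b i \<in> I" using bJ by blast
    then show "pathin (prod_topology M X) (f (b i))" using f by (simp add: strands_def pathin_def)
  next
    fix t :: real assume t: "t \<in> {0..1}"
    have "inj_on ((\<lambda>i. fst (f i t)) \<circ> b) {..<card I}"
      using bJ f t by (intro comp_inj_on) (auto simp: strands_def)
    then show "inj_on (\<lambda>i. fst (f (b i) t)) {..<card I}" by (simp add: o_def)
    show "\<gamma> t = (\<lambda>i. f (b i) t) ` {..<card I}"
      using f t bJ(2) by (auto simp: strands_def image_image[symmetric, of "\<lambda>i. f i t" b])
    show "\<gamma>' t = (\<lambda>i. f (b i) t) ` ?J"
      using \<gamma>'[OF t] bJ(1) by (auto simp: image_image[symmetric, of "\<lambda>i. f i t" b])
  qed auto
qed

text \<open>Deletion is compatible with homotopy: the strands kept in \<delta> are matched with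
  strands of a lifted homotopy, followed back to \<gamma>, and matched there with the given strands
  f.\<close>

lemma pclass_delete:
  assumes M: "Hausdorff_space M" and I: "finite I" and f: "strands M X {0..1} I f \<gamma>"
    and \<delta>: "\<delta> \<in> pclass M X \<gamma>" and del: "delete_strands M X \<delta> \<delta>'"
  obtains J where "J \<subseteq> I" "\<delta>' \<in> pclass M X (\<lambda>t. (\<lambda>i. f i t) ` J)"
proof -
  let ?k = "card (\<gamma> 0)"
  obtain h where h: "strand_homotopy M X {..<?k} h \<gamma> \<delta>"
    using pclassE[OF M \<delta>] by blast
  note D = strand_homotopyD[OF h]
  obtain k' :: nat and g J' where g: "J' \<subseteq> {..<k'}" "\<And>i. i < k' \<Longrightarrow> pathin (prod_topology M X) (g i)"
    "\<And>t. t \<in> {0..1} \<Longrightarrow> inj_on (\<lambda>i. fst (g i t)) {..<k'} \<and>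
           \<delta> t = (\<lambda>i. g i t) ` {..<k'} \<and> \<delta>' t = (\<lambda>i. g i t) ` J'"
    using del unfolding delete_strands_def by metis
  have sg: "strands M X {0..1} {..<k'} g \<delta>" using g by (auto simp: strands_def pathin_def)
  have sh: "strands M X {0..1} {..<?k} (\<lambda>i t. h i (e, t)) (if e = 0 then \<gamma> else \<delta>)"
    if "e = 0 \<or> e = 1" for e
  proof -
    have "continuous_map (top_of_set {0..1}) (top_of_set ({0..1} \<times> {0..1})) (Pair e)"
      using that by (auto simp: continuous_map_in_subtopology intro!: continuous_intros)
    note c = continuous_map_compose[OF this D(1), unfolded o_def]
    show ?thesis
      unfolding strands_def
    proof (intro conjI ballI c)
      fix t :: real assume t: "t \<in> {0..1}"
      show "inj_on (\<lambda>i. fst (h i (e, t))) {..<?k}" by (rule D(2)) (use t that in auto)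
      show "(if e = 0 then \<gamma> else \<delta>) t = (\<lambda>i. h i (e, t)) ` {..<?k}"
        using D(3)[OF t] D(4)[OF t] that by (metis zero_neq_one)
    qed assumption
  qed
  have con: "connected {0..1::real}" "{0..1::real} \<noteq> {}" by auto
  have h1: "strands M X {0..1} {..<?k} (\<lambda>i t. h i (1, t)) \<delta>"
    and h0: "strands M X {0..1} {..<?k} (\<lambda>i t. h i (0, t)) \<gamma>"
    using sh[of 1] sh[of 0] by simp_all
  \<comment> \<open>\<open>\<sigma>\<close> identifies the strands g with those of the homotopy at
    its end, \<open>\<tau>\<close> the strands at its start with f.\<close>
  have "\<exists>i. i < ?k \<and> (\<forall>t\<in>{0..1}. g j t = h i (1, t))" if "j < k'" for j
    using strands_match[OF M con finite_lessThan sg h1, of j] that by auto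
  then obtain \<sigma> where \<sigma>: "\<And>j. j < k' \<Longrightarrow> \<sigma> j < ?k \<and> (\<forall>t\<in>{0..1}. g j t = h (\<sigma> j) (1, t))" by metis
  have "\<exists>i. i \<in> I \<and> (\<forall>t\<in>{0..1}. h j (0, t) = f i t)" if "j < ?k" for j
    using strands_match[OF M con I h0 f, of j] that by auto
  then obtain \<tau> where \<tau>: "\<And>j. j < ?k \<Longrightarrow> \<tau> j \<in> I \<and> (\<forall>t\<in>{0..1}. h j (0, t) = f (\<tau> j) t)" by metis
  let ?K = "\<sigma> ` J'"
  have K: "?K \<subseteq> {..<?k}" using \<sigma> g(1) by auto
  have "strand_homotopy M X ?K h (\<lambda>t. (\<lambda>i. f i t) ` \<tau> ` ?K) \<delta>'"
    unfolding strand_homotopy_def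
  proof (intro conjI ballI)
    fix z :: "real \<times> real" assume "z \<in> {0..1} \<times> {0..1}"
    then show "inj_on (\<lambda>i. fst (h i z)) ?K"
      using D(2) K inj_on_subset by blast
  next
    fix t :: real assume t: "t \<in> {0..1}"
    show "(\<lambda>i. f i t) ` \<tau> ` ?K = (\<lambda>i. h i (0, t)) ` ?K"
      unfolding image_image[of "\<lambda>i. f i t" \<tau>] by (rule image_cong) (use \<tau> K t in auto)
    have "\<delta>' t = (\<lambda>i. g i t) ` J'" using g(3)[OF t] by simp
    also have "\<dots> = (\<lambda>j. h (\<sigma> j) (1, t)) ` J'" by (rule image_cong) (use \<sigma> g(1) t in auto)
    finally show "\<delta>' t = (\<lambda>i. h i (1, t)) ` ?K" by (simp add: image_image)
  qed (use D(1,5,6) K in blast)+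
  moreover have "finite ?K" using K finite_subset by blast
  ultimately have "\<delta>' \<in> pclass M X (\<lambda>t. (\<lambda>i. f i t) ` \<tau> ` ?K)" by (intro pclassI)
  moreover have "\<tau> ` ?K \<subseteq> I" using \<tau> K by auto
  ultimately show thesis by (intro that)
qed

lemma pclass_pconcat:
  assumes \<gamma>: "\<gamma>' \<in> pclass M X \<gamma>" and \<delta>: "\<delta>' \<in> pclass M X \<delta>" and eq: "\<gamma> 1 = \<delta> 0"
  shows "pconcat \<gamma>' \<delta>' \<in> pclass M X (pconcat \<gamma> \<delta>)"
proof -
  let ?k = "card (\<gamma> 0)" and ?S = "{0..1} \<times> {0..1::real} :: (real \<times> real) set"
  have "card (\<gamma> 1) = ?k" by (rule pathin_conf_space_card(1)[OF pclass_path(1)[OF \<gamma>]]) simp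
  then have k: "card (\<delta> 0) = ?k" using eq by simp
  obtain H :: "real \<times> real \<Rightarrow> _" where H': "continuous_map (top_of_set ?S) (conf_space ?k M X) H"
      "\<forall>t\<in>{0..1}. H (0, t) = \<gamma> t \<and> H (1, t) = \<gamma>' t"
      "\<forall>s\<in>{0..1}. H (s, 0) = \<gamma> 0 \<and> H (s, 1) = \<gamma> 1"
    by (rule pclass_homotopyE[OF \<gamma>])
  note H = H'(1) bspec[OF H'(2)] bspec[OF H'(3)]
  obtain K :: "real \<times> real \<Rightarrow> _" where K': "continuous_map (top_of_set ?S) (conf_space ?k M X) K"
      "\<forall>t\<in>{0..1}. K (0, t) = \<delta> t \<and> K (1, t) = \<delta>' t"
      "\<forall>s\<in>{0..1}. K (s, 0) = \<delta> 0 \<and> K (s, 1) = \<delta> 1"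
    by (rule pclass_homotopyE[OF \<delta>, unfolded k])
  note K = K'(1) bspec[OF K'(2)] bspec[OF K'(3)]
  define L where "L z = (if snd z \<le> 1/2 then H (fst z, 2 * snd z) else K (fst z, 2 * snd z - 1))" for z
  have "continuous_map (top_of_set ?S) (conf_space ?k M X) L"
    unfolding L_def
  proof (rule continuous_map_cases_le)
    have "continuous_map (top_of_set (?S \<inter> {z. snd z \<le> 1/2})) (top_of_set ?S) (\<lambda>z. (fst z, 2 * snd z))"
      by (auto simp: continuous_map_in_subtopology intro!: continuous_intros)
    from continuous_map_compose[OF this H(1)]
    show "continuous_map (subtopology (top_of_set ?S) {z \<in> topspace (top_of_set ?S). snd z \<le> 1/2})
        (conf_space ?k M X) (\<lambda>z. H (fst z, 2 * snd z))"
      by (auto simp: subtopology_subtopology o_def Collect_conj_eq Int_assoc[symmetric])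
    have "continuous_map (top_of_set (?S \<inter> {z. 1/2 \<le> snd z})) (top_of_set ?S) (\<lambda>z. (fst z, 2 * snd z - 1))"
      by (auto simp: continuous_map_in_subtopology intro!: continuous_intros)
    from continuous_map_compose[OF this K(1)]
    show "continuous_map (subtopology (top_of_set ?S) {z \<in> topspace (top_of_set ?S). 1/2 \<le> snd z})
        (conf_space ?k M X) (\<lambda>z. K (fst z, 2 * snd z - 1))"
      by (auto simp: subtopology_subtopology o_def Collect_conj_eq Int_assoc[symmetric])
    show "continuous_map (top_of_set ?S) euclideanreal snd"
      by (auto intro!: continuous_intros)
    show "continuous_map (top_of_set ?S) euclideanreal (\<lambda>z. 1/2)" by simp
    fix z assume z: "z \<in> topspace (top_of_set ?S)" "snd z = 1/2"
    then have "2 * snd z = 1" "2 * snd z - 1 = 0" "fst z \<in> {0..1}" by auto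
    then show "H (fst z, 2 * snd z) = K (fst z, 2 * snd z - 1)"
      using H(3)[of "fst z"] K(3)[of "fst z"] eq by simp
  qed
  moreover have "pconcat \<gamma> \<delta> 0 = \<gamma> 0" "pconcat \<gamma> \<delta> 1 = \<delta> 1" by (simp_all add: pconcat_def)
  ultimately show ?thesis
    unfolding mem_pclass_iff
    by (intro exI[of _ L]) (use H(2,3) K(2,3) in \<open>auto simp: L_def pconcat_def\<close>)
qed

section \<open>Linear slides along an injective arc\<close>

definition lin :: "(real \<Rightarrow> 'm) \<Rightarrow> 'x \<Rightarrow> (real \<times> real) set \<Rightarrow> ('m, 'x) cpath" where
  "lin a x0 P t = (\<lambda>p. (a ((1 - t) * fst p + t * snd p), x0)) ` P"

text \<open>The relations for which \<open>lin\<close> is a path of configurations: a pair (u, v) is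
  a strand that moves from a(u) to a(v) at constant speed, and equal order at both ends keeps
  strands apart in between. The paths in \<open>iota\<close> and \<open>slide\<close> and the
  constant path at \<open>std_conf\<close> all have this form.\<close>

definition arc_rel :: "(real \<times> real) set \<Rightarrow> bool" where
  "arc_rel P \<longleftrightarrow> finite P \<and> P \<subseteq> {0..} \<times> {0..} \<and> mono_rel P"

lemma arc_rel_subset: "arc_rel P \<Longrightarrow> Q \<subseteq> P \<Longrightarrow> arc_rel Q"
  unfolding arc_rel_def using mono_rel_subset finite_subset by blast

lemma arc_rel_converse: "arc_rel P \<Longrightarrow> arc_rel (P\<inverse>)"
  unfolding arc_rel_def using mono_rel_converse by auto

lemma arc_rel_relcomp:
  assumes "arc_rel P" "arc_rel Q"
  shows "arc_rel (P O Q)"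
proof -
  have "P O Q \<subseteq> Domain P \<times> Range Q" by auto
  then have "finite (P O Q)"
    using assms by (auto simp: arc_rel_def finite_Domain finite_Range intro: finite_subset)
  then show ?thesis
    using assms mono_rel_relcomp unfolding arc_rel_def by blast
qed

lemma convex_comb_less:
  fixes u v :: real
  assumes "u < u'" "v < v'" "t \<in> {0..1}"
  shows "(1 - t) * u + t * v < (1 - t) * u' + t * v'"
proof (cases "t = 0")
  case False
  then have "t * v < t * v'" using assms by (intro mult_strict_left_mono) auto
  moreover have "(1 - t) * u \<le> (1 - t) * u'" using assms by (intro mult_left_mono) auto
  ultimately show ?thesis by simp
qed (use assms in simp)

locale arc_space =
  fixes M :: "'m topology" and X :: "'x topology" and a :: "real \<Rightarrow> 'm" and x0 :: 'x
  assumes hausdorff: "Hausdorff_space M"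
    and a_cont: "continuous_map (top_of_set {0..}) M a"
    and a_inj: "inj_on a {0..}"
    and x0: "x0 \<in> topspace X"
begin

lemma continuous_map_arc:
  assumes "continuous_on A f" "\<And>z. z \<in> A \<Longrightarrow> 0 \<le> f z"
  shows "continuous_map (top_of_set A) (prod_topology M X) (\<lambda>z. (a (f z), x0))"
proof (rule continuous_map_pairedI)
  have "continuous_map (top_of_set A) (top_of_set {0..}) f"
    using assms by (auto simp: continuous_map_in_subtopology)
  from continuous_map_compose[OF this a_cont]
  show "continuous_map (top_of_set A) M (\<lambda>z. a (f z))" by (simp add: o_def)
qed (simp add: x0)

text \<open>The straight-line homotopy in the parameter of the arc works: strands that have the same
  order in x and in y at time t keep it under convex combination, so they do not meet.\<close>

lemma arc_homotopy:
  fixes x y :: "'i \<Rightarrow> real \<Rightarrow> real"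
  assumes I: "finite I"
    and cont: "\<And>i. i \<in> I \<Longrightarrow> continuous_on {0..1} (x i)" "\<And>i. i \<in> I \<Longrightarrow> continuous_on {0..1} (y i)"
    and pos: "\<And>i t. i \<in> I \<Longrightarrow> t \<in> {0..1} \<Longrightarrow> 0 \<le> x i t" "\<And>i t. i \<in> I \<Longrightarrow> t \<in> {0..1} \<Longrightarrow> 0 \<le> y i t"
    and ord: "\<And>i j t. i \<in> I \<Longrightarrow> j \<in> I \<Longrightarrow> i \<noteq> j \<Longrightarrow> t \<in> {0..1} \<Longrightarrow>
      x i t < x j t \<and> y i t < y j t \<or> x j t < x i t \<and> y j t < y i t"
    and ends: "\<And>i. i \<in> I \<Longrightarrow> x i 0 = y i 0 \<and> x i 1 = y i 1"
  shows "(\<lambda>t. (\<lambda>i. (a (y i t), x0)) ` I) \<in> pclass M X (\<lambda>t. (\<lambda>i. (a (x i t), x0)) ` I)"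
proof (rule pclassI[OF I])
  let ?p = "\<lambda>i z. (1 - fst z) * x i (snd z) + fst z * y i (snd z)"
  let ?S = "{0..1} \<times> {0..1::real} :: (real \<times> real) set"
  have p0: "0 \<le> ?p i z" if "i \<in> I" "z \<in> ?S" for i z
    using that pos by (auto intro!: add_nonneg_nonneg mult_nonneg_nonneg)
  show "strand_homotopy M X I (\<lambda>i z. (a (?p i z), x0)) (\<lambda>t. (\<lambda>i. (a (x i t), x0)) ` I)
     (\<lambda>t. (\<lambda>i. (a (y i t), x0)) ` I)"
    unfolding strand_homotopy_def
  proof (intro conjI ballI)
    fix i assume i: "i \<in> I"
    have "continuous_on ?S (\<lambda>z. x i (snd z))" "continuous_on ?S (\<lambda>z. y i (snd z))"
      using cont[OF i] by (auto intro!: continuous_on_compose2[where g = "x i" and t = "{0..1}"]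
          continuous_on_compose2[where g = "y i" and t = "{0..1}"] continuous_intros)
    then have "continuous_on ?S (?p i)" by (intro continuous_intros)
    then show "continuous_map (top_of_set ?S) (prod_topology M X) (\<lambda>z. (a (?p i z), x0))"
      using p0[OF i] by (rule continuous_map_arc)
  next
    fix z assume z: "z \<in> ?S"
    show "inj_on (\<lambda>i. fst (a (?p i z), x0)) I"
    proof (rule inj_onI, rule ccontr)
      fix i j assume ij: "i \<in> I" "j \<in> I" "fst (a (?p i z), x0) = fst (a (?p j z), x0)" "i \<noteq> j"
      then have "?p i z = ?p j z"
        using inj_onD[OF a_inj, of "?p i z" "?p j z"] p0 z by auto
      moreover have "?p i z < ?p j z \<or> ?p j z < ?p i z"
        using ord[OF ij(1,2,4), of "snd z"] convex_comb_less[of _ _ _ _ "fst z"] z by fastforce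
      ultimately show False by simp
    qed
  qed (use ends in \<open>auto simp: algebra_simps\<close>)
qed

lemma strands_lin:
  assumes "arc_rel P"
  shows "strands M X {0..1} P (\<lambda>p t. (a ((1 - t) * fst p + t * snd p), x0)) (lin a x0 P)"
  unfolding strands_def
proof (intro conjI ballI)
  have pos: "0 \<le> (1 - t) * fst p + t * snd p" if "p \<in> P" "t \<in> {0..1}" for p t
    using that assms by (auto simp: arc_rel_def intro!: add_nonneg_nonneg mult_nonneg_nonneg)
  fix p assume p: "p \<in> P"
  show "continuous_map (top_of_set {0..1}) (prod_topology M X) (\<lambda>t. (a ((1 - t) * fst p + t * snd p), x0))"
    by (rule continuous_map_arc) (use pos[OF p] in \<open>auto intro!: continuous_intros\<close>)
next
  fix t :: real assume t: "t \<in> {0..1}"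
  have pos: "0 \<le> (1 - t) * fst p + t * snd p" if "p \<in> P" for p
    using that t assms by (auto simp: arc_rel_def intro!: add_nonneg_nonneg mult_nonneg_nonneg)
  show "inj_on (\<lambda>p. fst (a ((1 - t) * fst p + t * snd p), x0)) P"
  proof (rule inj_onI, rule ccontr)
    fix p q assume pq: "p \<in> P" "q \<in> P" "p \<noteq> q"
      "fst (a ((1 - t) * fst p + t * snd p), x0) = fst (a ((1 - t) * fst q + t * snd q), x0)"
    then have eq: "(1 - t) * fst p + t * snd p = (1 - t) * fst q + t * snd q"
      using inj_onD[OF a_inj, of "(1 - t) * fst p + t * snd p"] pos by auto
    have "mono_rel P" using assms by (simp add: arc_rel_def)
    then have "fst p < fst q \<longleftrightarrow> snd p < snd q" "fst q < fst p \<longleftrightarrow> snd q < snd p" "fst p = fst q \<longleftrightarrow> snd p = snd q"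
      using pq mono_relD[of P "fst p" "snd p" "fst q" "snd q"] mono_relD[of P "fst q" "snd q" "fst p" "snd p"]
        mono_rel_eq[of P "fst p" "snd p" "fst q" "snd q"] by auto
    then have "fst p < fst q \<and> snd p < snd q \<or> fst q < fst p \<and> snd q < snd p"
      using pq(3) by (metis linorder_neqE prod_eqI)
    then show False using eq convex_comb_less[OF _ _ t] by (metis less_irrefl)
  qed
qed (simp add: lin_def)

lemma lin_pathin:
  assumes "arc_rel P"
  shows "pathin (conf_space (card P) M X) (lin a x0 P)"
  using strands_pathin[OF _ strands_lin[OF assms]] assms by (simp add: arc_rel_def)

lemma lin_refl:
  assumes "arc_rel P"
  shows "lin a x0 P \<in> pclass M X (lin a x0 P)"
  using pclass_refl[OF _ strands_lin[OF assms]] assms by (simp add: arc_rel_def)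

lemma lin_0: "lin a x0 P 0 = (\<lambda>u. (a u, x0)) ` Domain P"
  and lin_1: "lin a x0 P 1 = (\<lambda>v. (a v, x0)) ` Range P"
  by (simp_all add: lin_def image_image flip: fst_eq_Domain snd_eq_Range)

lemma arc_points_Int:
  assumes "A \<subseteq> {0..}" "B \<subseteq> {0..}"
  shows "(\<lambda>u. (a u, x0)) ` A \<inter> (\<lambda>u. (a u, x0)) ` B = (\<lambda>u. (a u, x0)) ` (A \<inter> B)"
proof -
  have "inj_on (\<lambda>u. (a u, x0)) {0..}" using a_inj by (auto simp: inj_on_def)
  from inj_on_image_Int[OF this assms] show ?thesis by simp
qed

lemma arc_points_eq:
  assumes "A \<subseteq> {0..}" "B \<subseteq> {0..}" "(\<lambda>u. (a u, x0)) ` A = (\<lambda>u. (a u, x0)) ` B"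
  shows "A = B"
proof (rule inj_on_image_eq_iff[THEN iffD1, OF _ assms(1,2,3)])
  show "inj_on (\<lambda>u. (a u, x0)) {0..}" using a_inj by (auto simp: inj_on_def)
qed

text \<open>All admissible representatives and deletions give one class: the deleted paths are
  homotopic to \<open>lin\<close> on the pairs that meet a pair of the other relation, and the
  broken line through the middle position is homotopic to the straight one. Hence partial
  composition becomes composition of relations.\<close>

lemma partial_comp_lin:
  assumes P: "arc_rel P" and Q: "arc_rel Q"
  shows "partial_comp M X (pclass M X (lin a x0 P)) (pclass M X (lin a x0 Q)) =
    pclass M X (lin a x0 (P O Q))"
proof -
  let ?P = "{p \<in> P. snd p \<in> Domain Q}" and ?Q = "{q \<in> Q. fst q \<in> Range P}"
  have mP: "mono_rel P" and mQ: "mono_rel Q" and fin: "finite P" "finite Q"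
    using P Q by (auto simp: arc_rel_def)
  have nn: "Domain P \<subseteq> {0..}" "Range P \<subseteq> {0..}" "Domain Q \<subseteq> {0..}" "Range Q \<subseteq> {0..}"
    using P Q by (auto simp: arc_rel_def)
  have P': "arc_rel ?P" "arc_rel ?Q"
    using P Q by (auto intro: arc_rel_subset)
  have RP: "Range ?P = Range P \<inter> Domain Q" and DQ: "Domain ?Q = Range P \<inter> Domain Q"
    by force+
  have mid: "lin a x0 P 1 \<inter> lin a x0 Q 0 = (\<lambda>u. (a u, x0)) ` (Range P \<inter> Domain Q)"
    unfolding lin_0 lin_1 by (rule arc_points_Int[OF nn(2,3)])
  have del: "\<gamma>' \<in> pclass M X (lin a x0 ?P) \<and> \<delta>' \<in> pclass M X (lin a x0 ?Q)"
    if \<gamma>: "\<gamma> \<in> pclass M X (lin a x0 P)" and \<delta>: "\<delta> \<in> pclass M X (lin a x0 Q)"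
      and d: "delete_strands M X \<gamma> \<gamma>'" "\<gamma>' 1 = \<gamma> 1 \<inter> \<delta> 0" "delete_strands M X \<delta> \<delta>'" "\<delta>' 0 = \<gamma> 1 \<inter> \<delta> 0"
    for \<gamma> \<delta> \<gamma>' \<delta>'
  proof
    have e: "\<gamma> 1 \<inter> \<delta> 0 = (\<lambda>u. (a u, x0)) ` (Range P \<inter> Domain Q)"
      using mid pclass_endpoints[OF \<gamma>] pclass_endpoints[OF \<delta>] by simp
    obtain J where J: "J \<subseteq> P" "\<gamma>' \<in> pclass M X (lin a x0 J)"
      using pclass_delete[OF hausdorff fin(1) strands_lin[OF P] \<gamma> d(1)]
      by (auto simp: lin_def[abs_def])
    have "lin a x0 J 1 = \<gamma> 1 \<inter> \<delta> 0" using pclass_endpoints[OF J(2)] d(2) by simp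
    then have "Range J = Range P \<inter> Domain Q"
      using e Range_mono[OF J(1)] nn unfolding lin_1 by (intro arc_points_eq) blast+
    \<comment> \<open>A strand is determined by its end point, since the relation is
      injective.\<close>
    then have "J = ?P"
      using J(1) mono_rel_eq[OF mP] by (auto; blast)
    then show "\<gamma>' \<in> pclass M X (lin a x0 ?P)" using J(2) by simp
    obtain K where K: "K \<subseteq> Q" "\<delta>' \<in> pclass M X (lin a x0 K)"
      using pclass_delete[OF hausdorff fin(2) strands_lin[OF Q] \<delta> d(3)]
      by (auto simp: lin_def[abs_def])
    have "lin a x0 K 0 = \<gamma> 1 \<inter> \<delta> 0" using pclass_endpoints[OF K(2)] d(4) by simp
    then have "Domain K = Range P \<inter> Domain Q"
      using e Domain_mono[OF K(1)] nn unfolding lin_0 by (intro arc_points_eq) blast+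
    then have "K = ?Q"
      using K(1) mono_rel_eq[OF mQ] by (auto; blast)
    then show "\<delta>' \<in> pclass M X (lin a x0 ?Q)" using K(2) by simp
  qed
  have lin_eq: "lin a x0 ?P 1 = lin a x0 ?Q 0" unfolding lin_0 lin_1 RP DQ ..
  have cat: "pconcat (lin a x0 ?P) (lin a x0 ?Q) \<in> pclass M X (lin a x0 (P O Q))"
  proof -
    \<comment> \<open>Surviving strands are indexed by start, middle and end, so that the straight
      and the broken strands share an index set.\<close>
    let ?I = "{(u, v, w) | u v w. (u, v) \<in> P \<and> (v, w) \<in> Q}"
    let ?x = "\<lambda>(u, v, w) t. (1 - t) * u + t * w :: real"
    let ?y = "\<lambda>(u, v, w) t. if t \<le> 1/2 then (1 - 2 * t) * u + 2 * t * v
                else (1 - (2 * t - 1)) * v + (2 * t - 1) * w :: real"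
    have "?I \<subseteq> Domain P \<times> Range P \<times> Range Q" by auto
    moreover have "finite (Domain P \<times> Range P \<times> Range Q)"
      using fin by (simp add: finite_Domain finite_Range)
    ultimately have I: "finite ?I" by (rule finite_subset)
    have "(\<lambda>t. (\<lambda>i. (a (?y i t), x0)) ` ?I) \<in> pclass M X (\<lambda>t. (\<lambda>i. (a (?x i t), x0)) ` ?I)"
    proof (rule arc_homotopy[OF I])
      fix i assume "i \<in> ?I"
      then obtain u v w where i: "i = (u, v, w)" "(u, v) \<in> P" "(v, w) \<in> Q" by blast
      show "continuous_on {0..1} (?x i)" unfolding i(1) by (auto intro!: continuous_intros)
      show "continuous_on {0..1} (?y i)"
      proof -
        \<comment> \<open>One formula for the broken line: at t = 1/2 the first increment is
          complete and the second begins.\<close>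
        have "continuous_on {0..1} (\<lambda>t. u + (v - u) * min (2 * t) 1 + (w - v) * max 0 (2 * t - 1))"
          by (intro continuous_intros)
        then show ?thesis
          by (rule continuous_on_eq) (auto simp: i(1) min_def max_def field_simps)
      qed
      have nn': "0 \<le> u" "0 \<le> v" "0 \<le> w" using i nn by auto
      show "?x i 0 = ?y i 0 \<and> ?x i 1 = ?y i 1" unfolding i(1) by simp
      fix t :: real assume t: "t \<in> {0..1}"
      show "0 \<le> ?x i t" "0 \<le> ?y i t"
        using nn' t unfolding i(1) by (auto intro!: add_nonneg_nonneg mult_nonneg_nonneg)
      fix j assume "j \<in> ?I" and ij: "i \<noteq> j"
      then obtain u' v' w' where j: "j = (u', v', w')" "(u', v') \<in> P" "(v', w') \<in> Q" by blast
      have "u = u' \<longleftrightarrow> v = v'" "v = v' \<longleftrightarrow> w = w'"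
        using mono_rel_eq[OF mP i(2) j(2)] mono_rel_eq[OF mQ i(3) j(3)] by auto
      then have "v \<noteq> v'" using ij i(1) j(1) by auto
      then have "u < u' \<and> v < v' \<and> w < w' \<or> u' < u \<and> v' < v \<and> w' < w"
        using mono_relD[OF mP i(2) j(2)] mono_relD[OF mQ i(3) j(3)]
          mono_relD[OF mP j(2) i(2)] mono_relD[OF mQ j(3) i(3)] by (metis linorder_neqE)
      moreover have "?x (u, v, w) t < ?x (u', v', w') t \<and> ?y (u, v, w) t < ?y (u', v', w') t"
        if "u < u'" "v < v'" "w < w'" for u v w u' v' w' :: real
        using that convex_comb_less[OF that(1,3) t] convex_comb_less[OF that(1,2), of "2 * t"]
          convex_comb_less[OF that(2,3), of "2 * t - 1"] t by auto
      ultimately show "?x i t < ?x j t \<and> ?y i t < ?y j t \<or> ?x j t < ?x i t \<and> ?y j t < ?y i t"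
        unfolding i(1) j(1) by blast
    qed
    moreover have "(\<lambda>i. (a (?x i t), x0)) ` ?I = lin a x0 (P O Q) t" for t
    proof -
      have "(\<lambda>(u, v, w). (u, w)) ` ?I = P O Q" by force
      then have "lin a x0 (P O Q) t = (\<lambda>p. (a ((1 - t) * fst p + t * snd p), x0)) ` (\<lambda>(u, v, w). (u, w)) ` ?I"
        by (simp add: lin_def)
      also have "\<dots> = (\<lambda>i. (a (?x i t), x0)) ` ?I"
        unfolding image_image by (rule image_cong) auto
      finally show ?thesis by simp
    qed
    moreover have "(\<lambda>i. (a (?y i t), x0)) ` ?I = pconcat (lin a x0 ?P) (lin a x0 ?Q) t" for t
    proof (cases "t \<le> 1/2")
      case True
      have "(\<lambda>(u, v, w). (u, v)) ` ?I = ?P" by force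
      then have "lin a x0 ?P (2 * t) = (\<lambda>p. (a ((1 - 2 * t) * fst p + 2 * t * snd p), x0)) ` (\<lambda>(u, v, w). (u, v)) ` ?I"
        by (simp add: lin_def)
      also have "\<dots> = (\<lambda>i. (a (?y i t), x0)) ` ?I"
        unfolding image_image by (rule image_cong) (use True in auto)
      finally show ?thesis using True by (simp add: pconcat_def)
    next
      case False
      have "(\<lambda>(u, v, w). (v, w)) ` ?I = ?Q" by force
      then have "lin a x0 ?Q (2 * t - 1) = (\<lambda>p. (a ((1 - (2 * t - 1)) * fst p + (2 * t - 1) * snd p), x0)) ` (\<lambda>(u, v, w). (v, w)) ` ?I"
        by (simp add: lin_def)
      also have "\<dots> = (\<lambda>i. (a (?y i t), x0)) ` ?I"
        unfolding image_image by (rule image_cong) (use False in auto)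
      finally show ?thesis using False by (simp add: pconcat_def)
    qed
    ultimately show ?thesis by simp
  qed
  have "pclass M X (pconcat \<gamma>' \<delta>') = pclass M X (lin a x0 (P O Q))"
    if "\<gamma> \<in> pclass M X (lin a x0 P)" "\<delta> \<in> pclass M X (lin a x0 Q)"
      "delete_strands M X \<gamma> \<gamma>'" "\<gamma>' 1 = \<gamma> 1 \<inter> \<delta> 0" "delete_strands M X \<delta> \<delta>'" "\<delta>' 0 = \<gamma> 1 \<inter> \<delta> 0"
    for \<gamma> \<delta> \<gamma>' \<delta>'
  proof -
    have "pconcat \<gamma>' \<delta>' \<in> pclass M X (pconcat (lin a x0 ?P) (lin a x0 ?Q))"
      using del[OF that] lin_eq by (intro pclass_pconcat) auto
    from pclass_eq[OF this] show ?thesis using pclass_eq[OF cat] by simp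
  qed
  moreover have "delete_strands M X (lin a x0 P) (lin a x0 ?P)" "delete_strands M X (lin a x0 Q) (lin a x0 ?Q)"
    by (rule delete_strandsI[OF fin(1) strands_lin[OF P]], auto simp: lin_def)
       (rule delete_strandsI[OF fin(2) strands_lin[OF Q]], auto simp: lin_def)
  moreover have "lin a x0 ?P 1 = lin a x0 P 1 \<inter> lin a x0 Q 0" "lin a x0 ?Q 0 = lin a x0 P 1 \<inter> lin a x0 Q 0"
    unfolding mid by (simp_all add: lin_0 lin_1 RP DQ)
  \<comment> \<open>The family whose union is the composite is a singleton: all members equal this
    class, and the linear paths with their linear deletions show that there is one.\<close>
  ultimately have "{pclass M X (pconcat \<gamma>' \<delta>') | \<gamma> \<delta> \<gamma>' \<delta>'.
      \<gamma> \<in> pclass M X (lin a x0 P) \<and> \<delta> \<in> pclass M X (lin a x0 Q) \<and>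
      delete_strands M X \<gamma> \<gamma>' \<and> \<gamma>' 1 = \<gamma> 1 \<inter> \<delta> 0 \<and> delete_strands M X \<delta> \<delta>' \<and> \<delta>' 0 = \<gamma> 1 \<inter> \<delta> 0} =
      {pclass M X (lin a x0 (P O Q))}"
    using lin_refl[OF P] lin_refl[OF Q]
    by (intro equalityI subsetI; (elim CollectE exE conjE, simp)?)
      (intro CollectI exI[of _ "lin a x0 P"] exI[of _ "lin a x0 Q"] exI[of _ "lin a x0 ?P"]
        exI[of _ "lin a x0 ?Q"], simp)
  then show ?thesis
    unfolding partial_comp_def by simp
qed

end

section \<open>Pushing into a collar\<close>

lemma continuous_map_inv_into_homeomorphic:
  assumes "homeomorphic_map X Y f"
  shows "continuous_map Y X (inv_into (topspace X) f)"
proof -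
  obtain g where g: "homeomorphic_maps X Y f g" using assms by (auto simp: homeomorphic_map_maps)
  have "continuous_map Y X g" using g by (simp add: homeomorphic_maps_def)
  then show ?thesis
  proof (rule continuous_map_eq)
    fix y assume "y \<in> topspace Y"
    then have "g y \<in> topspace X" "f (g y) = y"
      using g by (auto simp: homeomorphic_maps_def continuous_map_def)
    then show "g y = inv_into (topspace X) f y"
      using homeomorphic_imp_injective_map[OF assms] inv_into_f_f by metis
  qed
qed

lemma mboundary_subset_topspace:
  assumes "smooth_manifold_with_boundary M atlas"
  shows "mboundary atlas \<subseteq> topspace M"
proof
  fix x assume "x \<in> mboundary atlas"
  then obtain C where "C \<in> atlas" "x \<in> fst C" by (auto simp: mboundary_def)
  then have "x \<in> (\<Union>C\<in>atlas. fst C)" by blast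
  then show "x \<in> topspace M" using assms unfolding smooth_manifold_with_boundary_def by metis
qed

text \<open>Invariance of domain, applied to the collar extended linearly across the boundary of a chart.\<close>

lemma openin_collar:
  fixes atlas :: "('m set \<times> ('m \<Rightarrow> 'e::euclidean_space)) set"
  assumes mfd: "smooth_manifold_with_boundary M atlas"
    and col: "is_collared \<lparr>Spc = M, Bdy = mboundary atlas, Col = c, Bpt = p\<rparr>"
  shows "openin M (c ` (mboundary atlas \<times> {..<\<infinity>}))"
proof (subst openin_subopen, intro ballI)
  let ?\<nu> = "normal_vec :: 'e" and ?B = "mboundary atlas"
  have \<nu>: "?\<nu> \<bullet> ?\<nu> = 1"
  proof -
    have "\<exists>b. b \<in> (Basis :: 'e set)" using nonempty_Basis by blast
    then have "?\<nu> \<in> Basis" unfolding normal_vec_def by (rule someI_ex)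
    then show ?thesis by (simp add: inner_Basis)
  qed
  have chart: "bd_chart M C" if "C \<in> atlas" for C
    using mfd that by (simp add: smooth_manifold_with_boundary_def)
  have ccont: "continuous_map (prod_topology (subtopology M ?B) euclidean) M c"
    using col homeomorphic_imp_continuous_map
    by (fastforce simp: is_collared_def embedding_map_def continuous_map_in_subtopology)
  have cinj: "inj_on c ((topspace M \<inter> ?B) \<times> UNIV)"
    using col homeomorphic_imp_injective_map by (fastforce simp: is_collared_def embedding_map_def)
  have BM: "?B \<subseteq> topspace M"
    by (rule mboundary_subset_topspace[OF mfd])
  have c0: "c (y, 0) = y" if "y \<in> ?B" for y using col that by (simp add: is_collared_def)
  fix z assume "z \<in> c ` (?B \<times> {..<\<infinity>})"
  then obtain y t where y: "y \<in> ?B" "t < \<infinity>" "z = c (y, t)" by auto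
  obtain r where r: "t = ennreal r" "0 \<le> r" using y(2) by (cases t) auto
  obtain U \<theta> where U: "(U, \<theta>) \<in> atlas" "y \<in> U" "\<theta> y \<bullet> ?\<nu> = 0"
    using y(1) by (auto simp: mboundary_def)
  have "z \<in> topspace M"
    using continuous_map_funspace[OF ccont] y BM by (auto simp: Pi_iff)
  then obtain V' \<psi>' where V': "(V', \<psi>') \<in> atlas" "z \<in> V'"
  proof -
    have "topspace M = (\<Union>C\<in>atlas. fst C)" using mfd by (simp add: smooth_manifold_with_boundary_def)
    then obtain C where "C \<in> atlas" "z \<in> fst C" using \<open>z \<in> topspace M\<close> by blast
    then show thesis using that[of "fst C" "snd C"] by simp
  qed
  \<comment> \<open>Away from the boundary any chart at z will do, and only positive heights are
    kept. For r = 0 the point z is y itself, and one chart serves source and target, so that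
    negative heights can be filled in by the identity.\<close>
  obtain V \<psi> R where V: "(V, \<psi>) \<in> atlas" "z \<in> V" "open R" "r \<in> R" "R = {0<..} \<or> V = U \<and> \<psi> = \<theta>"
  proof (cases "r = 0")
    case True
    then have "z = y" using y r c0 by simp
    then show thesis using that[of U \<theta> UNIV] U by simp
  next
    case False
    then show thesis using that[of V' \<psi>' "{0<..}"] V' r(2) by simp
  qed
  have Uc: "openin M U" "openin (top_of_set half_space) (\<theta> ` U)"
    "homeomorphic_map (subtopology M U) (top_of_set (\<theta> ` U)) \<theta>"
    using chart[OF U(1)] by (auto simp: bd_chart_def)
  have Vc: "openin M V" "openin (top_of_set half_space) (\<psi> ` V)"
    "homeomorphic_map (subtopology M V) (top_of_set (\<psi> ` V)) \<psi>"
    using chart[OF V(1)] by (auto simp: bd_chart_def)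
  have tU: "topspace (subtopology M U) = U" "topspace (subtopology M V) = V"
    using openin_subset[OF Uc(1)] openin_subset[OF Vc(1)] by auto
  have injV: "inj_on \<psi> V" and injU: "inj_on \<theta> U"
    using homeomorphic_imp_injective_map[OF Vc(3)] homeomorphic_imp_injective_map[OF Uc(3)] tU by auto
  \<comment> \<open>Projection to the boundary hyperplane of the chart; the coefficient of
    \<open>normal_vec\<close> becomes the depth in the collar.\<close>
  define pr where "pr x = x - (x \<bullet> ?\<nu>) *\<^sub>R ?\<nu>" for x :: 'e
  have pr\<nu>: "pr x \<bullet> ?\<nu> = 0" for x by (simp add: pr_def inner_diff_left \<nu>)
  define ti where "ti = inv_into U \<theta>"
  have ti: "ti w \<in> U" "\<theta> (ti w) = w" if "w \<in> \<theta> ` U" for w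
    using that by (auto simp: ti_def inv_into_into f_inv_into_f)
  have tiB: "ti w \<in> ?B" if "w \<in> \<theta> ` U" "w \<bullet> ?\<nu> = 0" for w
    unfolding mboundary_def using ti[OF that(1)] that(2) by (auto intro!: bexI[OF _ U(1)])
  define D where "D = {x. pr x \<in> \<theta> ` U}"
  \<comment> \<open>\<open>ennreal\<close> sends negative reals to 0, so below the hyperplane K is
    the boundary point over \<open>pr x\<close>.\<close>
  define K where "K x = c (ti (pr x), ennreal (x \<bullet> ?\<nu>))" for x
  have pr_cont: "continuous_on A pr" for A unfolding pr_def by (intro continuous_intros)
  have openD: "open D"
  proof -
    obtain Q where Q: "open Q" "\<theta> ` U = half_space \<inter> Q" using Uc(2) by (auto simp: openin_open)
    have "D = pr -` Q" using Q(2) pr\<nu> by (auto simp: D_def half_space_def)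
    then show ?thesis using Q(1) pr_cont[of UNIV] by (simp add: open_vimage)
  qed
  have Kcont: "continuous_map (top_of_set D) M K"
  proof -
    have "continuous_map (top_of_set D) (top_of_set (\<theta> ` U)) pr"
      using pr_cont by (auto simp: continuous_map_in_subtopology D_def)
    from continuous_map_compose[OF this continuous_map_inv_into_homeomorphic[OF Uc(3)]]
    have "continuous_map (top_of_set D) M (\<lambda>x. ti (pr x))"
      unfolding ti_def tU o_def by (simp add: continuous_map_in_subtopology)
    then have "continuous_map (top_of_set D) (subtopology M ?B) (\<lambda>x. ti (pr x))"
      using tiB pr\<nu> by (auto simp: continuous_map_in_subtopology D_def)
    moreover have "continuous_map (top_of_set D) euclidean (\<lambda>x. ennreal (x \<bullet> ?\<nu>))"
      by (auto intro!: continuous_on_ennreal continuous_intros)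
    ultimately show ?thesis
      unfolding K_def by (intro continuous_map_compose[OF _ ccont, unfolded o_def] continuous_map_pairedI)
  qed
  define Q where "Q = {x \<in> D. K x \<in> V} \<inter> {x. x \<bullet> ?\<nu> \<in> R}"
  have "open {x \<in> D. K x \<in> V}"
    using openin_continuous_map_preimage[OF Kcont Vc(1)] openD by (simp add: openin_open_eq)
  moreover have "open {x :: 'e. x \<bullet> ?\<nu> \<in> R}"
    using open_vimage[OF V(3), of "\<lambda>x. x \<bullet> ?\<nu>"] by (simp add: vimage_def continuous_intros)
  ultimately have openQ: "open Q" unfolding Q_def by (rule open_Int)
  \<comment> \<open>The second summand vanishes at nonnegative heights. At negative heights, where
    \<psi> = \<theta>, the sum is \<open>pr x\<close> plus the height times the normal, that is,
    x.\<close>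
  define f where "f x = \<psi> (K x) + min 0 (x \<bullet> ?\<nu>) *\<^sub>R ?\<nu>" for x
  have fcont: "continuous_on Q f"
  proof -
    have "continuous_map (top_of_set Q) (subtopology M V) K"
      using continuous_map_from_subtopology_mono[OF Kcont, of Q]
      by (auto simp: continuous_map_in_subtopology Q_def)
    from continuous_map_compose[OF this homeomorphic_imp_continuous_map[OF Vc(3)]]
    have "continuous_on Q (\<lambda>x. \<psi> (K x))" by (simp add: continuous_map_in_subtopology o_def)
    then show ?thesis unfolding f_def by (intro continuous_intros)
  qed
  have half: "0 \<le> \<psi> w \<bullet> ?\<nu>" if "w \<in> V" for w
    using openin_subset[OF Vc(2)] that by (auto simp: half_space_def)
  have fpos: "f x = \<psi> (K x)" "0 \<le> f x \<bullet> ?\<nu>" if "x \<in> Q" "0 \<le> x \<bullet> ?\<nu>" for x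
    using that half[of "K x"] by (auto simp: f_def Q_def)
  have fneg: "f x = x" if "x \<in> Q" "x \<bullet> ?\<nu> < 0" for x
  proof -
    have "R \<noteq> {0<..}" using that by (auto simp: Q_def)
    then have "\<psi> = \<theta>" using V(5) by blast
    have prx: "pr x \<in> \<theta> ` U" using that by (simp add: Q_def D_def)
    have "K x = ti (pr x)"
      unfolding K_def using c0[OF tiB[OF prx pr\<nu>]] that by (simp add: ennreal_neg)
    then show ?thesis
      unfolding f_def \<open>\<psi> = \<theta>\<close> using ti(2)[OF prx] that by (simp add: pr_def)
  qed
  have finj: "inj_on f Q"
  proof (rule inj_onI)
    fix x x' assume x: "x \<in> Q" "x' \<in> Q" "f x = f x'"
    \<comment> \<open>f sends nonnegative heights into the half space and fixes points of negative
      height, so the mixed cases cannot occur.\<close>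
    consider "0 \<le> x \<bullet> ?\<nu>" "0 \<le> x' \<bullet> ?\<nu>" | "x \<bullet> ?\<nu> < 0" "x' \<bullet> ?\<nu> < 0"
      | "0 \<le> x \<bullet> ?\<nu>" "x' \<bullet> ?\<nu> < 0" | "x \<bullet> ?\<nu> < 0" "0 \<le> x' \<bullet> ?\<nu>" by linarith
    then show "x = x'"
    proof cases
      case 1
      have prx: "pr x \<in> \<theta> ` U" "pr x' \<in> \<theta> ` U" "K x \<in> V" "K x' \<in> V" using x by (auto simp: Q_def D_def)
      have "K x = K x'"
        by (rule inj_onD[OF injV _ prx(3,4)]) (use fpos(1)[OF x(1)] fpos(1)[OF x(2)] x(3) 1 in simp)
      then have "(ti (pr x), ennreal (x \<bullet> ?\<nu>)) = (ti (pr x'), ennreal (x' \<bullet> ?\<nu>))"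
        unfolding K_def
        by (rule inj_onD[OF cinj]) (use tiB[OF prx(1) pr\<nu>] tiB[OF prx(2) pr\<nu>] BM in auto)
      then have eq: "ti (pr x) = ti (pr x')" "ennreal (x \<bullet> ?\<nu>) = ennreal (x' \<bullet> ?\<nu>)"
        unfolding prod.inject by (rule conjunct1, rule conjunct2)
      have "pr x = pr x'" using arg_cong[OF eq(1), of \<theta>] ti(2)[OF prx(1)] ti(2)[OF prx(2)] by metis
      moreover have "x \<bullet> ?\<nu> = x' \<bullet> ?\<nu>" using eq(2) 1 by simp
      ultimately show ?thesis by (simp add: pr_def)
    next
      case 2 then show ?thesis using fneg x by simp
    next
      case 3 then show ?thesis using fneg[OF x(2)] fpos(2)[OF x(1)] x(3) by simp
    next
      case 4 then show ?thesis using fneg[OF x(1)] fpos(2)[OF x(2)] x(3) by simp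
    qed
  qed
  have openf: "open (f ` Q)"
    by (rule invariance_of_domain[OF fcont openQ finj])
  let ?T = "{w \<in> V. \<psi> w \<in> f ` Q}"
  have "openin (subtopology M V) {w \<in> topspace (subtopology M V). \<psi> w \<in> f ` Q}"
    using homeomorphic_imp_continuous_map[OF Vc(3)] openf
    by (intro openin_continuous_map_preimage[where Y = euclidean]) (auto simp: continuous_map_in_subtopology)
  then have "openin M ?T"
    unfolding tU openin_open_subtopology[OF Vc(1)] by simp
  moreover have "z \<in> ?T"
  proof -
    let ?x = "\<theta> y + r *\<^sub>R ?\<nu>"
    have x: "?x \<bullet> ?\<nu> = r" "pr ?x = \<theta> y" using U(3) \<nu> by (simp_all add: pr_def inner_add_left)
    have "ti (\<theta> y) = y" unfolding ti_def by (rule inv_into_f_f[OF injU U(2)])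
    then have "K ?x = z" unfolding K_def x y(3) r(1) by simp
    then have "?x \<in> Q" using x U(2) V(2,4) by (auto simp: Q_def D_def)
    then show ?thesis using fpos(1)[of ?x] x(1) r(2) \<open>K ?x = z\<close> V(2) by force
  qed
  moreover have "?T \<subseteq> c ` (?B \<times> {..<\<infinity>})"
  proof
    fix w assume "w \<in> ?T"
    then obtain x where x: "w \<in> V" "x \<in> Q" "\<psi> w = f x" by auto
    \<comment> \<open>A negative height is impossible: f would fix x, whereas \<psi> w lies in the
      half space.\<close>
    have "0 \<le> x \<bullet> ?\<nu>" using half[OF x(1)] x(3) fneg[OF x(2)] by fastforce
    then have "\<psi> w = \<psi> (K x)" using fpos(1) x by simp
    then have "w = K x" using injV x by (auto simp: Q_def inj_on_def)
    moreover have "ti (pr x) \<in> ?B" using tiB pr\<nu> x(2) by (auto simp: Q_def D_def)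
    ultimately show "w \<in> c ` (?B \<times> {..<\<infinity>})" unfolding K_def by (auto simp: infinity_ennreal_def)
  qed
  ultimately show "\<exists>T. openin M T \<and> z \<in> T \<and> T \<subseteq> c ` (?B \<times> {..<\<infinity>})" by blast
qed

text \<open>\<open>epush\<close> with a real amount: iterates of \<open>epush\<close> are pushes by
  an integer, and homotopies need an amount that varies continuously. Since \<infinity> + \<tau> =
  \<infinity>, the far end of the collar is fixed, in agreement with the identity outside.\<close>

definition cpush :: "'m collared \<Rightarrow> real \<Rightarrow> 'm \<Rightarrow> 'm" where
  "cpush W \<tau> z =
     (if z \<in> Col W ` (Bdy W \<times> UNIV)
      then (case inv_into (Bdy W \<times> UNIV) (Col W) z of (y, t) \<Rightarrow> Col W (y, t + ennreal \<tau>))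
      else z)"

locale collared_space =
  fixes W :: "'m collared"
  assumes collared: "is_collared W"
    and hausdorff: "Hausdorff_space (Spc W)"
    and bdy: "Bdy W \<subseteq> topspace (Spc W)"
begin

lemma topspace_bdy: "topspace (prod_topology (subtopology (Spc W) (Bdy W)) euclidean) = Bdy W \<times> UNIV"
  using bdy by auto

lemma col_homeo:
  "homeomorphic_map (prod_topology (subtopology (Spc W) (Bdy W)) euclidean)
     (subtopology (Spc W) (Col W ` (Bdy W \<times> UNIV))) (Col W)"
  using collared topspace_bdy unfolding is_collared_def embedding_map_def by metis

lemma col_cont: "continuous_map (prod_topology (subtopology (Spc W) (Bdy W)) euclidean) (Spc W) (Col W)"
  using homeomorphic_imp_continuous_map[OF col_homeo] by (simp add: continuous_map_in_subtopology)

lemma col_inj: "inj_on (Col W) (Bdy W \<times> UNIV)"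
  using homeomorphic_imp_injective_map[OF col_homeo] unfolding topspace_bdy .

lemma col_mem: "y \<in> Bdy W \<Longrightarrow> Col W (y, t) \<in> topspace (Spc W)"
  using continuous_map_funspace[OF col_cont] topspace_bdy by (auto simp: Pi_iff)

lemma bpt: "Bpt W \<in> Bdy W"
  using collared by (simp add: is_collared_def)

lemma apt_cont: "continuous_map (top_of_set {0..}) (Spc W) (apt W)"
proof -
  have "continuous_map (top_of_set {0..}) (subtopology (Spc W) (Bdy W)) (\<lambda>t. Bpt W)"
    using bpt bdy by auto
  moreover have "continuous_map (top_of_set {0..}) euclidean ennreal"
    by (auto intro!: continuous_on_ennreal continuous_intros)
  ultimately show ?thesis
    unfolding apt_def[abs_def]
    by (intro continuous_map_compose[OF _ col_cont, unfolded o_def] continuous_map_pairedI)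
qed

lemma apt_inj: "inj_on (apt W) {0..}"
proof (rule inj_onI)
  fix x y :: real assume xy: "x \<in> {0..}" "y \<in> {0..}" "apt W x = apt W y"
  have "(Bpt W, ennreal x) = (Bpt W, ennreal y)"
    by (rule inj_onD[OF col_inj]) (use xy bpt in \<open>auto simp: apt_def\<close>)
  then show "x = y" using xy by simp
qed

lemma arc_space: "x0 \<in> topspace X \<Longrightarrow> arc_space (Spc W) X (apt W) x0"
  by unfold_locales (use hausdorff apt_cont apt_inj in auto)

lemma cpush_Col: "y \<in> Bdy W \<Longrightarrow> cpush W \<tau> (Col W (y, t)) = Col W (y, t + ennreal \<tau>)"
  unfolding cpush_def using inv_into_f_f[OF col_inj, of "(y, t)"] by auto

lemma cpush_outside: "z \<notin> Col W ` (Bdy W \<times> UNIV) \<Longrightarrow> cpush W \<tau> z = z"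
  unfolding cpush_def by simp

lemma epush_eq_cpush: "epush W = cpush W 1"
  by (simp add: fun_eq_iff epush_def cpush_def)

lemma cpush_cpush:
  assumes "0 \<le> \<sigma>" "0 \<le> \<tau>"
  shows "cpush W \<tau> (cpush W \<sigma> z) = cpush W (\<sigma> + \<tau>) z"
proof (cases "z \<in> Col W ` (Bdy W \<times> UNIV)")
  case True
  then show ?thesis using assms by (auto simp: cpush_Col ennreal_plus add.assoc)
qed (simp add: cpush_outside)

lemma cpush_0: "cpush W 0 z = z"
  by (cases "z \<in> Col W ` (Bdy W \<times> UNIV)") (auto simp: cpush_Col cpush_outside)

lemma epush_funpow: "(epush W ^^ n) = cpush W (real n)"
proof (induction n)
  case 0 show ?case by (simp add: fun_eq_iff cpush_0)
next
  case (Suc n)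
  then show ?case by (simp add: fun_eq_iff epush_eq_cpush cpush_cpush add.commute)
qed

lemma cpush_apt: "0 \<le> t \<Longrightarrow> 0 \<le> \<tau> \<Longrightarrow> cpush W \<tau> (apt W t) = apt W (t + \<tau>)"
  unfolding apt_def by (simp add: cpush_Col[OF bpt] ennreal_plus)

text \<open>Points outside the collar stay outside, and inside it the depth grows by \<tau>. This
  separates a pushed configuration from anything at smaller depth.\<close>

lemma cpush_range:
  assumes y: "y \<in> Bdy W" and eq: "cpush W \<tau> z = Col W (y, s)"
  shows "ennreal \<tau> \<le> s"
proof -
  have "z \<in> Col W ` (Bdy W \<times> UNIV)"
    using eq y cpush_outside[of z \<tau>] by (metis SigmaI UNIV_I image_eqI)
  then obtain y' t where z: "y' \<in> Bdy W" "z = Col W (y', t)" by auto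
  then have "Col W (y', t + ennreal \<tau>) = Col W (y, s)" using eq by (simp add: cpush_Col)
  then have "(y', t + ennreal \<tau>) = (y, s)" by (rule inj_onD[OF col_inj]) (use z y in auto)
  then show ?thesis by auto
qed

lemma cpush_inj: "inj (cpush W \<tau>)"
proof (rule injI)
  fix z z' assume eq: "cpush W \<tau> z = cpush W \<tau> z'"
  let ?C = "Col W ` (Bdy W \<times> UNIV)"
  have in_iff: "cpush W \<tau> w \<in> ?C \<longleftrightarrow> w \<in> ?C" for w
    by (cases "w \<in> ?C") (auto simp: cpush_Col cpush_outside)
  show "z = z'"
  proof (cases "z \<in> ?C")
    case True
    moreover have "z' \<in> ?C" using True in_iff eq by metis
    ultimately obtain y t y' t' where z: "y \<in> Bdy W" "z = Col W (y, t)" "y' \<in> Bdy W" "z' = Col W (y', t')"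
      by auto
    then have "Col W (y, t + ennreal \<tau>) = Col W (y', t' + ennreal \<tau>)" using eq by (simp add: cpush_Col)
    then have "(y, t + ennreal \<tau>) = (y', t' + ennreal \<tau>)" by (rule inj_onD[OF col_inj]) (use z in auto)
    \<comment> \<open>A finite amount can be cancelled in [0, \<infinity>], also where the depth is
      \<infinity>.\<close>
    then have "y = y'" "t = t'" by (auto simp: add.commute[of _ "ennreal \<tau>"] ennreal_add_left_cancel)
    then show ?thesis using z by simp
  next
    case False
    then have "z' \<notin> ?C" using in_iff eq by metis
    then show ?thesis using False eq by (simp add: cpush_outside)
  qed
qed

text \<open>A push by 1 + \<sigma> reaches depth 1 only if \<sigma> = 0, and then, by injectivity,
  only from the basepoint. This is the one way in which a pushed strand can hit the point inserted
  at a_1.\<close>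

lemma cpush_eq_apt_1:
  assumes "0 \<le> \<sigma>" "cpush W (1 + \<sigma>) z = apt W 1"
  shows "\<sigma> = 0 \<and> z = Bpt W"
proof -
  have "ennreal (1 + \<sigma>) \<le> ennreal 1"
    by (rule cpush_range[OF bpt]) (use assms in \<open>simp add: apt_def\<close>)
  then have "\<sigma> = 0" using assms(1) by (subst (asm) ennreal_le_iff) auto
  have "Bpt W = apt W 0" using collared bpt by (simp add: apt_def is_collared_def)
  then have "cpush W 1 (Bpt W) = apt W 1" using cpush_apt[of 0 1] by simp
  then show ?thesis using assms(2) \<open>\<sigma> = 0\<close> injD[OF cpush_inj, of 1 z "Bpt W"] by simp
qed

text \<open>Pasting over two closed sets: the whole collar, closed because the collar map is proper,
  and the complement of its part at finite depth, where the push is the identity. Continuity is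
  joint in amount and point, as needed for pushes that vary over the square.\<close>

lemma cpush_cont:
  assumes op: "openin (Spc W) (Col W ` (Bdy W \<times> {..<\<infinity>}))"
  shows "continuous_map (prod_topology (top_of_set {0..}) (Spc W)) (Spc W) (\<lambda>q. cpush W (fst q) (snd q))"
proof -
  let ?C = "Col W ` (Bdy W \<times> UNIV)" and ?G = "Col W ` (Bdy W \<times> {..<\<infinity>})"
  let ?Z = "prod_topology (top_of_set {0::real..}) (Spc W)"
  let ?B = "prod_topology (subtopology (Spc W) (Bdy W)) euclidean"
  let ?E = "\<lambda>q. cpush W (fst q) (snd q)"
  have "closedin (Spc W) ?C"
  proof -
    have "closed_map ?B (Spc W) (Col W)"
      using collared by (simp add: is_collared_def proper_map_def)
    then show ?thesis using closedin_topspace[of ?B] topspace_bdy by (metis closed_map_def)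
  qed
  then have clo: "closedin ?Z ({0..} \<times> ?C)" "closedin ?Z ({0..} \<times> (topspace (Spc W) - ?G))"
    using op by (auto simp: closedin_prod_Times_iff)
  have "topspace ?Z \<subseteq> {0..} \<times> ?C \<union> {0..} \<times> (topspace (Spc W) - ?G)" by auto
  moreover have "continuous_map (subtopology ?Z ({0..} \<times> ?C)) (Spc W) ?E"
  proof -
    let ?i = "inv_into (Bdy W \<times> UNIV) (Col W)"
    let ?S = "subtopology ?Z ({0..} \<times> ?C)"
    have "continuous_map ?S (Spc W) snd"
      by (intro continuous_map_from_subtopology continuous_map_snd)
    then have "continuous_map ?S (subtopology (Spc W) ?C) snd"
      by (auto simp: continuous_map_in_subtopology)
    from continuous_map_compose[OF this continuous_map_inv_into_homeomorphic[OF col_homeo]]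
    have i: "continuous_map ?S ?B (\<lambda>q. ?i (snd q))" unfolding topspace_bdy o_def .
    have i1: "continuous_map ?S (subtopology (Spc W) (Bdy W)) (\<lambda>q. fst (?i (snd q)))"
      using continuous_map_compose[OF i continuous_map_fst] by (simp add: o_def)
    have i2: "continuous_map ?S euclidean (\<lambda>q. snd (?i (snd q)))"
      using continuous_map_compose[OF i continuous_map_snd] by (simp add: o_def)
    have "continuous_map ?S (top_of_set {0..}) fst"
      by (intro continuous_map_from_subtopology continuous_map_fst)
    moreover have "continuous_map (top_of_set {0..}) euclidean ennreal"
      by (auto intro!: continuous_on_ennreal continuous_intros)
    ultimately have e: "continuous_map ?S euclidean (\<lambda>q. ennreal (fst q))"
      by (rule continuous_map_compose[unfolded o_def])
    have plus: "continuous_map (prod_topology euclidean euclidean) euclidean (\<lambda>q. fst q + snd q :: ennreal)"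
      by (auto intro!: continuous_intros)
    have "continuous_map ?S euclidean (\<lambda>q. snd (?i (snd q)) + ennreal (fst q))"
      using continuous_map_compose[OF continuous_map_pairedI[OF i2 e] plus] by (simp add: o_def)
    from continuous_map_compose[OF continuous_map_pairedI[OF i1 this] col_cont]
    have "continuous_map ?S (Spc W) (\<lambda>q. Col W (fst (?i (snd q)), snd (?i (snd q)) + ennreal (fst q)))"
      by (simp add: o_def)
    then show ?thesis
      by (rule continuous_map_eq) (auto simp: cpush_def split: prod.split)
  qed
  moreover have "continuous_map (subtopology ?Z ({0..} \<times> (topspace (Spc W) - ?G))) (Spc W) ?E"
  proof -
    have "continuous_map (subtopology ?Z ({0..} \<times> (topspace (Spc W) - ?G))) (Spc W) snd"
      by (intro continuous_map_from_subtopology continuous_map_snd)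
    then show ?thesis
    proof (rule continuous_map_eq)
      fix q assume "q \<in> topspace (subtopology ?Z ({0..} \<times> (topspace (Spc W) - ?G)))"
      then have q: "snd q \<notin> ?G" by auto
      show "snd q = ?E q"
      proof (cases "snd q \<in> ?C")
        case True
        then obtain y t where yt: "y \<in> Bdy W" "snd q = Col W (y, t)" by auto
        then have "\<not> t < \<infinity>" using q by auto
        then have "t = \<infinity>" unfolding infinity_ennreal_def less_top[symmetric] by simp
        then show ?thesis using yt by (simp add: cpush_Col infinity_ennreal_def)
      qed (simp add: cpush_outside)
    qed
  qed
  ultimately show ?thesis using continuous_map_closed_Un[OF clo] by blast
qed

end

section \<open>From marked points to positions on the arc\<close>

definition rshift :: "real \<Rightarrow> (real \<times> real) set \<Rightarrow> (real \<times> real) set" where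
  "rshift \<tau> P = (\<lambda>p. (\<tau> + fst p, \<tau> + snd p)) ` P"

lemma arc_rel_rshift:
  assumes "arc_rel P" "0 \<le> \<tau>"
  shows "arc_rel (rshift \<tau> P)"
proof -
  have "mono_rel (rshift \<tau> P)"
    unfolding mono_rel_def rshift_def using assms mono_relD[of P] by (auto simp: arc_rel_def)
  then show ?thesis using assms by (auto simp: arc_rel_def rshift_def)
qed

lemma arc_rel_Un:
  assumes P: "arc_rel P" and Q: "arc_rel Q"
    and less: "\<And>p q. p \<in> P \<Longrightarrow> q \<in> Q \<Longrightarrow> fst p < fst q \<and> snd p < snd q"
  shows "arc_rel (P \<union> Q)"
proof -
  have "mono_rel (P \<union> Q)"
    unfolding mono_rel_def
  proof (intro allI impI)
    fix u v u' v' assume "(u, v) \<in> P \<union> Q" "(u', v') \<in> P \<union> Q"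
    then consider "(u, v) \<in> P" "(u', v') \<in> P" | "(u, v) \<in> Q" "(u', v') \<in> Q"
      | "(u, v) \<in> P" "(u', v') \<in> Q" | "(u, v) \<in> Q" "(u', v') \<in> P" by blast
    then show "u < u' \<longleftrightarrow> v < v'"
    proof cases
      case 1 then show ?thesis using P mono_relD unfolding arc_rel_def by blast
    next
      case 2 then show ?thesis using Q mono_relD unfolding arc_rel_def by blast
    next
      case 3 then show ?thesis using less by fastforce
    next
      case 4 then show ?thesis using less by fastforce
    qed
  qed
  then show ?thesis using P Q by (simp add: arc_rel_def)
qed

lemma lin_Un: "lin a x0 (P \<union> Q) t = lin a x0 P t \<union> lin a x0 Q t"
  by (auto simp: lin_def)

definition real_rel :: "(nat \<times> nat) set \<Rightarrow> (real \<times> real) set" where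
  "real_rel P = (\<lambda>(i, j). (real i, real j)) ` P"

lemma mem_real_rel: "(u, v) \<in> real_rel P \<longleftrightarrow> (\<exists>i j. u = real i \<and> v = real j \<and> (i, j) \<in> P)"
  by (auto simp: real_rel_def)

lemma real_rel_relcomp: "real_rel P O real_rel Q = real_rel (P O Q)"
proof (intro equalityI subrelI)
  fix u w assume "(u, w) \<in> real_rel P O real_rel Q"
  then show "(u, w) \<in> real_rel (P O Q)" by (fastforce simp: mem_real_rel)
next
  fix u w assume "(u, w) \<in> real_rel (P O Q)"
  then show "(u, w) \<in> real_rel P O real_rel Q" unfolding mem_real_rel by (metis relcomp.cases relcomp.intros mem_real_rel)
qed

lemma real_rel_converse: "(real_rel P)\<inverse> = real_rel (P\<inverse>)"
  by (auto simp: real_rel_def)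

lemma real_rel_Un: "real_rel (P \<union> Q) = real_rel P \<union> real_rel Q"
  by (auto simp: real_rel_def)

lemma rshift_real_rel: "rshift (real n) (real_rel P) = real_rel ((\<lambda>(i, j). (n + i, n + j)) ` P)"
  unfolding rshift_def real_rel_def image_image by (rule image_cong) auto

lemma arc_rel_real_rel:
  assumes "finite P" "mono_rel P"
  shows "arc_rel (real_rel P)"
proof -
  have "mono_rel (real_rel P)"
    unfolding mono_rel_def mem_real_rel
  proof (intro allI impI, elim exE conjE)
    fix u v u' v' i j i' j' assume "u = real i" "v = real j" "(i, j) \<in> P" "u' = real i'" "v' = real j'" "(i', j') \<in> P"
    then show "u < u' \<longleftrightarrow> v < v'" using mono_relD[OF assms(2), of i j i' j'] by simp
  qed
  moreover have "finite (real_rel P)" "real_rel P \<subseteq> {0..} \<times> {0..}"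
    using assms(1) by (auto simp: real_rel_def)
  ultimately show ?thesis by (simp add: arc_rel_def)
qed

lemma oinj_arc_rel:
  assumes "(m, m', P) \<in> Arr oinj_cat"
  shows "arc_rel (real_rel P)" "finite P"
proof -
  have P: "P \<subseteq> {1..m} \<times> {1..m'}" "mono_rel P" using assms by (auto simp: Arr_oinj_cat)
  show "finite P" using P(1) by (rule finite_subset) simp
  then show "arc_rel (real_rel P)" using P(2) by (rule arc_rel_real_rel)
qed

lemma Id_on_lin: "lin a x0 (Id_on A) t = (\<lambda>u. (a u, x0)) ` A"
proof -
  have "lin a x0 (Id_on A) t = (\<lambda>p. (a ((1 - t) * fst p + t * snd p), x0)) ` (\<lambda>u. (u, u)) ` A"
    unfolding lin_def Id_on_def by (rule arg_cong[where f = "image _"]) auto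
  also have "\<dots> = (\<lambda>u. (a u, x0)) ` A"
    unfolding image_image by (simp add: algebra_simps)
  finally show ?thesis .
qed

lemma real_rel_Id_on: "real_rel (Id_on A) = Id_on (real ` A)"
  by (auto simp: real_rel_def Id_on_def)

lemma std_conf_eq_lin: "std_conf W x0 m = lin (apt W) x0 (real_rel (Id_on {1..m})) t"
  unfolding real_rel_Id_on Id_on_lin std_conf_def image_image ..

section \<open>The effect of the stabilisers on classes of slides\<close>

locale pushable_space = collared_space W for W :: "'m collared" +
  fixes X :: "'x topology" and x0 :: 'x
  assumes x0: "x0 \<in> topspace X"
    and open_collar: "openin (Spc W) (Col W ` (Bdy W \<times> {..<\<infinity>}))"
begin

sublocale arc: arc_space "Spc W" X "apt W" x0
  by (rule arc_space[OF x0])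

lemma push_strand_cont:
  assumes h: "continuous_map (top_of_set A) (prod_topology (Spc W) X) h"
    and \<sigma>: "continuous_on A \<sigma>" "\<And>z. z \<in> A \<Longrightarrow> 0 \<le> \<sigma> z"
  shows "continuous_map (top_of_set A) (prod_topology (Spc W) X) (\<lambda>z. (cpush W (\<sigma> z) (fst (h z)), snd (h z)))"
proof (rule continuous_map_pairedI)
  have "continuous_map (top_of_set A) (top_of_set {0..}) \<sigma>"
    using \<sigma> by (auto simp: continuous_map_in_subtopology)
  moreover have "continuous_map (top_of_set A) (Spc W) (\<lambda>z. fst (h z))"
    using continuous_map_compose[OF h continuous_map_fst] by (simp add: o_def)
  ultimately have "continuous_map (top_of_set A) (prod_topology (top_of_set {0..}) (Spc W)) (\<lambda>z. (\<sigma> z, fst (h z)))"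
    by (rule continuous_map_pairedI)
  from continuous_map_compose[OF this cpush_cont[OF open_collar]]
  show "continuous_map (top_of_set A) (Spc W) (\<lambda>z. cpush W (\<sigma> z) (fst (h z)))" by (simp add: o_def)
  show "continuous_map (top_of_set A) X (\<lambda>z. snd (h z))"
    using continuous_map_compose[OF h continuous_map_snd] by (simp add: o_def)
qed

lemma move_conf_cpush_lin:
  assumes P: "P \<subseteq> {0..} \<times> {0..}" and t: "t \<in> {0..1}" and \<tau>: "0 \<le> \<tau>"
  shows "move_conf (cpush W \<tau>) (lin (apt W) x0 P t) = lin (apt W) x0 (rshift \<tau> P) t"
  unfolding move_conf_def lin_def rshift_def image_image prod.case
proof (rule image_cong[OF refl])
  fix p assume "p \<in> P"
  then have "0 \<le> (1 - t) * fst p + t * snd p"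
    using P t by (auto intro!: add_nonneg_nonneg mult_nonneg_nonneg)
  moreover have "(1 - t) * (\<tau> + fst p) + t * (\<tau> + snd p) = (1 - t) * fst p + t * snd p + \<tau>"
    by (simp add: algebra_simps)
  ultimately show "(cpush W \<tau> (apt W ((1 - t) * fst p + t * snd p)), x0) =
      (apt W ((1 - t) * fst (\<tau> + fst p, \<tau> + snd p) + t * snd (\<tau> + fst p, \<tau> + snd p)), x0)"
    using cpush_apt \<tau> by simp
qed

text \<open>The union runs over all representatives, including those that pass through the
  basepoint. These contribute nothing, and all others contribute the class of the pushed slide with
  a constant strand at a_1. Strict positivity in \<open>pos\<close> keeps the slide itself off the
  basepoint.\<close>

lemma s_functor_lin:
  assumes P: "arc_rel P" and pos: "P \<subseteq> {0<..} \<times> {0<..}"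
  shows "(\<Union>\<gamma>\<in>pclass (Spc W) X (lin (apt W) x0 P).
      pclass (Spc W) X (\<lambda>t. insert (apt W 1, x0) (move_conf (epush W) (\<gamma> t)))) =
    pclass (Spc W) X (lin (apt W) x0 ({(1, 1)} \<union> rshift 1 P))"
proof -
  let ?M = "Spc W" and ?Q = "{(1, 1)} \<union> rshift 1 P"
  let ?L = "lin (apt W) x0 P"
  define ins where "ins \<gamma> t = insert (apt W 1, x0) (move_conf (epush W) (\<gamma> t))" for \<gamma> :: "('m, 'x) cpath" and t
  have P0: "P \<subseteq> {0..} \<times> {0..}" and fin: "finite P" using P by (auto simp: arc_rel_def)
  have Q: "arc_rel ?Q"
  proof (rule arc_rel_Un)
    show "arc_rel (rshift 1 P)" by (rule arc_rel_rshift[OF P]) simp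
  qed (use pos in \<open>auto simp: arc_rel_def mono_rel_def rshift_def\<close>)
  have insL: "ins ?L t = lin (apt W) x0 ?Q t" if "t \<in> {0..1}" for t
    unfolding ins_def epush_eq_cpush move_conf_cpush_lin[OF P0 that zero_le_one] lin_Un
    by (simp add: lin_def)
  then have base: "pclass ?M X (ins ?L) = pclass ?M X (lin (apt W) x0 ?Q)" by (rule pclass_cong)
  have cardQ: "card ?Q = Suc (card P)"
  proof -
    have "card (rshift 1 P) = card P" unfolding rshift_def by (rule card_image) (auto simp: inj_on_def prod_eq_iff)
    moreover have "(1, 1) \<notin> rshift 1 P" using pos by (auto simp: rshift_def)
    ultimately show ?thesis using fin by (simp add: rshift_def)
  qed
  have Bpt0: "Bpt W = apt W 0" using collared bpt by (simp add: apt_def is_collared_def)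
  have avoid: "Bpt W \<notin> fst ` ?L t" if t: "t \<in> {0..1}" for t
  proof
    assume "Bpt W \<in> fst ` ?L t"
    then obtain p where p: "p \<in> P" "apt W 0 = apt W ((1 - t) * fst p + t * snd p)"
      unfolding lin_def Bpt0 by auto
    have "(1 - t) * 0 + t * 0 < (1 - t) * fst p + t * snd p"
      using p(1) pos t by (intro convex_comb_less) auto
    then show False using inj_onD[OF apt_inj p(2)] by auto
  qed
  have "pclass ?M X (ins \<gamma>) = {} \<or> pclass ?M X (ins \<gamma>) = pclass ?M X (lin (apt W) x0 ?Q)"
    if \<gamma>: "\<gamma> \<in> pclass ?M X ?L" for \<gamma>
  proof (cases "\<exists>t\<in>{0..1}. Bpt W \<in> fst ` \<gamma> t")
    case True
    then obtain t x where t: "t \<in> {0..1}" "(Bpt W, x) \<in> \<gamma> t" by auto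
    \<comment> \<open>The push-in map sends the basepoint to the first marked point, so here two points collide.\<close>
    have "\<delta> \<notin> pclass ?M X (ins \<gamma>)" for \<delta>
    proof
      assume "\<delta> \<in> pclass ?M X (ins \<gamma>)"
      note pa = pclass_path(1)[OF this]
      have "ins \<gamma> 0 = lin (apt W) x0 ?Q 0"
        using insL[of 0] pclass_endpoints(1)[OF \<gamma>] by (simp add: ins_def)
      then have c0: "card (ins \<gamma> 0) = Suc (card P)"
        using pathin_conf_space_card(1)[OF arc.lin_pathin[OF Q], of 0] cardQ by simp
      have c: "card (ins \<gamma> t) = Suc (card P)" "inj_on fst (ins \<gamma> t)"
        using pathin_conf_space_card[OF pa t(1)] c0 by auto
      have "epush W (Bpt W) = apt W 1"
        unfolding epush_eq_cpush Bpt0 using cpush_apt[of 0 1] by simp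
      then have "(apt W 1, x) \<in> move_conf (epush W) (\<gamma> t)"
        unfolding move_conf_def using t(2) by force
      moreover from this have "x = x0" using inj_onD[OF c(2), of "(apt W 1, x)" "(apt W 1, x0)"] by (auto simp: ins_def)
      \<comment> \<open>The inserted point is already present, so at most \<open>card P\<close>
        points are left where \<open>Suc (card P)\<close> are required.\<close>
      ultimately have "ins \<gamma> t = move_conf (epush W) (\<gamma> t)" by (auto simp: ins_def)
      moreover have "card (\<gamma> t) = card (?L 0)"
        by (rule pathin_conf_space_card(1)[OF pclass_path(2)[OF \<gamma>] t(1)])
      moreover have "card (?L 0) = card P"
        by (rule pathin_conf_space_card(1)[OF arc.lin_pathin[OF P]]) simp
      moreover have "finite (\<gamma> t)"
        by (rule pathin_conf_space_card(3)[OF pclass_path(2)[OF \<gamma>] t(1)])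
      ultimately show False
        using c(1) card_image_le[of "\<gamma> t" "\<lambda>(z, x). (epush W z, x)"] unfolding move_conf_def by simp
    qed
    then show ?thesis by blast
  next
    case False
    obtain h where h: "strand_homotopy ?M X {..<card (?L 0)} h ?L \<gamma>"
      using pclassE[OF hausdorff \<gamma>] by blast
    let ?k = "card (?L 0)"
    note D = strand_homotopyD[OF h]
    \<comment> \<open>Pushing a little further in the interior of the square keeps the strands off the first
      marked point even where the homotopy passes through the basepoint.\<close>
    let ?g = "\<lambda>z::real \<times> real. fst z * (1 - fst z) * (snd z * (1 - snd z))"
    \<comment> \<open>\<open>None\<close> indexes the inserted strand, which stays at a_1.\<close>
    define h' where "h' j z = (case j of None \<Rightarrow> (apt W 1, x0)
        | Some i \<Rightarrow> (cpush W (1 + ?g z) (fst (h i z)), snd (h i z)))" for j z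
    have g0: "0 \<le> ?g z" if "z \<in> {0..1} \<times> {0..1}" for z
      using that by (auto intro!: mult_nonneg_nonneg)
    \<comment> \<open>The extra push vanishes exactly on the four sides of the square. Three of them
      carry points of the slide; the fourth, s = 1, carries \<gamma>, which avoids the basepoint in
      this case.\<close>
    have off: "fst (h i z) \<noteq> Bpt W" if i: "i < ?k" and z: "z \<in> {0..1} \<times> {0..1}" and g: "?g z = 0" for i z
    proof -
      obtain s t where st: "z = (s, t)" "s \<in> {0..1}" "t \<in> {0..1}" using z by auto
      have L: "h i (0, t) \<in> ?L t" and G: "h i (1, t) \<in> \<gamma> t" using D(3,4)[OF st(3)] i by blast+
      consider "s = 0" | "s = 1" | "t = 0" | "t = 1" using g st(1) by auto
      then show ?thesis
      proof cases
        case 1 then show ?thesis using avoid[OF st(3)] L st(1) by force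
      next
        case 2 then show ?thesis using False st G by force
      next
        case 3
        then have "h i z = h i (0, t)" using D(5)[OF _ st(2)] i st(1) by simp
        then show ?thesis using avoid[OF st(3)] L by force
      next
        case 4
        then have "h i z = h i (0, t)" using D(6)[OF _ st(2)] i st(1) by simp
        then show ?thesis using avoid[OF st(3)] L by force
      qed
    qed
    let ?I = "insert None (Some ` {..<?k})"
    have "strand_homotopy ?M X ?I h' (ins ?L) (ins \<gamma>)"
      unfolding strand_homotopy_def
    proof (intro conjI ballI)
      fix j assume "j \<in> ?I"
      then show "continuous_map (top_of_set ({0..1} \<times> {0..1})) (prod_topology ?M X) (h' j)"
      proof (elim insertE imageE)
        assume "j = None"
        then show ?thesis
          using col_mem[OF bpt] x0 by (simp add: h'_def[abs_def] apt_def)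
      next
        fix i assume i: "j = Some i" "i \<in> {..<?k}"
        have "continuous_map (top_of_set ({0..1} \<times> {0..1})) (prod_topology ?M X)
            (\<lambda>z. (cpush W (1 + ?g z) (fst (h i z)), snd (h i z)))"
          by (rule push_strand_cont[OF D(1)[OF i(2)]])
            (use g0 in \<open>auto intro!: continuous_intros add_nonneg_nonneg\<close>)
        then show ?thesis using i(1) by (simp add: h'_def[abs_def])
      qed
    next
      fix z :: "real \<times> real" assume z: "z \<in> {0..1} \<times> {0..1}"
      have "fst (h' None z) \<noteq> fst (h' (Some i) z)" if "i < ?k" for i
        using cpush_eq_apt_1[OF g0[OF z], of "fst (h i z)"] off[OF that z] by (auto simp: h'_def)
      moreover have "i = j" if "i < ?k" "j < ?k" "fst (h' (Some i) z) = fst (h' (Some j) z)" for i j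
        using injD[OF cpush_inj] inj_onD[OF D(2)[OF z], of i j] that by (auto simp: h'_def)
      ultimately show "inj_on (\<lambda>j. fst (h' j z)) ?I"
        by (auto simp: inj_on_def) metis
    next
      fix t :: real assume t: "t \<in> {0..1}"
      have "(\<lambda>j. h' j (e, t)) ` ?I = insert (apt W 1, x0) (move_conf (epush W) ((\<lambda>i. h i (e, t)) ` {..<?k}))"
        if "e = 0 \<or> e = 1" for e
        using that unfolding move_conf_def epush_eq_cpush
        by (auto simp: h'_def image_image split_beta)
      then show "ins ?L t = (\<lambda>j. h' j (0, t)) ` ?I" "ins \<gamma> t = (\<lambda>j. h' j (1, t)) ` ?I"
        using D(3,4)[OF t] unfolding ins_def by metis+
    next
      fix j and s :: real assume j: "j \<in> ?I" and s: "s \<in> {0..1}"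
      show "h' j (s, 0) = h' j (0, 0)" "h' j (s, 1) = h' j (0, 1)"
        using j D(5)[OF _ s] D(6)[OF _ s] by (auto simp: h'_def simp del: One_nat_def)
    qed
    then have "ins \<gamma> \<in> pclass ?M X (ins ?L)" by (intro pclassI) auto
    then show ?thesis using pclass_eq base by blast
  qed
  moreover have "?L \<in> pclass ?M X ?L" by (rule arc.lin_refl[OF P])
  ultimately have "(\<Union>\<gamma>\<in>pclass ?M X ?L. pclass ?M X (ins \<gamma>)) = pclass ?M X (lin (apt W) x0 ?Q)"
    using base by blast
  then show ?thesis unfolding ins_def .
qed

text \<open>No collision is possible here: the embedded disc reaches only depth N + 1/2 in the
  collar, and points pushed by N + 1 that lie in the collar have depth at least N + 1. Strand
  homotopies of the two factors can therefore be united, and every pair of representatives gives the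
  same class.\<close>

lemma oplus_mid_lin:
  fixes D :: "'d collared"
  assumes D: "collared_space D" and \<phi>: "arc_embedding D W N \<phi>"
    and A: "A \<subseteq> {1..N}" and P: "arc_rel P"
  shows "(\<Union>\<beta>\<in>pclass (Spc D) X (lin (apt D) x0 (real_rel (Id_on A))).
      \<Union>\<gamma>\<in>pclass (Spc W) X (lin (apt W) x0 P).
        pclass (Spc W) X (\<lambda>t. move_conf \<phi> (\<beta> t) \<union> move_conf (epush W ^^ (N + 1)) (\<gamma> t))) =
    pclass (Spc W) X (lin (apt W) x0 (real_rel (Id_on A) \<union> rshift (real (N + 1)) P))"
proof -
  interpret D: collared_space D by (rule D)
  interpret Darc: arc_space "Spc D" X "apt D" x0 by (rule D.arc_space[OF x0])
  let ?M = "Spc W" and ?A = "real_rel (Id_on A)"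
  let ?LD = "lin (apt D) x0 ?A" and ?L = "lin (apt W) x0 P"
  define un where "un \<beta> \<gamma> t = move_conf \<phi> (\<beta> t) \<union> move_conf (epush W ^^ (N + 1)) (\<gamma> t)"
    for \<beta> :: "('d, 'x) cpath" and \<gamma> :: "('m, 'x) cpath" and t
  have fA: "arc_rel ?A"
    using A by (intro arc_rel_real_rel mono_rel_Id_on) (auto intro: finite_subset simp: Id_on_def)
  have P0: "P \<subseteq> {0..} \<times> {0..}" using P by (simp add: arc_rel_def)
  have e: "epush W ^^ (N + 1) = cpush W (real (N + 1))" by (rule epush_funpow)
  have base: "pclass ?M X (un ?LD ?L) = pclass ?M X (lin (apt W) x0 (?A \<union> rshift (real (N + 1)) P))"
  proof (rule pclass_cong)
    fix t :: real assume t: "t \<in> {0..1}"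
    have "\<phi> (apt D (real i)) = apt W (real i)" if "i \<in> A" for i
      using \<phi> A that unfolding arc_embedding_def by blast
    then have "move_conf \<phi> (?LD t) = lin (apt W) x0 ?A t"
      unfolding real_rel_Id_on Id_on_lin move_conf_def image_image by auto
    then show "un ?LD ?L t = lin (apt W) x0 (?A \<union> rshift (real (N + 1)) P) t"
      unfolding un_def e lin_Un using move_conf_cpush_lin[OF P0 t, of "real (N + 1)"] by simp
  qed
  have emb: "embedding_map (Spc D) ?M \<phi>"
    and img: "\<phi> ` topspace (Spc D) \<subseteq> Col W ` (Bdy W \<times> {0..ennreal (real N + 1/2)})"
    using \<phi> by (auto simp: arc_embedding_def)
  have \<phi>c: "continuous_map (Spc D) ?M \<phi>"
    using homeomorphic_imp_continuous_map emb
    unfolding embedding_map_def by (metis continuous_map_in_subtopology)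
  have \<phi>i: "inj_on \<phi> (topspace (Spc D))"
    using emb homeomorphic_imp_injective_map unfolding embedding_map_def by blast
  have disj: "\<phi> w \<noteq> cpush W (real (N + 1)) z" if w: "w \<in> topspace (Spc D)" for w z
  proof
    assume eq: "\<phi> w = cpush W (real (N + 1)) z"
    obtain y s where y: "y \<in> Bdy W" "s \<le> ennreal (real N + 1/2)" "\<phi> w = Col W (y, s)"
      using img w by fastforce
    have "ennreal (real (N + 1)) \<le> s"
      using cpush_range[OF y(1), of "real (N + 1)" z s] eq y(3) by simp
    then have "ennreal (real (N + 1)) \<le> ennreal (real N + 1/2)" using y(2) by (rule order_trans)
    then show False by (subst (asm) ennreal_le_iff) auto
  qed
  have "pclass ?M X (un \<beta> \<gamma>) = pclass ?M X (un ?LD ?L)"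
    if \<beta>: "\<beta> \<in> pclass (Spc D) X ?LD" and \<gamma>: "\<gamma> \<in> pclass ?M X ?L" for \<beta> \<gamma>
  proof -
    let ?k = "card (?LD 0)" and ?l = "card (?L 0)"
    obtain h where h: "strand_homotopy (Spc D) X {..<?k} h ?LD \<beta>"
      using pclassE[OF D.hausdorff \<beta>] by blast
    obtain g where g: "strand_homotopy ?M X {..<?l} g ?L \<gamma>"
      using pclassE[OF hausdorff \<gamma>] by blast
    note H = strand_homotopyD[OF h] and G = strand_homotopyD[OF g]
    define f where "f j z = (case j of Inl i \<Rightarrow> (\<phi> (fst (h i z)), snd (h i z))
        | Inr i \<Rightarrow> (cpush W (real (N + 1)) (fst (g i z)), snd (g i z)))" for j z
    let ?I = "{..<?k} <+> {..<?l}"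
    have htop: "fst (h i z) \<in> topspace (Spc D)" if "i < ?k" "z \<in> {0..1} \<times> {0..1}" for i z
    proof -
      have "h i z \<in> topspace (prod_topology (Spc D) X)"
        using continuous_map_funspace[OF H(1)] that by (auto simp: Pi_iff)
      then show ?thesis by (auto simp: mem_Times_iff)
    qed
    have "strand_homotopy ?M X ?I f (un ?LD ?L) (un \<beta> \<gamma>)"
      unfolding strand_homotopy_def
    proof (intro conjI ballI)
      fix j assume "j \<in> ?I"
      then show "continuous_map (top_of_set ({0..1} \<times> {0..1})) (prod_topology ?M X) (f j)"
      proof (elim PlusE)
        fix i assume i: "i \<in> {..<?k}" "j = Inl i"
        have "continuous_map (top_of_set ({0..1} \<times> {0..1})) (Spc D) (\<lambda>z. fst (h i z))"
          using continuous_map_compose[OF H(1)[OF i(1)] continuous_map_fst] by (simp add: o_def)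
        from continuous_map_compose[OF this \<phi>c]
        have "continuous_map (top_of_set ({0..1} \<times> {0..1})) ?M (\<lambda>z. \<phi> (fst (h i z)))"
          by (simp add: o_def)
        moreover have "continuous_map (top_of_set ({0..1} \<times> {0..1})) X (\<lambda>z. snd (h i z))"
          using continuous_map_compose[OF H(1)[OF i(1)] continuous_map_snd] by (simp add: o_def)
        ultimately show ?thesis unfolding f_def i(2) sum.case by (rule continuous_map_pairedI)
      next
        fix i assume i: "i \<in> {..<?l}" "j = Inr i"
        show ?thesis unfolding f_def i(2) sum.case
          by (rule push_strand_cont[OF G(1)[OF i(1)]]) auto
      qed
    next
      fix z :: "real \<times> real" assume z: "z \<in> {0..1} \<times> {0..1}"
      have "i = i'" if "i < ?k" "i' < ?k" "fst (f (Inl i) z) = fst (f (Inl i') z)" for i i'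
        using inj_onD[OF \<phi>i] inj_onD[OF H(2)[OF z], of i i'] htop[OF _ z] that by (auto simp: f_def)
      moreover have "i = i'" if "i < ?l" "i' < ?l" "fst (f (Inr i) z) = fst (f (Inr i') z)" for i i'
        using injD[OF cpush_inj] inj_onD[OF G(2)[OF z], of i i'] that by (auto simp: f_def)
      moreover have "fst (f (Inl i) z) \<noteq> fst (f (Inr i') z)" if "i < ?k" for i i'
        using disj[OF htop[OF that z]] by (simp add: f_def)
      ultimately show "inj_on (\<lambda>j. fst (f j z)) ?I"
      proof (intro inj_onI; elim PlusE)
        fix x y i i' assume *: "\<And>i i'. i < ?k \<Longrightarrow> fst (f (Inl i) z) \<noteq> fst (f (Inr i') z)"
          and xy: "fst (f x z) = fst (f y z)"
        show "x = y" if "i \<in> {..<?l}" "x = Inr i" "i' \<in> {..<?k}" "y = Inl i'"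
          using *[of i' i] xy that by simp
      qed simp_all
    next
      fix t :: real assume t: "t \<in> {0..1}"
      have "(\<lambda>j. f j w) ` ?I = move_conf \<phi> ((\<lambda>i. h i w) ` {..<?k}) \<union>
          move_conf (cpush W (real (N + 1))) ((\<lambda>i. g i w) ` {..<?l})" for w
        unfolding move_conf_def Plus_def image_Un image_image split_beta f_def by simp
      then show "un ?LD ?L t = (\<lambda>j. f j (0, t)) ` ?I" "un \<beta> \<gamma> t = (\<lambda>j. f j (1, t)) ` ?I"
        unfolding un_def e H(3)[OF t] H(4)[OF t] G(3)[OF t] G(4)[OF t] by simp_all
    next
      fix j and s :: real assume j: "j \<in> ?I" and s: "s \<in> {0..1}"
      show "f j (s, 0) = f j (0, 0)" "f j (s, 1) = f j (0, 1)"
        using j H(5,6)[OF _ s] G(5,6)[OF _ s] by (elim PlusE; simp only: f_def sum.case)+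
    qed
    then have "un \<beta> \<gamma> \<in> pclass ?M X (un ?LD ?L)" by (intro pclassI) auto
    then show ?thesis by (rule pclass_eq)
  qed
  moreover have "?LD \<in> pclass (Spc D) X ?LD" by (rule Darc.lin_refl[OF fA])
  moreover have "?L \<in> pclass ?M X ?L" by (rule arc.lin_refl[OF P])
  ultimately have "(\<Union>\<beta>\<in>pclass (Spc D) X ?LD. \<Union>\<gamma>\<in>pclass ?M X ?L. pclass ?M X (un \<beta> \<gamma>)) = pclass ?M X (un ?LD ?L)"
    by blast
  then show ?thesis using base unfolding un_def by simp
qed

end

section \<open>Comparison of the stabilisers\<close>

text \<open>Pairs of start and end points of \<open>slide\<close>. The gap N + 1 - m is a difference
  of naturals, faithful to the real one when m \<le> N.\<close>

definition slide_rel :: "nat \<Rightarrow> nat \<Rightarrow> nat \<Rightarrow> (nat \<times> nat) set" where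
  "slide_rel N m l = (\<lambda>i. (i, if i \<le> m then i else i + (N + 1 - m))) ` {1..m + l}"

lemma mem_slide_rel:
  "(i, j) \<in> slide_rel N m l \<longleftrightarrow> 1 \<le> i \<and> i \<le> m + l \<and> j = (if i \<le> m then i else i + (N + 1 - m))"
  by (auto simp: slide_rel_def)

lemma arc_rel_slide_rel: "m \<le> N \<Longrightarrow> arc_rel (real_rel (slide_rel N m l))"
  by (rule arc_rel_real_rel) (auto simp: slide_rel_def mono_rel_def split: if_splits)

lemma slide_eq_lin:
  assumes "m \<le> N"
  shows "slide W x0 N m l t = lin (apt W) x0 (real_rel (slide_rel N m l)) t"
    and "slide W x0 N m l (1 - t) = lin (apt W) x0 ((real_rel (slide_rel N m l))\<inverse>) t"
proof -
  let ?b = "\<lambda>i. if i \<le> m then i else i + (N + 1 - m)"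
  have r: "real (?b i) = real i + (if i \<le> m then 0 else real N + 1 - real m)" for i
    using assms by (auto simp: of_nat_diff)
  have "lin (apt W) x0 (real_rel (slide_rel N m l)) t =
      (\<lambda>i. (apt W ((1 - t) * real i + t * real (?b i)), x0)) ` {1..m + l}"
    unfolding lin_def real_rel_def slide_rel_def image_image by simp
  also have "\<dots> = slide W x0 N m l t"
    unfolding slide_def r by (rule image_cong) (auto simp: algebra_simps)
  finally show "slide W x0 N m l t = lin (apt W) x0 (real_rel (slide_rel N m l)) t" by simp
  have "(real_rel (slide_rel N m l))\<inverse> = (\<lambda>i. (real (?b i), real i)) ` {1..m + l}"
    unfolding real_rel_def slide_rel_def image_image by auto
  then have "lin (apt W) x0 ((real_rel (slide_rel N m l))\<inverse>) t =
      (\<lambda>i. (apt W ((1 - t) * real (?b i) + t * real i), x0)) ` {1..m + l}"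
    unfolding lin_def by (simp add: image_image)
  also have "\<dots> = slide W x0 N m l (1 - t)"
    unfolding slide_def r by (rule image_cong) (auto simp: algebra_simps)
  finally show "slide W x0 N m l (1 - t) = lin (apt W) x0 ((real_rel (slide_rel N m l))\<inverse>) t" by simp
qed

text \<open>With N = m the slides move the points after the m-th by one place, so m + i goes to m +
  1 + i, the position to which the push by N + 1 moves point i. Sliding out, applying P there and
  sliding back takes m + i to m + j.\<close>

lemma slide_rel_conj:
  assumes P: "P \<subseteq> {1..l} \<times> {1..l'}"
  shows "(slide_rel m m l O (Id_on {1..m} \<union> (\<lambda>(i, j). (m + 1 + i, m + 1 + j)) ` P)) O
      (slide_rel m m l')\<inverse> = shift_rel m P"
proof (intro equalityI subrelI)
  fix a d assume "(a, d) \<in> (slide_rel m m l O (Id_on {1..m} \<union> (\<lambda>(i, j). (m + 1 + i, m + 1 + j)) ` P)) O (slide_rel m m l')\<inverse>"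
  then obtain b c where *: "(a, b) \<in> slide_rel m m l" "(d, c) \<in> slide_rel m m l'"
      "(b, c) \<in> Id_on {1..m} \<or> (\<exists>i j. (i, j) \<in> P \<and> b = m + 1 + i \<and> c = m + 1 + j)"
    by (auto simp: image_iff)
  from *(3) show "(a, d) \<in> shift_rel m P"
  proof (elim disjE exE conjE)
    assume "(b, c) \<in> Id_on {1..m}"
    then show ?thesis using *(1,2) by (auto simp: mem_slide_rel shift_rel_iff split: if_splits)
  next
    fix i j assume ij: "(i, j) \<in> P" "b = m + 1 + i" "c = m + 1 + j"
    then have "a = m + i" "d = m + j" using *(1,2) P by (auto simp: mem_slide_rel split: if_splits)
    then show ?thesis using ij(1) by (auto simp: shift_rel_iff)
  qed
next
  fix a d assume "(a, d) \<in> shift_rel m P"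
  then consider "a = d" "1 \<le> a" "a \<le> m" | i j where "(i, j) \<in> P" "a = m + i" "d = m + j"
    by (auto simp: shift_rel_iff)
  then show "(a, d) \<in> (slide_rel m m l O (Id_on {1..m} \<union> (\<lambda>(i, j). (m + 1 + i, m + 1 + j)) ` P)) O (slide_rel m m l')\<inverse>"
  proof cases
    case 1
    then have "(a, a) \<in> slide_rel m m l" "(a, a) \<in> Id_on {1..m}" "(d, a) \<in> slide_rel m m l'"
      by (auto simp: mem_slide_rel)
    then show ?thesis by blast
  next
    case (2 i j)
    then have "(a, m + 1 + i) \<in> slide_rel m m l" "(d, m + 1 + j) \<in> slide_rel m m l'"
      using P by (auto simp: mem_slide_rel)
    moreover have "(m + 1 + i, m + 1 + j) \<in> (\<lambda>(i, j). (m + 1 + i, m + 1 + j)) ` P" using 2 by force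
    ultimately show ?thesis by blast
  qed
qed

text \<open>Again N = m, but the source has no points from the disc. Sliding out moves i by m + 1,
  sliding back subtracts 1, and the net effect is the shift by m.\<close>

lemma slide_rel_nat:
  "(slide_rel m 0 l O (Id_on {} \<union> (\<lambda>(i, j). (m + 1 + i, m + 1 + j)) ` Id_on {1..l})) O
      (slide_rel m m l)\<inverse> = (\<lambda>i. (i, m + i)) ` {1..l}"
proof (intro equalityI subrelI)
  fix a d assume "(a, d) \<in> (slide_rel m 0 l O (Id_on {} \<union> (\<lambda>(i, j). (m + 1 + i, m + 1 + j)) ` Id_on {1..l})) O (slide_rel m m l)\<inverse>"
  then show "(a, d) \<in> (\<lambda>i. (i, m + i)) ` {1..l}"
    by (auto simp: mem_slide_rel image_iff Id_on_iff split: if_splits)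
next
  fix a d assume "(a, d) \<in> (\<lambda>i. (i, m + i)) ` {1..l}"
  then have *: "d = m + a" "1 \<le> a" "a \<le> l" by auto
  then have "(a, m + 1 + a) \<in> slide_rel m 0 l" "(d, m + 1 + a) \<in> slide_rel m m l"
    by (auto simp: mem_slide_rel)
  moreover have "(m + 1 + a, m + 1 + a) \<in> (\<lambda>(i, j). (m + 1 + i, m + 1 + j)) ` Id_on {1..l}"
    using * by (force simp: Id_on_iff)
  ultimately show "(a, d) \<in> (slide_rel m 0 l O (Id_on {} \<union> (\<lambda>(i, j). (m + 1 + i, m + 1 + j)) ` Id_on {1..l})) O (slide_rel m m l)\<inverse>"
    by blast
qed

text \<open>A partial braid out of 0 has k = 0, so its configurations are all empty. Uniqueness
  follows because a class depends only on the values on the unit interval.\<close>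

lemma initial_braid:
  "(THE f. f \<in> homset (braid_cat D X x0) 0 m) = (0, m, pclass (Spc D) X (\<lambda>t. {}))"
proof (rule the_equality)
  have "pathin (conf_space 0 (Spc D) X) (\<lambda>t. {})"
    using strands_pathin[of "{} :: nat set" "Spc D" X undefined "\<lambda>t. {}"] by (simp add: strands_def)
  then show "(0, m, pclass (Spc D) X (\<lambda>t. {})) \<in> homset (braid_cat D X x0) 0 m"
    unfolding homset_def braid_cat_def by auto
next
  fix f assume "f \<in> homset (braid_cat D X x0) 0 m"
  then obtain \<gamma> where f: "f = (0, m, pclass (Spc D) X \<gamma>)" "pathin (conf_space 0 (Spc D) X) \<gamma>"
    unfolding homset_def braid_cat_def by auto
  have "\<gamma> t = {}" if "t \<in> {0..1}" for t
    using pathin_conf_space_card(1,3)[OF f(2) that] by simp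
  then have "pclass (Spc D) X \<gamma> = pclass (Spc D) X (\<lambda>t. {})" by (rule pclass_cong)
  then show "f = (0, m, pclass (Spc D) X (\<lambda>t. {}))" unfolding f(1) by simp
qed

text \<open>The action on arrows of the comparison from order-preserving injections to partial
  braids, which is the identity on objects. It is the map J in the transfer of degrees.\<close>

definition slide_arr :: "'m collared \<Rightarrow> 'x topology \<Rightarrow> 'x \<Rightarrow> nat \<times> nat \<times> (nat \<times> nat) set \<Rightarrow> ('m, 'x) pbraid" where
  "slide_arr W X x0 = (\<lambda>(m, m', P). (m, m', pclass (Spc W) X (lin (apt W) x0 (real_rel P))))"

lemma Idn_braid_cat: "Idn (braid_cat W X x0) m = slide_arr W X x0 (m, m, Id_on {1..m})"
proof -
  have "(\<lambda>t. std_conf W x0 m) = lin (apt W) x0 (real_rel (Id_on {1..m}))"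
    by (rule ext) (rule std_conf_eq_lin)
  then show ?thesis by (simp add: slide_arr_def braid_cat_def)
qed

section \<open>Matching both structures with the combinatorial model\<close>

context pushable_space
begin

lemma slide_arr_Arr:
  assumes "f \<in> Arr oinj_cat"
  shows "slide_arr W X x0 f \<in> homset (braid_cat W X x0) (Dom oinj_cat f) (Cod oinj_cat f)"
proof -
  obtain m m' P where f: "f = (m, m', P)" by (cases f)
  have P: "P \<subseteq> {1..m} \<times> {1..m'}" "Domain P = {1..m}" "mono_rel P"
    using assms by (auto simp: f Arr_oinj_cat)
  note arc = oinj_arc_rel[OF assms[unfolded f]]
  have "card (real_rel P) = card P"
    unfolding real_rel_def by (rule card_image) (auto simp: inj_on_def)
  moreover have "card P = m" "card P \<le> m'"
    using card_mono_rel_Domain[OF P(3)] card_mono_rel_Range[OF P(3)] P(2)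
      card_mono[of "{1..m'}" "Range P"] P(1) by auto
  ultimately have "card (real_rel P) \<le> min m m'" by simp
  moreover have "pathin (conf_space (card (real_rel P)) (Spc W) X) (lin (apt W) x0 (real_rel P))"
    by (rule arc.lin_pathin[OF arc(1)])
  moreover have "lin (apt W) x0 (real_rel P) 0 \<subseteq> std_conf W x0 m"
    "lin (apt W) x0 (real_rel P) 1 \<subseteq> std_conf W x0 m'"
    using P(1) by (force simp: lin_def real_rel_def std_conf_def)+
  ultimately show ?thesis
    unfolding homset_def braid_cat_def slide_arr_def f by auto
qed

lemma slide_arr_Cmp:
  assumes "(m, m', P) \<in> Arr oinj_cat" "(l, l', Q) \<in> Arr oinj_cat"
  shows "Cmp (braid_cat W X x0) (slide_arr W X x0 (l, l', Q)) (slide_arr W X x0 (m, m', P)) =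
    slide_arr W X x0 (m, l', P O Q)"
  unfolding slide_arr_def braid_cat_def
  using arc.partial_comp_lin[OF oinj_arc_rel(1)[OF assms(1)] oinj_arc_rel(1)[OF assms(2)]]
  by (simp add: real_rel_relcomp)

lemma is_functor_slide_arr:
  assumes T: "is_functor (braid_cat W X x0) A T"
  shows "is_functor oinj_cat A (fcomp T \<lparr>FObj = id, FArr = slide_arr W X x0\<rparr>)"
proof -
  have J: "slide_arr W X x0 f \<in> Arr (braid_cat W X x0)"
    "Dom (braid_cat W X x0) (slide_arr W X x0 f) = Dom oinj_cat f"
    "Cod (braid_cat W X x0) (slide_arr W X x0 f) = Cod oinj_cat f" if "f \<in> Arr oinj_cat" for f
    using slide_arr_Arr[OF that] by (auto simp: homset_def)
  have O: "Obj (braid_cat W X x0) = UNIV" by (simp add: braid_cat_def)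
  have "FArr T (slide_arr W X x0 (Cmp oinj_cat g f)) =
      Cmp A (FArr T (slide_arr W X x0 g)) (FArr T (slide_arr W X x0 f))"
    if f: "f \<in> Arr oinj_cat" and g: "g \<in> Arr oinj_cat" and fg: "Cod oinj_cat f = Dom oinj_cat g" for f g
  proof -
    obtain m m' P l l' Q where fg': "f = (m, m', P)" "g = (l, l', Q)" by (cases f, cases g) auto
    have "slide_arr W X x0 (Cmp oinj_cat g f) =
        Cmp (braid_cat W X x0) (slide_arr W X x0 g) (slide_arr W X x0 f)"
      using slide_arr_Cmp f g unfolding fg' by simp
    then show ?thesis using T J[OF f] J[OF g] fg by (simp add: is_functor_def)
  qed
  moreover have "FArr T (slide_arr W X x0 (Idn oinj_cat m)) = Idn A (FObj T m)" for m
    using T O unfolding is_functor_def by (metis Idn_braid_cat UNIV_I oinj_cat_simps(4))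
  ultimately show ?thesis
    using T J O unfolding is_functor_def fcomp_def homset_def by auto
qed

lemma s_functor_slide_arr:
  assumes "(l, l', P) \<in> Arr oinj_cat"
  shows "FArr (s_functor W X x0) (slide_arr W X x0 (l, l', P)) = slide_arr W X x0 (1 + l, 1 + l', shift_rel 1 P)"
proof -
  have P: "P \<subseteq> {1..l} \<times> {1..l'}" using assms by (auto simp: Arr_oinj_cat)
  have pos: "real_rel P \<subseteq> {0<..} \<times> {0<..}" using P by (force simp: real_rel_def)
  have "{(1, 1)} \<union> rshift 1 (real_rel P) = real_rel (shift_rel 1 P)"
    using rshift_real_rel[of 1 P] unfolding shift_rel_def real_rel_Un by (auto simp: real_rel_def Id_on_def)
  then show ?thesis
    unfolding s_functor_def slide_arr_def
    using s_functor_lin[OF oinj_arc_rel(1)[OF assms] pos] by simp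
qed

text \<open>The paths themselves agree, not only their classes: at time t the linear slide has its
  i-th point at i + t.\<close>

lemma iota_slide_arr: "iota W X x0 l = slide_arr W X x0 (l, 1 + l, (\<lambda>i. (i, 1 + i)) ` {1..l})"
proof -
  have "lin (apt W) x0 (real_rel ((\<lambda>i. (i, 1 + i)) ` {1..l})) = (\<lambda>t. (\<lambda>i. (apt W (real i + t), x0)) ` {1..l})"
    unfolding lin_def real_rel_def image_image fun_eq_iff
    by (intro allI image_cong) (auto simp: algebra_simps)
  then show ?thesis unfolding iota_def slide_arr_def by simp
qed

text \<open>Unequal m and m' are allowed because two arrows of the disc category are meant: the
  identity of m, with \<open>A = {1..m}\<close>, and the unique arrow from 0 to m, with A empty. In
  both cases N = m.\<close>

lemma oplus_lin:
  fixes D :: "'d collared"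
  assumes D: "collared_space D" and \<phi>: "arc_embedding D W N (\<phi> N)" and N: "N = max m m'"
    and A: "A \<subseteq> {1..N}" and P: "finite P" "mono_rel P" "P \<subseteq> {1..l} \<times> {1..l'}"
  shows "oplus W X x0 \<phi> (m, m', pclass (Spc D) X (lin (apt D) x0 (real_rel (Id_on A))))
      (slide_arr W X x0 (l, l', P)) =
    slide_arr W X x0 (m + l, m' + l', (slide_rel N m l O
      (Id_on A \<union> (\<lambda>(i, j). (N + 1 + i, N + 1 + j)) ` P)) O (slide_rel N m' l')\<inverse>)"
proof -
  let ?R = "Id_on A \<union> (\<lambda>(i, j). (N + 1 + i, N + 1 + j)) ` P"
  have le: "m \<le> N" "m' \<le> N" using N by auto
  note aP = arc_rel_real_rel[OF P(1,2)]
  have R: "real_rel (Id_on A) \<union> rshift (real (N + 1)) (real_rel P) = real_rel ?R"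
    unfolding rshift_real_rel real_rel_Un ..
  have aR: "arc_rel (real_rel ?R)"
    unfolding R[symmetric]
  proof (rule arc_rel_Un)
    show "arc_rel (real_rel (Id_on A))"
      using A by (intro arc_rel_real_rel mono_rel_Id_on) (auto intro: finite_subset simp: Id_on_def)
    show "arc_rel (rshift (real (N + 1)) (real_rel P))" by (rule arc_rel_rshift[OF aP]) simp
  qed (use A in \<open>force simp: real_rel_def rshift_def\<close>)
  note mid = oplus_mid_lin[OF D \<phi> A aP, unfolded R]
  have s1: "pclass (Spc W) X (slide W x0 N m l) = pclass (Spc W) X (lin (apt W) x0 (real_rel (slide_rel N m l)))"
    by (rule pclass_cong) (rule slide_eq_lin(1)[OF le(1)])
  have s2: "pclass (Spc W) X (\<lambda>t. slide W x0 N m' l' (1 - t)) =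
      pclass (Spc W) X (lin (apt W) x0 ((real_rel (slide_rel N m' l'))\<inverse>))"
    by (rule pclass_cong) (rule slide_eq_lin(2)[OF le(2)])
  note a1 = arc_rel_slide_rel[OF le(1), of l] and a2 = arc_rel_converse[OF arc_rel_slide_rel[OF le(2), of l']]
  have "partial_comp (Spc W) X (partial_comp (Spc W) X
       (pclass (Spc W) X (lin (apt W) x0 (real_rel (slide_rel N m l))))
       (pclass (Spc W) X (lin (apt W) x0 (real_rel ?R))))
       (pclass (Spc W) X (lin (apt W) x0 ((real_rel (slide_rel N m' l'))\<inverse>))) =
     pclass (Spc W) X (lin (apt W) x0 (real_rel ((slide_rel N m l O ?R) O (slide_rel N m' l')\<inverse>)))"
    using arc.partial_comp_lin[OF a1 aR] arc.partial_comp_lin[OF arc_rel_relcomp[OF a1 aR] a2]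
    by (simp add: real_rel_relcomp real_rel_converse)
  then show ?thesis
    unfolding oplus_def slide_arr_def Let_def prod.case N[symmetric] mid s1 s2 by simp
qed

lemma ddagger_SFun_slide_arr:
  fixes D :: "'d collared"
  assumes D: "collared_space D" and \<phi>: "arc_embedding D W m (\<phi> m)" and f: "(l, l', P) \<in> Arr oinj_cat"
  shows "FArr (SFun (ddagger D W X x0 \<phi>) m) (slide_arr W X x0 (l, l', P)) =
    slide_arr W X x0 (m + l, m + l', shift_rel m P)"
proof -
  have P: "P \<subseteq> {1..l} \<times> {1..l'}" "mono_rel P" "finite P"
    using f oinj_arc_rel[OF f] by (auto simp: Arr_oinj_cat)
  show ?thesis
    unfolding ddagger_def Idn_braid_cat
    using oplus_lin[where \<phi> = \<phi>, OF D \<phi>, of m m "{1..m}" P l l'] P slide_rel_conj[OF P(1), of m]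
    by (simp add: slide_arr_def)
qed

lemma ddagger_SNat_slide_arr:
  fixes D :: "'d collared"
  assumes D: "collared_space D" and \<phi>: "arc_embedding D W m (\<phi> m)"
  shows "SNat (ddagger D W X x0 \<phi>) m l = slide_arr W X x0 (l, m + l, (\<lambda>i. (i, m + i)) ` {1..l})"
proof -
  have "lin (apt D) x0 (real_rel (Id_on {})) = (\<lambda>t. {})"
    by (simp add: fun_eq_iff lin_def real_rel_def)
  moreover have "finite (Id_on {1..l})" "Id_on {1..l} \<subseteq> {1..l} \<times> {1..l}" by (auto simp: Id_on_def)
  ultimately show ?thesis
    unfolding ddagger_def Idn_braid_cat initial_braid
    using oplus_lin[where \<phi> = \<phi>, OF D \<phi>, of 0 m "{}" "Id_on {1..l}" l l] mono_rel_Id_on[of "{1..l}"] slide_rel_nat[of m l]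
    by simp
qed

end

theorem proposition2p7:
  fixes M :: "'m topology"
    and atlas :: "('m set \<times> ('m \<Rightarrow> 'e::euclidean_space)) set"
    and c :: "'m \<times> ennreal \<Rightarrow> 'm" and p :: 'm
    and X :: "'x topology" and x0 :: 'x
    and cD :: "'e \<times> ennreal \<Rightarrow> 'e" and pD :: 'e
    and \<phi> :: "nat \<Rightarrow> 'e \<Rightarrow> 'm"
    and A :: "('p, 'b) cat"
    and W :: "'m collared" and D :: "'e collared"
    and T :: "(nat, ('m, 'x) pbraid, 'p, 'b) functr"
  defines "W \<equiv> \<lparr>Spc = M, Bdy = mboundary atlas, Col = c, Bpt = p\<rparr>"
    and "D \<equiv> disc cD pD"
  assumes "DIM('e) \<ge> 2"
    and "smooth_manifold_with_boundary M atlas"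
    and "is_collared W"
    and "path_connected_space X" and "x0 \<in> topspace X"
    and "is_collared D"
    and "arc_embeddings DIM('e) D W \<phi>"
    and "abelian_category A"
    and "is_functor (braid_cat W X x0) A T"
  shows "degree_wrt (braid_cat W X x0) A (dagger W X x0) T =
         degree_wrt (braid_cat W X x0) A (ddagger D W X x0 \<phi>) T"
proof -
  interpret W: pushable_space W X x0
  proof unfold_locales
    show "is_collared W" "x0 \<in> topspace X" by fact+
    show "Hausdorff_space (Spc W)"
      using \<open>smooth_manifold_with_boundary M atlas\<close> by (simp add: W_def smooth_manifold_with_boundary_def)
    show "Bdy W \<subseteq> topspace (Spc W)"
      using mboundary_subset_topspace[OF \<open>smooth_manifold_with_boundary M atlas\<close>] by (simp add: W_def)
    show "openin (Spc W) (Col W ` (Bdy W \<times> {..<\<infinity>}))"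
      using openin_collar[OF \<open>smooth_manifold_with_boundary M atlas\<close>, of c p] \<open>is_collared W\<close>
      by (simp add: W_def)
  qed
  have D: "collared_space D"
  proof
    show "is_collared D" by fact
  qed (auto simp: D_def disc_def Hausdorff_space_subtopology)
  have emb: "arc_embedding D W m (\<phi> m)" for m
    using \<open>arc_embeddings DIM('e) D W \<phi>\<close> by (simp add: arc_embeddings_def)
  interpret category_with_cokernels A
    using \<open>abelian_category A\<close> by unfold_locales (auto simp: abelian_category_def is_preadditive_def)
  let ?C = "braid_cat W X x0" and ?J = "slide_arr W X x0"
  define T' where "T' = fcomp T \<lparr>FObj = id, FArr = ?J\<rparr>"
  have T': "is_functor oinj_cat A T'"
    unfolding T'_def by (rule W.is_functor_slide_arr) fact
  have J: "Dom ?C (?J f) = Dom oinj_cat f \<and> Cod ?C (?J f) = Cod oinj_cat f" if "f \<in> Arr oinj_cat" for f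
    using W.slide_arr_Arr[OF that] by (simp add: homset_def)
  have sArr: "FArr (SFun (oinj_stab K) m) f \<in> Arr oinj_cat" if "f \<in> Arr oinj_cat" for f m K
    using that shift_rel_Arr by (cases f) auto
  \<comment> \<open>The index 1 of the model corresponds to the only element of type
    \<open>unit\<close>.\<close>
  have "deg_less ?C A (dagger W X x0) d T \<longleftrightarrow> deg_less oinj_cat A (oinj_stab {1}) d T'" for d
  proof (rule deg_less_transfer[where r = "\<lambda>_. ()" and J = ?J])
    fix i f assume i: "i \<in> SIdx (oinj_stab {1})" and f: "f \<in> Arr oinj_cat"
    obtain l l' P where "f = (l, l', P)" by (cases f)
    then show "FArr (SFun (oinj_stab {1}) i) f \<in> Arr oinj_cat \<and>
        FArr (SFun (dagger W X x0) ()) (?J f) = ?J (FArr (SFun (oinj_stab {1}) i) f)"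
      using W.s_functor_slide_arr[of l l' P] i f sArr[OF f, of "{1}" i] by (auto simp: dagger_def)
  qed (use J SNat_oinj_Arr[of _ 1] in \<open>auto simp: braid_cat_def dagger_def s_functor_def T'_def fcomp_def
      W.iota_slide_arr UNIV_unit\<close>)
  moreover have "deg_less ?C A (ddagger D W X x0 \<phi>) d T \<longleftrightarrow> deg_less oinj_cat A (oinj_stab UNIV) d T'" for d
  proof (rule deg_less_transfer[where r = id and J = ?J])
    fix i f assume f: "f \<in> Arr oinj_cat"
    obtain l l' P where "f = (l, l', P)" by (cases f)
    then show "FArr (SFun (oinj_stab UNIV) i) f \<in> Arr oinj_cat \<and>
        FArr (SFun (ddagger D W X x0 \<phi>) (id i)) (?J f) = ?J (FArr (SFun (oinj_stab UNIV) i) f)"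
      using W.ddagger_SFun_slide_arr[where \<phi> = \<phi>, OF D emb, of l l' P] f sArr[OF f] by simp
  next
    fix i x
    show "SNat (oinj_stab UNIV) i x \<in> Arr oinj_cat \<and>
        SNat (ddagger D W X x0 \<phi>) (id i) x = ?J (SNat (oinj_stab UNIV) i x)"
      using W.ddagger_SNat_slide_arr[where \<phi> = \<phi>, OF D emb] SNat_oinj_Arr by simp
  qed (use J in \<open>auto simp: braid_cat_def ddagger_def T'_def fcomp_def\<close>)
  moreover have "deg_less oinj_cat A (oinj_stab {1}) d T' \<longleftrightarrow> deg_less oinj_cat A (oinj_stab UNIV) d T'" for d
    using deg_less_oinj_all[OF T'] deg_less_oinj_mono by blast
  ultimately show ?thesis
    unfolding degree_wrt_def by simp
qed

end
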